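(* Let $n\ge1$, $p\in[1,\infty)$. For each $\mathcal A\in\{\mathcal D,\mathcal S,W^{\infty,p},\mathcal B\}$ the set $$\mathrm{Diff}\,\mathcal A(\mathbb R^n):=\big\{F=\mathrm{Id}+f:\ f\in\mathcal A(\mathbb R^n,\mathbb R^n),\ \inf_{x\in\mathbb R^n}\det(\mathbb I_n+df(x))>0\big\}$$ is a $C^\infty$ Lie group with respect to composition of mappings.
   Context: Spaces, with their natural locally convex topologies: $\mathcal D(\mathbb R^n,\mathbb R^n)$ is the space of compactly supported $C^\infty$-mappings (inductive limit topology over compact supports); $\mathcal S(\mathbb R^n,\mathbb R^n)$ is the Schwartz space of rapidly decreasing mappings; $W^{\infty,p}(\mathbb R^n,\mathbb R^n)$ is the Fréchet space of $C^\infty$-mappings all of whose partial derivatives $f^{(\alpha)}$ (including $\alpha=0$) lie in $L^p$; $\mathcal B(\mathbb R^n,\mathbb R^n)$ is the Fréchet space of $C^\infty$-mappings all of whose derivatives (including order $0$) are globally bounded. $\mathbb I_n$ is the identity matrix and $df(x)$ the Jacobian. $C^\infty$ is understood in the sense of convenient calculus: a mapping between $c^\infty$-open subsets of convenient (Mackey complete locally convex) vector spaces is $C^\infty$ if it maps $C^\infty$-curves to $C^\infty$-curves; a set is $c^\infty$-open if its preimage under every $C^\infty$-curve is open. "$\mathrm{Diff}\,\mathcal A(\mathbb R^n)$ is a $C^\infty$ Lie group" means: it is a group under composition (consisting of $C^\infty$-diffeomorphisms of $\mathbb R^n$), it is a $C^\infty$-manifold modelled on $\mathcal A(\mathbb R^n,\mathbb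 R^n)$ via the single global chart $\mathrm{Id}+f\mapsto f$ onto a $c^\infty$-open subset of $\mathcal A(\mathbb R^n,\mathbb R^n)$, and the group operations (composition and inversion) are $C^\infty$ in this chart. *)

theory Defs
  imports
    "HOL-Analysis.Analysis"
    "HOL-Library.Function_Algebras"
    "HOL-Algebra.Group"
begin

instantiation "fun" :: (type, real_vector) real_vector
begin

definition scaleR_fun :: "real \<Rightarrow> ('a \<Rightarrow> 'b) \<Rightarrow> 'a \<Rightarrow> 'b" where
  "scaleR_fun a f = (\<lambda>x. a *\<^sub>R f x)"

instance
  by standard (simp_all add: scaleR_fun_def plus_fun_def fun_eq_iff algebra_simps)

end

text \<open>
  A locally convex space is given by its topology \<open>T\<close>; the underlying vector space is
  \<open>topspace T\<close>, a linear subspace of the ambient type. This topology is unrelated to a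
  type class topology that the ambient type may carry. Hausdorffness is not included here.
\<close>

definition lctvs :: "'a::real_vector topology \<Rightarrow> bool" where
  "lctvs T \<longleftrightarrow>
     subspace (topspace T) \<and>
     continuous_map (prod_topology T T) T (\<lambda>(x, y). x + y) \<and>
     continuous_map (prod_topology euclideanreal T) T (\<lambda>(a, x). a *\<^sub>R x) \<and>
     (\<forall>U. openin T U \<and> 0 \<in> U \<longrightarrow> (\<exists>V. openin T V \<and> 0 \<in> V \<and> convex V \<and> V \<subseteq> U))"

definition seminorm_topology :: "'a::real_vector set \<Rightarrow> ('a \<Rightarrow> real) set \<Rightarrow> 'a topology" where
  "seminorm_topology E Q = topology (\<lambda>U. U \<subseteq> E \<and>
     (\<forall>f\<in>U. \<exists>F e. finite F \<and> F \<subseteq> Q \<and> 0 < e \<and> {g \<in> E. \<forall>q\<in>F. q (g - f) < e} \<subseteq> U))"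

lemma openin_seminorm_topology:
  "openin (seminorm_topology E Q) U \<longleftrightarrow> U \<subseteq> E \<and>
     (\<forall>f\<in>U. \<exists>F e. finite F \<and> F \<subseteq> Q \<and> 0 < e \<and> {g \<in> E. \<forall>q\<in>F. q (g - f) < e} \<subseteq> U)"
proof -
  let ?N = "\<lambda>U f. \<exists>F e. finite F \<and> F \<subseteq> Q \<and> 0 < (e::real) \<and> {g \<in> E. \<forall>q\<in>F. q (g - f) < e} \<subseteq> U"
  have inter: "?N (S \<inter> T) f" if S: "?N S f" and T: "?N T f" for S T f
  proof -
    obtain F e where F: "finite F" "F \<subseteq> Q" "0 < e" "{g \<in> E. \<forall>q\<in>F. q (g - f) < e} \<subseteq> S"
      using S by blast
    obtain G d where G: "finite G" "G \<subseteq> Q" "0 < d" "{g \<in> E. \<forall>q\<in>G. q (g - f) < d} \<subseteq> T"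
      using T by blast
    have "finite (F \<union> G) \<and> F \<union> G \<subseteq> Q \<and> 0 < min e d \<and>
        {g \<in> E. \<forall>q\<in>F \<union> G. q (g - f) < min e d} \<subseteq> S \<inter> T"
      using F G by auto
    then show ?thesis by blast
  qed
  have mono: "?N T f" if S: "?N S f" and "S \<subseteq> T" for S T f
  proof -
    obtain F e where "finite F" "F \<subseteq> Q" "0 < e" "{g \<in> E. \<forall>q\<in>F. q (g - f) < e} \<subseteq> S"
      using S by blast
    with \<open>S \<subseteq> T\<close> show ?thesis
      by (intro exI[of _ F] exI[of _ e]) auto
  qed
  have Int: "S \<inter> T \<subseteq> E \<and> (\<forall>f\<in>S \<inter> T. ?N (S \<inter> T) f)"
    if "S \<subseteq> E \<and> (\<forall>f\<in>S. ?N S f)" "T \<subseteq> E \<and> (\<forall>f\<in>T. ?N T f)" for S T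
  proof (intro conjI ballI)
    show "S \<inter> T \<subseteq> E"
      using that by blast
    fix f assume "f \<in> S \<inter> T"
    then have "?N S f" "?N T f"
      using that by blast+
    then show "?N (S \<inter> T) f"
      by (rule inter)
  qed
  have Union: "\<Union>K \<subseteq> E \<and> (\<forall>f\<in>\<Union>K. ?N (\<Union>K) f)"
    if K: "\<forall>S\<in>K. S \<subseteq> E \<and> (\<forall>f\<in>S. ?N S f)" for K
  proof (intro conjI ballI)
    show "\<Union>K \<subseteq> E"
      using K by blast
    fix f assume "f \<in> \<Union>K"
    then obtain S where S: "S \<in> K" "f \<in> S" by blast
    then have "?N S f"
      using K by blast
    moreover have "S \<subseteq> \<Union>K"
      using S by blast
    ultimately show "?N (\<Union>K) f"
      by (rule mono)
  qed
  have ist: "istopology (\<lambda>U. U \<subseteq> E \<and> (\<forall>f\<in>U. ?N U f))"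
    unfolding istopology_def
    by (rule conjI, (rule allI)+, (rule impI)+, rule Int, assumption+,
        rule allI, rule impI, rule Union)
  show ?thesis
    unfolding seminorm_topology_def topology_inverse'[OF ist] by (rule refl)
qed

lemma topspace_seminorm_topology [simp]: "topspace (seminorm_topology E Q) = E"
proof
  show "topspace (seminorm_topology E Q) \<subseteq> E"
    using openin_topspace[of "seminorm_topology E Q"] by (simp only: openin_seminorm_topology)
  have "\<exists>F e. finite F \<and> F \<subseteq> Q \<and> 0 < (e::real) \<and> {g \<in> E. \<forall>q\<in>F. q (g - f) < e} \<subseteq> E" for f
    by (rule exI[of _ "{}"], rule exI[of _ 1]) simp
  then have "openin (seminorm_topology E Q) E"
    unfolding openin_seminorm_topology by blast
  then show "E \<subseteq> topspace (seminorm_topology E Q)"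
    by (rule openin_subset)
qed

text \<open>
  The finest locally convex topology on the union of the steps for which all inclusions are
  continuous: the supremum of all such topologies.
\<close>

definition lc_inductive_limit :: "'a::real_vector topology set \<Rightarrow> 'a topology" where
  "lc_inductive_limit \<T> = topology_generated_by
     (\<Union>{{U. openin T U} | T. lctvs T \<and> topspace T = (\<Union>S\<in>\<T>. topspace S) \<and>
                              (\<forall>S\<in>\<T>. continuous_map S T id)})"

lemma topspace_lc_inductive_limit:
  fixes \<T> :: "'a::real_vector topology set"
  assumes "subspace (\<Union>S\<in>\<T>. topspace S)"
  shows "topspace (lc_inductive_limit \<T>) = (\<Union>S\<in>\<T>. topspace S)"
proof -
  define E where "E = (\<Union>S\<in>\<T>. topspace S)"
  let ?I = "seminorm_topology E {}"
  have I: "openin ?I U \<longleftrightarrow> U = {} \<or> U = E" for U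
    unfolding openin_seminorm_topology by (auto intro: exI[of _ "1::real"])
  have E: "subspace E"
    using assms by (simp add: E_def)
  have cont: "continuous_map X ?I f" if "f ` topspace X \<subseteq> E" for X :: "'c topology" and f
  proof -
    have "{x \<in> topspace X. f x \<in> E} = topspace X"
      using that by auto
    then show ?thesis
      using that by (auto simp: continuous_map_def I)
  qed
  have add: "(\<lambda>(x, y). x + y) ` topspace (prod_topology ?I ?I) \<subseteq> E"
    using E by (auto simp: subspace_add)
  have scale: "(\<lambda>(a, x). a *\<^sub>R x) ` topspace (prod_topology euclideanreal ?I) \<subseteq> E"
    using E by (auto simp: subspace_scale)
  have "lctvs ?I"
    unfolding lctvs_def
  proof (intro conjI allI impI)
    show "\<exists>V. openin ?I V \<and> 0 \<in> V \<and> convex V \<and> V \<subseteq> U" if "openin ?I U \<and> 0 \<in> U" for U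
      using that subspace_imp_convex[OF E] unfolding I by (intro exI[of _ U]) blast
  qed (use E cont[OF add] cont[OF scale] in simp_all)
  moreover have "\<forall>S\<in>\<T>. continuous_map S ?I id"
    by (intro ballI cont) (auto simp: E_def)
  ultimately have "E \<in> \<Union>{{U. openin T U} | T. lctvs T \<and> topspace T = E \<and> (\<forall>S\<in>\<T>. continuous_map S T id)}"
    using I[of E] topspace_seminorm_topology[of E "{}"]
    unfolding E_def[symmetric] by blast
  then show ?thesis
    unfolding lc_inductive_limit_def topology_generated_by_topspace E_def[symmetric]
    by (auto dest: openin_subset)
qed

definition tvs_bounded :: "'a::real_vector topology \<Rightarrow> 'a set \<Rightarrow> bool" where
  "tvs_bounded T B \<longleftrightarrow> B \<subseteq> topspace T \<and>
     (\<forall>U. openin T U \<and> 0 \<in> U \<longrightarrow> (\<exists>r>0. B \<subseteq> (\<lambda>x. r *\<^sub>R x) ` U))"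

definition Mackey_Cauchy :: "'a::real_vector topology \<Rightarrow> (nat \<Rightarrow> 'a) \<Rightarrow> bool" where
  "Mackey_Cauchy T x \<longleftrightarrow> range x \<subseteq> topspace T \<and>
     (\<exists>B \<mu>. tvs_bounded T B \<and> (\<mu> \<longlongrightarrow> (0::real)) (sequentially \<times>\<^sub>F sequentially) \<and>
            (\<forall>m n. \<exists>b\<in>B. x m - x n = \<mu> (m, n) *\<^sub>R b))"

definition convenient :: "'a::real_vector topology \<Rightarrow> bool" where
  "convenient T \<longleftrightarrow> lctvs T \<and> Hausdorff_space T \<and>
     (\<forall>x. Mackey_Cauchy T x \<longrightarrow> (\<exists>l. limitin T x l sequentially))"

definition smooth_curve :: "'a::real_vector topology \<Rightarrow> (real \<Rightarrow> 'a) \<Rightarrow> bool" where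
  "smooth_curve T c \<longleftrightarrow> range c \<subseteq> topspace T \<and>
     (\<exists>d :: nat \<Rightarrow> real \<Rightarrow> 'a. d 0 = c \<and>
        (\<forall>k t. limitin T (\<lambda>h. (1 / h) *\<^sub>R (d k (t + h) - d k t)) (d (Suc k) t) (at 0)))"

definition c_infty_open :: "'a::real_vector topology \<Rightarrow> 'a set \<Rightarrow> bool" where
  "c_infty_open T U \<longleftrightarrow> U \<subseteq> topspace T \<and> (\<forall>c. smooth_curve T c \<longrightarrow> open (c -` U))"

definition convenient_smooth ::
  "'a::real_vector topology \<Rightarrow> 'a set \<Rightarrow> 'b::real_vector topology \<Rightarrow> 'b set \<Rightarrow> ('a \<Rightarrow> 'b) \<Rightarrow> bool"
where
  "convenient_smooth T U T' V f \<longleftrightarrow> f ` U \<subseteq> V \<and>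
     (\<forall>c. smooth_curve T c \<and> range c \<subseteq> U \<longrightarrow> smooth_curve T' (f \<circ> c))"

definition single_chart_lie_group ::
  "('g, 'm) monoid_scheme \<Rightarrow> 'a::real_vector topology \<Rightarrow> ('g \<Rightarrow> 'a) \<Rightarrow> bool"
where
  "single_chart_lie_group G T \<phi> \<longleftrightarrow>
     group G \<and> convenient T \<and> inj_on \<phi> (carrier G) \<and> c_infty_open T (\<phi> ` carrier G) \<and>
     (let U = \<phi> ` carrier G; \<psi> = inv_into (carrier G) \<phi> in
        convenient_smooth (prod_topology T T) (U \<times> U) T U (\<lambda>(u, v). \<phi> (\<psi> u \<otimes>\<^bsub>G\<^esub> \<psi> v)) \<and>
        convenient_smooth T U T U (\<lambda>u. \<phi> (m_inv G (\<psi> u))))"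

definition partial :: "'n \<Rightarrow> (real^'n \<Rightarrow> real^'m) \<Rightarrow> real^'n \<Rightarrow> real^'m" where
  "partial i f x = frechet_derivative f (at x) (axis i 1)"

text \<open>
  Iterated partial derivatives are indexed by lists of coordinate directions; for smooth
  \<open>f\<close> the order is irrelevant, so these are the derivatives indexed by multi-indices.
\<close>

definition partials :: "'n list \<Rightarrow> (real^'n \<Rightarrow> real^'m) \<Rightarrow> real^'n \<Rightarrow> real^'m" where
  "partials js f = foldr partial js f"

definition smooth_map :: "(real^'n \<Rightarrow> real^'m) \<Rightarrow> bool" where
  "smooth_map f \<longleftrightarrow> (\<forall>js. partials js f differentiable_on UNIV)"

definition smooth_diffeomorphism :: "(real^'n \<Rightarrow> real^'n) \<Rightarrow> bool" where
  "smooth_diffeomorphism F \<longleftrightarrow> bij F \<and> smooth_map F \<and> smooth_map (inv_into UNIV F)"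

definition sup_seminorm :: "'n list \<Rightarrow> (real^'n \<Rightarrow> real^'n) \<Rightarrow> real" where
  "sup_seminorm js f = (SUP x. norm (partials js f x))"

definition test_space_on :: "(real^'n) set \<Rightarrow> (real^'n \<Rightarrow> real^'n) topology" where
  "test_space_on K = seminorm_topology
     {f. smooth_map f \<and> closure {x. f x \<noteq> 0} \<subseteq> K} (range sup_seminorm)"

definition test_space :: "(real^'n \<Rightarrow> real^'n) topology" where
  "test_space = lc_inductive_limit (test_space_on ` {K. compact K})"

definition schwartz_seminorm :: "nat \<Rightarrow> 'n list \<Rightarrow> (real^'n \<Rightarrow> real^'n) \<Rightarrow> real" where
  "schwartz_seminorm k js f = (SUP x. (1 + (norm x)\<^sup>2) ^ k * norm (partials js f x))"

definition schwartz_space :: "(real^'n \<Rightarrow> real^'n) topology" where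
  "schwartz_space = seminorm_topology
     {f. smooth_map f \<and> (\<forall>k js. bdd_above (range (\<lambda>x. (1 + (norm x)\<^sup>2) ^ k * norm (partials js f x))))}
     {schwartz_seminorm k js | k js. True}"

definition Lp_seminorm :: "real \<Rightarrow> 'n list \<Rightarrow> (real^'n \<Rightarrow> real^'n) \<Rightarrow> real" where
  "Lp_seminorm p js f = (LINT x|lborel. norm (partials js f x) powr p) powr (1 / p)"

definition sobolev_infty :: "real \<Rightarrow> (real^'n \<Rightarrow> real^'n) topology" where
  "sobolev_infty p = seminorm_topology
     {f. smooth_map f \<and> (\<forall>js. integrable lborel (\<lambda>x. norm (partials js f x) powr p))}
     (range (Lp_seminorm p))"

definition bounded_space :: "(real^'n \<Rightarrow> real^'n) topology" where
  "bounded_space = seminorm_topology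
     {f. smooth_map f \<and> (\<forall>js. bounded (range (partials js f)))} (range sup_seminorm)"

text \<open>
  The infimum is taken in the extended reals, so that it is meaningful without knowing
  beforehand that the determinant is bounded below.
\<close>

definition Diff :: "(real^'n \<Rightarrow> real^'n) topology \<Rightarrow> (real^'n \<Rightarrow> real^'n) set" where
  "Diff A = {F. \<exists>f\<in>topspace A. F = (\<lambda>x. x + f x) \<and>
                  0 < (INF x. ereal (det (mat 1 + jacobian f (at x))))}"

definition Diff_group :: "(real^'n \<Rightarrow> real^'n) topology \<Rightarrow> (real^'n \<Rightarrow> real^'n) monoid" where
  "Diff_group A = \<lparr>carrier = Diff A, mult = (\<circ>), one = id\<rparr>"

definition Diff_chart :: "(real^'n \<Rightarrow> real^'n) \<Rightarrow> real^'n \<Rightarrow> real^'n" where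
  "Diff_chart F = (\<lambda>x. F x - x)"

definition Diff_is_lie_group :: "(real^'n \<Rightarrow> real^'n) topology \<Rightarrow> bool" where
  "Diff_is_lie_group A \<longleftrightarrow>
     (\<forall>F\<in>Diff A. smooth_diffeomorphism F) \<and>
     single_chart_lie_group (Diff_group A) A Diff_chart"

end

(*
A curve in one of the four spaces is smooth iff its components, read as functions of (t, x), have
all mixed derivatives bounded locally uniformly in t with respect to the norms of the space. Call
such functions tame. The tame functions of a space form an ideal over the functions whose
derivatives are all bounded, and this ideal is closed under partial derivatives. The derivatives
of a o G, for G (t, x) = (t, x + g (t, x)), are sums of products of bounded functions with some
a' o G, and those of a o G^(-1) are of the form a' o G^(-1), with a' tame again, because the
inverse Jacobian matrix has bounded entries by Cramer's rule. So composition and inversion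
preserve tameness by coinduction, and the Faa di Bruno formula is never needed.

A map Id + f with bounded derivatives and determinant bounded away from 0 is bijective, since it
is uniformly a local diffeomorphism, hence a covering of a simply connected space.

For the L^p norms a pointwise Sobolev inequality over unit cubes gives both the embedding into
the bounded functions and the control of a o F for any F at bounded distance from the identity.
Smooth curves of test functions are handled with the weights phi(|x|) for arbitrary
nondecreasing phi: they do not generate the inductive limit topology, but they have the same
bounded sets and the same convergent sequences.
*)
theory Submission
  imports Defs
begin

section \<open>Size bounds and tame functions of time and space\<close>

text \<open>\<open>N f C\<close> reads: the size of \<open>f\<close> is at most \<open>C\<close>. A
  predicate treats suprema, weighted suprema and L^p norms alike, and infinite size means that no
  \<open>C\<close> exists. The rules speak of continuous functions because integrals require
  measurability. Difference quotients in time have to be estimated through the time derivative, but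
  this abstraction has no integral with values in the space. \<open>Fatou\<close> fills the gap:
  Riemann sums are averages of functions of bounded size and converge pointwise. The same rule
  yields Mackey completeness. A topology is seen only through zero neighbourhoods on which a size is
  small and through null sequences. This is enough, since limits on the real line can be tested
  along sequences. Inversion is the delicate operation: the inverse is not known to be tame when its
  derivatives are to be bounded. Its chain rule coefficients, however, are evaluated at the same
  inner point as the outer function and can be absorbed into it. For composition this fails, and a
  span with bounded coefficients takes over. Statements about single maps are read off from constant
  curves.\<close>

locale size_bound =
  fixes N :: "(real^'n \<Rightarrow> real) \<Rightarrow> real \<Rightarrow> bool"
  assumes nonneg: "N f C \<Longrightarrow> 0 \<le> C"
    and zero: "N (\<lambda>x. 0) 0"
    and weaken: "N f C \<Longrightarrow> C \<le> D \<Longrightarrow> N f D"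
    and dominated: "\<lbrakk>continuous_on UNIV f; continuous_on UNIV g; N g C; 0 \<le> c;
          \<And>x. \<bar>f x\<bar> \<le> c * \<bar>g x\<bar>\<rbrakk> \<Longrightarrow> N f (c * C)"
    and triangle: "\<lbrakk>continuous_on UNIV f; continuous_on UNIV g; N f C; N g D\<rbrakk>
          \<Longrightarrow> N (\<lambda>x. f x + g x) (C + D)"
    and Fatou: "\<lbrakk>\<And>n. continuous_on UNIV (F n); continuous_on UNIV f;
          \<And>x. (\<lambda>n. F n x) \<longlonglongrightarrow> f x; \<And>n. N (F n) C\<rbrakk> \<Longrightarrow> N f C"
begin

lemma dominated1:
  "\<lbrakk>continuous_on UNIV f; continuous_on UNIV g; N g C; \<And>x. \<bar>f x\<bar> \<le> \<bar>g x\<bar>\<rbrakk> \<Longrightarrow> N f C"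
  using dominated[of f g C 1] by simp

lemma scale:
  assumes "continuous_on UNIV f" "N f C"
  shows "N (\<lambda>x. c * f x) (\<bar>c\<bar> * C)"
  by (rule dominated[OF _ assms]) (auto intro!: continuous_intros assms simp: abs_mult)

lemma difference:
  assumes "continuous_on UNIV f" "continuous_on UNIV g" "N f C" "N g D"
  shows "N (\<lambda>x. f x - g x) (C + D)"
  using triangle[OF assms(1) _ assms(3) scale[OF assms(2,4), of "-1"]] assms(2)
  by (simp add: continuous_intros)

lemma sum_bound:
  assumes "finite I" "\<And>i. i \<in> I \<Longrightarrow> continuous_on UNIV (f i)" "\<And>i. i \<in> I \<Longrightarrow> N (f i) (C i)"
  shows "N (\<lambda>x. \<Sum>i\<in>I. f i x) (\<Sum>i\<in>I. C i)"
  using assms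
  by (induction I rule: finite_induct) (auto intro!: triangle continuous_intros simp: zero)

end

definition sup_bound :: "(real^'n \<Rightarrow> real) \<Rightarrow> real \<Rightarrow> bool" where
  "sup_bound f C \<longleftrightarrow> (\<forall>x. \<bar>f x\<bar> \<le> C)"

lemma size_bound_sup: "size_bound sup_bound"
proof
  show "sup_bound f C" if "\<And>n. continuous_on UNIV (F n)" "continuous_on UNIV f"
    "\<And>x. (\<lambda>n. F n x) \<longlonglongrightarrow> f x" "\<And>n. sup_bound (F n) C" for F f C
    unfolding sup_bound_def
  proof
    fix x
    show "\<bar>f x\<bar> \<le> C"
      using that(4) by (intro tendsto_upperbound[OF tendsto_rabs[OF that(3)[of x]]]) (auto simp: sup_bound_def)
  qed
  show "sup_bound f (c * C)" if "sup_bound g C" "0 \<le> c" "\<And>x. \<bar>f x\<bar> \<le> c * \<bar>g x\<bar>" for f g C c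
    unfolding sup_bound_def
  proof
    fix x show "\<bar>f x\<bar> \<le> c * C"
      using that(3)[of x] mult_left_mono[of "\<bar>g x\<bar>" C c] that(1,2) by (force simp: sup_bound_def)
  qed
  show "sup_bound (\<lambda>x. f x + g x) (C + D)" if "sup_bound f C" "sup_bound g D" for f g C D
    using that unfolding sup_bound_def by (meson abs_triangle_ineq add_mono order_trans)
qed (auto simp: sup_bound_def intro: order_trans)

section \<open>Directional derivatives in space-time and tame functions\<close>

definition dd :: "'a::real_normed_vector \<Rightarrow> ('a \<Rightarrow> 'b::real_normed_vector) \<Rightarrow> 'a \<Rightarrow> 'b" where
  "dd v f = (\<lambda>x. frechet_derivative f (at x) v)"

lemma dd_eqI: "(f has_derivative f') (at x) \<Longrightarrow> dd v f x = f' v"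
  unfolding dd_def using frechet_derivative_at by metis

lemma partial_eq_dd: "partial i = dd (axis i 1)"
  by (simp add: partial_def dd_def fun_eq_iff)

text \<open>One finite index type for time and space lets the chain rule be a single sum over
  \<open>UNIV\<close> and lets words of directions mix both kinds.\<close>

definition dirv :: "'n option \<Rightarrow> real \<times> (real^'n)" where
  "dirv j = (case j of None \<Rightarrow> (1, 0) | Some i \<Rightarrow> (0, axis i 1))"

definition dst :: "'n option list \<Rightarrow> (real \<times> (real^'n) \<Rightarrow> real) \<Rightarrow> real \<times> (real^'n) \<Rightarrow> real" where
  "dst js u = foldr (\<lambda>j. dd (dirv j)) js u"

lemma dst_simps [simp]: "dst [] u = u" "dst (j # js) u = dd (dirv j) (dst js u)"
  by (simp_all add: dst_def)

lemma dst_append: "dst (is @ js) u = dst is (dst js u)"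
  by (simp add: dst_def)

definition tame ::
  "((real^'n \<Rightarrow> real) \<Rightarrow> real \<Rightarrow> bool) set \<Rightarrow> (real \<times> (real^'n) \<Rightarrow> real) \<Rightarrow> bool" where
  "tame \<N> u \<longleftrightarrow> (\<forall>js. dst js u differentiable_on UNIV \<and>
     (\<forall>N\<in>\<N>. \<forall>r. \<exists>C. \<forall>t. \<bar>t\<bar> \<le> r \<longrightarrow> N (\<lambda>x. dst js u (t, x)) C))"

text \<open>An induction on the word of directions keeps every iterated derivative in
  \<open>X\<close>. Proofs of tameness thus reduce to finding a class of functions that contains its
  own first derivatives.\<close>

lemma tame_coinduct [consumes 1, case_names differentiable bounded dd]:
  assumes "X u"
    and "\<And>u z. X u \<Longrightarrow> u differentiable (at z)"
    and "\<And>u N r. X u \<Longrightarrow> N \<in> \<N> \<Longrightarrow> \<exists>C. \<forall>t. \<bar>t\<bar> \<le> r \<longrightarrow> N (\<lambda>x. u (t, x)) C"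
    and "\<And>u j. X u \<Longrightarrow> X (dd (dirv j) u)"
  shows "tame \<N> u"
proof -
  have "X (dst js u)" for js
    by (induction js) (auto intro: assms)
  then show ?thesis
    unfolding tame_def differentiable_on_def
    by (auto intro: assms(2,3))
qed

lemma tame_dd: "tame \<N> u \<Longrightarrow> tame \<N> (dd (dirv j) u)"
  unfolding tame_def
proof (intro allI)
  fix js
  assume "\<forall>js. dst js u differentiable_on UNIV \<and>
     (\<forall>N\<in>\<N>. \<forall>r. \<exists>C. \<forall>t. \<bar>t\<bar> \<le> r \<longrightarrow> N (\<lambda>x. dst js u (t, x)) C)"
  from this[rule_format, of "js @ [j]"]
  show "dst js (dd (dirv j) u) differentiable_on UNIV \<and>
     (\<forall>N\<in>\<N>. \<forall>r. \<exists>C. \<forall>t. \<bar>t\<bar> \<le> r \<longrightarrow> N (\<lambda>x. dst js (dd (dirv j) u) (t, x)) C)"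
    by (simp add: dst_append)
qed

lemma tame_dst: "tame \<N> u \<Longrightarrow> tame \<N> (dst js u)"
  by (induction js) (auto intro: tame_dd)

lemma tame_differentiable: "tame \<N> u \<Longrightarrow> u differentiable (at z)"
  unfolding tame_def differentiable_on_def by (metis UNIV_I dst_simps(1) )

lemma tame_bounded: "tame \<N> u \<Longrightarrow> N \<in> \<N> \<Longrightarrow> \<exists>C. \<forall>t. \<bar>t\<bar> \<le> r \<longrightarrow> N (\<lambda>x. u (t, x)) C"
  unfolding tame_def by (metis dst_simps(1))

lemma tame_continuous: "tame \<N> u \<Longrightarrow> continuous_on S u"
  by (simp add: continuous_at_imp_continuous_on differentiable_imp_continuous_within tame_differentiable)

lemma tame_continuous_slice: "tame \<N> u \<Longrightarrow> continuous_on S (\<lambda>x. u (t, x))"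
  by (rule continuous_on_compose2[OF tame_continuous[of _ _ UNIV]]) (auto intro!: continuous_intros)

lemma sum_option: "(\<Sum>j\<in>(UNIV::'n::finite option set). f j) = f None + (\<Sum>i\<in>UNIV. f (Some i))"
  by (simp add: UNIV_option_conv sum.reindex)

lemma spacetime_expansion: "w = (\<Sum>j\<in>UNIV. (case j of None \<Rightarrow> fst w | Some i \<Rightarrow> snd w $ i) *\<^sub>R dirv j)"
  for w :: "real \<times> (real^'n)"
  by (simp add: sum_option dirv_def prod_eq_iff vec_eq_iff fst_sum snd_sum axis_def if_distrib[of "(*) _"] cong: if_cong)

lemma has_derivative_dd:
  "u differentiable (at z) \<Longrightarrow> (u has_derivative (\<lambda>w. dd w u z)) (at z)"
  unfolding dd_def using frechet_derivative_works by (metis eta_contract_eq)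

lemma dd_spacetime:
  fixes u :: "real \<times> (real^'n) \<Rightarrow> real"
  assumes "u differentiable (at z)"
  shows "dd w u z = fst w * dd (dirv None) u z + (\<Sum>i\<in>UNIV. snd w $ i * dd (dirv (Some i)) u z)"
proof -
  interpret bounded_linear "\<lambda>w. dd w u z"
    using has_derivative_dd[OF assms] by (rule has_derivative_bounded_linear)
  have "dd w u z = dd (\<Sum>j\<in>UNIV. (case j of None \<Rightarrow> fst w | Some i \<Rightarrow> snd w $ i) *\<^sub>R dirv j) u z"
    using spacetime_expansion[of w] by simp
  also have "\<dots> = (\<Sum>j\<in>UNIV. (case j of None \<Rightarrow> fst w | Some i \<Rightarrow> snd w $ i) * dd (dirv j) u z)"
    by (simp add: sum scaleR)
  finally show ?thesis by (simp add: sum_option)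
qed

lemma tame_add:
  assumes N: "\<forall>N\<in>\<N>. size_bound N" and "tame \<N> u" "tame \<N> v"
  shows "tame \<N> (\<lambda>z. u z + v z)"
proof (rule tame_coinduct[where X="\<lambda>w. \<exists>u v. tame \<N> u \<and> tame \<N> v \<and> w = (\<lambda>z. u z + v z)"])
  show "\<exists>a b. tame \<N> a \<and> tame \<N> b \<and> (\<lambda>z. u z + v z) = (\<lambda>z. a z + b z)"
    using assms by blast
next
  fix w assume "\<exists>u v. tame \<N> u \<and> tame \<N> v \<and> w = (\<lambda>z. u z + v z)"
  then obtain u v where uv: "tame \<N> u" "tame \<N> v" and w: "w = (\<lambda>z. u z + v z)" by blast
  show "w differentiable (at z)" for z
    unfolding w using uv by (intro differentiable_add tame_differentiable)
  show "\<exists>C. \<forall>t. \<bar>t\<bar> \<le> r \<longrightarrow> N (\<lambda>x. w (t, x)) C" if NN: "N \<in> \<N>" for N r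
  proof -
    obtain C D where "\<forall>t. \<bar>t\<bar> \<le> r \<longrightarrow> N (\<lambda>x. u (t, x)) C" "\<forall>t. \<bar>t\<bar> \<le> r \<longrightarrow> N (\<lambda>x. v (t, x)) D"
      using tame_bounded[OF uv(1) NN] tame_bounded[OF uv(2) NN] by meson
    then have "\<forall>t. \<bar>t\<bar> \<le> r \<longrightarrow> N (\<lambda>x. w (t, x)) (C + D)"
      unfolding w
      using size_bound.triangle[OF N[rule_format, OF NN] tame_continuous_slice[OF uv(1)] tame_continuous_slice[OF uv(2)]]
      by simp
    then show ?thesis by blast
  qed
  have "dd (dirv j) w = (\<lambda>z. dd (dirv j) u z + dd (dirv j) v z)" for j
    unfolding w fun_eq_iff
    by (intro allI dd_eqI has_derivative_add has_derivative_dd tame_differentiable[OF uv(1)] tame_differentiable[OF uv(2)])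
  then show "\<exists>u v. tame \<N> u \<and> tame \<N> v \<and> dd (dirv j) w = (\<lambda>z. u z + v z)" for j
    using tame_dd uv by blast
qed

lemma dd_const: "dd v (\<lambda>_. c) = (\<lambda>_. 0)"
  by (intro ext dd_eqI[where f'="\<lambda>_. 0"]) simp

lemma tame_zero: "\<forall>N\<in>\<N>. size_bound N \<Longrightarrow> tame \<N> (\<lambda>_. 0)"
  by (rule tame_coinduct[where X="\<lambda>u. u = (\<lambda>_. 0)"]) (auto simp: dd_const intro: size_bound.zero)

abbreviation btame :: "(real \<times> (real^'n) \<Rightarrow> real) \<Rightarrow> bool" where
  "btame \<equiv> tame {sup_bound}"

lemma btame_bounded: "btame u \<Longrightarrow> \<exists>C. \<forall>t x. \<bar>t\<bar> \<le> r \<longrightarrow> \<bar>u (t, x)\<bar> \<le> C"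
  using tame_bounded[of "{sup_bound}" u sup_bound r] by (auto simp: sup_bound_def)

lemma btame_const: "btame (\<lambda>_. c)"
  by (rule tame_coinduct[where X="\<lambda>u. \<exists>c. u = (\<lambda>_. c)"]) (auto simp: dd_const sup_bound_def)

lemma tame_sum:
  assumes N: "\<forall>N\<in>\<N>. size_bound N" and "\<And>i. i \<in> I \<Longrightarrow> tame \<N> (u i)"
  shows "tame \<N> (\<lambda>z. \<Sum>i\<in>I. u i z)"
  using assms(2)
  by (induction I rule: infinite_finite_induct) (auto intro!: tame_add tame_zero N)

text \<open>
  The closure of the compositions \<open>a \<circ> G\<close> under addition and multiplication by bounded
  coefficients is stable under differentiation whenever the chain rule has coefficients of that
  kind. Tameness of its members follows by coinduction, without any formula for the higher
  derivatives of a composition.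
\<close>

inductive chain_span ::
  "((real^'n \<Rightarrow> real) \<Rightarrow> real \<Rightarrow> bool) set \<Rightarrow> (real \<times> (real^'n) \<Rightarrow> real \<times> (real^'n)) \<Rightarrow>
   (real \<times> (real^'n) \<Rightarrow> real) \<Rightarrow> bool" for \<N> G where
  base: "tame \<N> a \<Longrightarrow> chain_span \<N> G (\<lambda>z. a (G z))"
| mult: "btame b \<Longrightarrow> chain_span \<N> G u \<Longrightarrow> chain_span \<N> G (\<lambda>z. b z * u z)"
| add: "chain_span \<N> G u \<Longrightarrow> chain_span \<N> G v \<Longrightarrow> chain_span \<N> G (\<lambda>z. u z + v z)"

lemma chain_span_tame:
  assumes N: "\<forall>N\<in>\<N>. size_bound N"
    and diff: "\<And>z. G differentiable (at z)"
    and bound: "\<And>a N r. tame \<N> a \<Longrightarrow> N \<in> \<N> \<Longrightarrow> \<exists>C. \<forall>t. \<bar>t\<bar> \<le> r \<longrightarrow> N (\<lambda>x. a (G (t, x))) C"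
    and chain: "\<And>a j. tame \<N> a \<Longrightarrow> \<exists>c. (\<forall>l. btame (c l)) \<and>
        dd (dirv j) (\<lambda>z. a (G z)) = (\<lambda>z. \<Sum>l\<in>UNIV. c l z * dd (dirv l) a (G z))"
    and u: "chain_span \<N> G u"
  shows "tame \<N> u"
proof -
  have zero: "chain_span \<N> G (\<lambda>z. 0)"
    using chain_span.base[OF tame_zero[OF N]] by simp
  have sum: "chain_span \<N> G (\<lambda>z. \<Sum>i\<in>I. f i z)" if "\<And>i. i \<in> I \<Longrightarrow> chain_span \<N> G (f i)" for I :: "'a option set" and f
    using that by (induction I rule: infinite_finite_induct) (auto intro!: chain_span.add zero)
  \<comment> \<open>One rule induction for all three properties: the product case uses the
    differentiability of the factor \<open>u\<close>, its bound, and the membership of its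
    derivatives in the span.\<close>
  have props: "(\<forall>z. w differentiable (at z)) \<and>
      (\<forall>N\<in>\<N>. \<forall>r. \<exists>C. \<forall>t. \<bar>t\<bar> \<le> r \<longrightarrow> N (\<lambda>x. w (t, x)) C) \<and>
      (\<forall>j. chain_span \<N> G (dd (dirv j) w))" if "chain_span \<N> G w" for w
    using that
  proof (induction rule: chain_span.induct)
    case (base a)
    have "chain_span \<N> G (dd (dirv j) (\<lambda>z. a (G z)))" for j
    proof -
      obtain c where c: "\<And>l. btame (c l)"
        and e: "dd (dirv j) (\<lambda>z. a (G z)) = (\<lambda>z. \<Sum>l\<in>UNIV. c l z * dd (dirv l) a (G z))"
        using chain[OF base] by blast
      show ?thesis
        unfolding e using base by (intro sum chain_span.mult chain_span.base tame_dd c)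
    qed
    moreover have "(\<lambda>z. a (G z)) differentiable (at z)" for z
      using differentiable_chain_at[OF diff tame_differentiable[OF base]] by (simp add: o_def)
    ultimately show ?case
      by (intro conjI allI ballI bound[OF base])
  next
    case (mult b u)
    then have d: "b differentiable (at z)" "u differentiable (at z)" for z
      using tame_differentiable by blast+
    have cont: "continuous_on UNIV (\<lambda>x. b (t, x))" "continuous_on UNIV (\<lambda>x. u (t, x))" for t
      using d by (auto intro!: continuous_on_compose2[of UNIV _ UNIV "\<lambda>x. (t, x)"] continuous_intros
          simp: continuous_at_imp_continuous_on differentiable_imp_continuous_within)
    have "dd (dirv j) (\<lambda>z. b z * u z) = (\<lambda>z. b z * dd (dirv j) u z + dd (dirv j) b z * u z)" for j
      unfolding fun_eq_iff
      by (intro allI dd_eqI has_derivative_mult has_derivative_dd d)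
    then have "chain_span \<N> G (dd (dirv j) (\<lambda>z. b z * u z))" for j
      using mult by (auto intro!: chain_span.add chain_span.mult tame_dd)
    moreover have "\<exists>C. \<forall>t. \<bar>t\<bar> \<le> r \<longrightarrow> N (\<lambda>x. b (t, x) * u (t, x)) C" if NN: "N \<in> \<N>" for N r
    proof -
      obtain C where C: "\<And>t. \<bar>t\<bar> \<le> r \<Longrightarrow> N (\<lambda>x. u (t, x)) C"
        using mult.IH[THEN conjunct2, THEN conjunct1, rule_format, OF NN] by blast
      obtain B where B: "\<And>t x. \<bar>t\<bar> \<le> r \<Longrightarrow> \<bar>b (t, x)\<bar> \<le> B"
        using btame_bounded[OF mult(1)] by meson
      have "N (\<lambda>x. b (t, x) * u (t, x)) (\<bar>B\<bar> * C)" if t: "\<bar>t\<bar> \<le> r" for t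
      proof (rule size_bound.dominated[OF N[rule_format, OF NN] _ _ C[OF t]])
        show "\<bar>b (t, x) * u (t, x)\<bar> \<le> \<bar>B\<bar> * \<bar>u (t, x)\<bar>" for x
          using B[OF t, of x] by (auto simp: abs_mult intro!: mult_right_mono)
      qed (auto intro!: continuous_intros cont)
      then show ?thesis by blast
    qed
    ultimately show ?case
      using d by (auto intro!: differentiable_mult)
  next
    case (add u v)
    then have d: "u differentiable (at z)" "v differentiable (at z)" for z
      by blast+
    have cont: "continuous_on UNIV (\<lambda>x. u (t, x))" "continuous_on UNIV (\<lambda>x. v (t, x))" for t
      using d by (auto intro!: continuous_on_compose2[of UNIV _ UNIV "\<lambda>x. (t, x)"] continuous_intros
          simp: continuous_at_imp_continuous_on differentiable_imp_continuous_within)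
    have "dd (dirv j) (\<lambda>z. u z + v z) = (\<lambda>z. dd (dirv j) u z + dd (dirv j) v z)" for j
      unfolding fun_eq_iff
      by (intro allI dd_eqI has_derivative_add has_derivative_dd d)
    then have "chain_span \<N> G (dd (dirv j) (\<lambda>z. u z + v z))" for j
      using add by (auto intro!: chain_span.add)
    moreover have "\<exists>C. \<forall>t. \<bar>t\<bar> \<le> r \<longrightarrow> N (\<lambda>x. u (t, x) + v (t, x)) C" if NN: "N \<in> \<N>" for N r
    proof -
      obtain C D where "\<forall>t. \<bar>t\<bar> \<le> r \<longrightarrow> N (\<lambda>x. u (t, x)) C" "\<forall>t. \<bar>t\<bar> \<le> r \<longrightarrow> N (\<lambda>x. v (t, x)) D"
        using add.IH(1)[THEN conjunct2, THEN conjunct1, rule_format, OF NN]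
          add.IH(2)[THEN conjunct2, THEN conjunct1, rule_format, OF NN] by blast
      then have "\<forall>t. \<bar>t\<bar> \<le> r \<longrightarrow> N (\<lambda>x. u (t, x) + v (t, x)) (C + D)"
        using size_bound.triangle[OF N[rule_format, OF NN] cont] by simp
      then show ?thesis by blast
    qed
    ultimately show ?case
      using d by (auto intro!: differentiable_add)
  qed
  show ?thesis
    by (rule tame_coinduct[where X="chain_span \<N> G", OF u]) (simp_all add: props)
qed

text \<open>The case of \<open>chain_span_tame\<close> in which \<open>G\<close> is the identity and
  the chain rule coefficients are Kronecker deltas; the Leibniz rule is hidden in the stability of
  the span.\<close>

lemma tame_mult:
  assumes N: "\<forall>N\<in>\<N>. size_bound N" and "btame b" "tame \<N> a"
  shows "tame \<N> (\<lambda>z. b z * a z)"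
proof (rule chain_span_tame[OF N, where G="\<lambda>z. z"])
  show "\<exists>c. (\<forall>l. btame (c l)) \<and> dd (dirv j) a = (\<lambda>z. \<Sum>l\<in>UNIV. c l z * dd (dirv l) a z)"
    for a :: "real \<times> (real^'a) \<Rightarrow> real" and j
    by (rule exI[of _ "\<lambda>l z. if l = j then 1 else 0"]) (simp add: btame_const if_distrib[of "\<lambda>x. x * _"] cong: if_cong)
  show "chain_span \<N> (\<lambda>z. z) (\<lambda>z. b z * a z)"
    using assms by (intro chain_span.mult chain_span.base)
qed (auto intro: tame_bounded)

lemma tame_cmult:
  assumes "\<forall>N\<in>\<N>. size_bound N" "tame \<N> a"
  shows "tame \<N> (\<lambda>z. c * a z)"
  using tame_mult[OF assms(1) btame_const assms(2)] .

lemma tame_diff: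
  assumes "\<forall>N\<in>\<N>. size_bound N" "tame \<N> a" "tame \<N> b"
  shows "tame \<N> (\<lambda>z. a z - b z)"
  using tame_add[OF assms(1,2) tame_cmult[OF assms(1,3), of "-1"]] by simp

lemma btame_size: "\<forall>N\<in>{sup_bound}. size_bound N"
  using size_bound_sup by auto

lemmas btame_add = tame_add[OF btame_size]
lemmas btame_mult = tame_mult[OF btame_size]
lemmas btame_diff = tame_diff[OF btame_size]
lemmas btame_cmult = tame_cmult[OF btame_size]
lemmas btame_sum = tame_sum[OF btame_size]

lemma btame_prod: "(\<And>i. i \<in> I \<Longrightarrow> btame (u i)) \<Longrightarrow> btame (\<lambda>z. \<Prod>i\<in>I. u i z)"
  by (induction I rule: infinite_finite_induct) (auto intro: btame_const btame_mult)

lemma btame_det: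
  assumes "\<And>i j. btame (\<lambda>z. A z $ i $ j)"
  shows "btame (\<lambda>z. det (A z))"
  unfolding det_def by (intro btame_sum btame_cmult btame_prod assms)

text \<open>The functions \<open>b / u ^ k\<close> with bounded tame \<open>b\<close> form a class
  stable under derivatives, because (b / u^k)' = (b' u - k b u') / u^(k+1). The lower bounds on
  \<open>u\<close> control the powers.\<close>

lemma btame_recip:
  assumes u: "btame u" and pos: "\<And>r. \<exists>\<delta>>0. \<forall>t x. \<bar>t\<bar> \<le> r \<longrightarrow> \<delta> \<le> u (t, x)"
  shows "btame (\<lambda>z. 1 / u z)"
proof (rule tame_coinduct[where X="\<lambda>w. \<exists>b k. btame b \<and> w = (\<lambda>z. b z * (1 / u z) ^ k)"])
  have u0: "u z > 0" for z
    using pos[of "\<bar>fst z\<bar>"] by (metis order.refl order_less_le_trans prod.collapse)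
  then have un0: "u z \<noteq> 0" for z by (metis less_irrefl)
  show "\<exists>b k. btame b \<and> (\<lambda>z. 1 / u z) = (\<lambda>z. b z * (1 / u z) ^ k)"
    by (rule exI[of _ "\<lambda>z. 1"], rule exI[of _ 1]) (simp add: btame_const)
  fix w assume "\<exists>b k. btame b \<and> w = (\<lambda>z. b z * (1 / u z) ^ k)"
  then obtain b k where b: "btame b" and w: "w = (\<lambda>z. b z * (1 / u z) ^ k)" by blast
  have d: "b differentiable (at z)" "u differentiable (at z)" for z
    using b u tame_differentiable by blast+
  show "w differentiable (at z)" for z
    unfolding w by (intro differentiable_mult differentiable_power differentiable_divide d un0 differentiable_const)
  show "\<exists>C. \<forall>t. \<bar>t\<bar> \<le> r \<longrightarrow> N (\<lambda>x. w (t, x)) C" if N: "N \<in> {sup_bound}" for N r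
  proof -
    obtain B where B: "\<And>t x. \<bar>t\<bar> \<le> r \<Longrightarrow> \<bar>b (t, x)\<bar> \<le> B"
      using btame_bounded[OF b] by meson
    obtain \<delta> where \<delta>: "\<delta> > 0" "\<And>t x. \<bar>t\<bar> \<le> r \<Longrightarrow> \<delta> \<le> u (t, x)"
      using pos by meson
    have "\<bar>w (t, x)\<bar> \<le> B * (1 / \<delta>) ^ k" if t: "\<bar>t\<bar> \<le> r" for t x
      unfolding w abs_mult
    proof (intro mult_mono B[OF t])
      show "0 \<le> B" using B[OF t, of x] by linarith
      show "\<bar>(1 / u (t, x)) ^ k\<bar> \<le> (1 / \<delta>) ^ k"
        unfolding power_abs using \<delta>(1) \<delta>(2)[OF t, of x]
        by (intro power_mono) (auto simp: frac_le)
    qed simp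
    then show ?thesis using N by (auto simp: sup_bound_def)
  qed
  fix j
  have "dd (dirv j) w z = (dd (dirv j) b z * u z - of_nat k * (b z * dd (dirv j) u z)) * (1 / u z) ^ (Suc k)" for z
  proof -
    have "(w has_derivative (\<lambda>h. b z * (of_nat k * (- 1 * (inverse (u z) * dd h u z * inverse (u z)) + 0 / u z) * (1 / u z) ^ (k - 1)) + dd h b z * (1 / u z) ^ k)) (at z)"
      unfolding w by (rule derivative_eq_intros has_derivative_dd d un0 refl)+ (auto simp: fun_eq_iff un0 field_simps)
    \<comment> \<open>The power rule leaves the exponent \<open>k - 1\<close>, truncated at
      \<open>k = 0\<close>, where the factor \<open>of_nat k\<close> vanishes; hence the case
      split.\<close>
    from dd_eqI[OF this, of "dirv j"] show ?thesis
      using un0[of z] by (cases k) (simp_all add: field_simps)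
  qed
  then show "\<exists>b k. btame b \<and> dd (dirv j) w = (\<lambda>z. b z * (1 / u z) ^ k)"
    by (intro exI[of _ "\<lambda>z. dd (dirv j) b z * u z - of_nat k * (b z * dd (dirv j) u z)"] exI[of _ "Suc k"])
      (auto intro!: btame_diff btame_mult btame_cmult tame_dd b u)
qed

section \<open>Mixed partial derivatives and global invertibility\<close>

lemma DERIV_line:
  fixes u :: "'a::real_normed_vector \<Rightarrow> real"
  assumes "\<And>z. u differentiable (at z)"
  shows "((\<lambda>r. u (z + r *\<^sub>R v)) has_real_derivative dd v u (z + r *\<^sub>R v)) (at r)"
proof -
  have "((\<lambda>r. z + r *\<^sub>R v) has_derivative (\<lambda>h. h *\<^sub>R v)) (at r)"
    by (auto intro!: derivative_eq_intros)
  from has_derivative_compose[OF this has_derivative_dd[OF assms]]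
  have *: "((\<lambda>r. u (z + r *\<^sub>R v)) has_derivative (\<lambda>h. dd (h *\<^sub>R v) u (z + r *\<^sub>R v))) (at r)" .
  have "dd (h *\<^sub>R v) u x = h * dd v u x" for h x
    using linear_cmul[OF bounded_linear.linear[OF has_derivative_bounded_linear[OF has_derivative_dd[OF assms, of x]]], of h v]
    by simp
  with * show ?thesis
    by (simp add: has_field_derivative_def mult_commute_abs)
qed

text \<open>The mean value theorem twice: along \<open>v\<close> for the increment in direction
  \<open>w\<close>, then along \<open>w\<close> for \<open>dd v u\<close>. The second difference is
  symmetric in \<open>v\<close> and \<open>w\<close>, which is what makes mixed derivatives
  agree.\<close>

lemma second_difference:
  fixes u :: "'a::real_normed_vector \<Rightarrow> real"
  assumes "\<And>z. u differentiable (at z)" "\<And>z. dd v u differentiable (at z)" "0 < s"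
  shows "\<exists>\<xi> \<eta>. 0 < \<xi> \<and> \<xi> < s \<and> 0 < \<eta> \<and> \<eta> < s \<and>
    u (z + s *\<^sub>R v + s *\<^sub>R w) - u (z + s *\<^sub>R v) - u (z + s *\<^sub>R w) + u z =
    s * (s * dd w (dd v u) (z + \<xi> *\<^sub>R v + \<eta> *\<^sub>R w))"
proof -
  have "\<exists>\<xi>. 0 < \<xi> \<and> \<xi> < s \<and>
    (u ((z + s *\<^sub>R w) + s *\<^sub>R v) - u (z + s *\<^sub>R v)) - (u ((z + s *\<^sub>R w) + 0 *\<^sub>R v) - u (z + 0 *\<^sub>R v)) =
    (s - 0) * (dd v u ((z + s *\<^sub>R w) + \<xi> *\<^sub>R v) - dd v u (z + \<xi> *\<^sub>R v))"
    using assms(1,3) by (intro MVT2) (auto intro!: DERIV_diff DERIV_line)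
  then obtain \<xi> where \<xi>: "0 < \<xi>" "\<xi> < s"
    "(u ((z + s *\<^sub>R w) + s *\<^sub>R v) - u (z + s *\<^sub>R v)) - (u ((z + s *\<^sub>R w) + 0 *\<^sub>R v) - u (z + 0 *\<^sub>R v)) =
    (s - 0) * (dd v u ((z + s *\<^sub>R w) + \<xi> *\<^sub>R v) - dd v u (z + \<xi> *\<^sub>R v))"
    by blast
  have "\<exists>\<eta>. 0 < \<eta> \<and> \<eta> < s \<and>
    dd v u ((z + \<xi> *\<^sub>R v) + s *\<^sub>R w) - dd v u ((z + \<xi> *\<^sub>R v) + 0 *\<^sub>R w) =
    (s - 0) * (dd w (dd v u) ((z + \<xi> *\<^sub>R v) + \<eta> *\<^sub>R w))"
    using assms(2,3) by (intro MVT2) (auto intro!: DERIV_line)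
  then obtain \<eta> where \<eta>: "0 < \<eta>" "\<eta> < s"
    "dd v u ((z + \<xi> *\<^sub>R v) + s *\<^sub>R w) - dd v u ((z + \<xi> *\<^sub>R v) + 0 *\<^sub>R w) =
    (s - 0) * (dd w (dd v u) ((z + \<xi> *\<^sub>R v) + \<eta> *\<^sub>R w))"
    by blast
  show ?thesis
    using \<xi> \<eta> by (intro exI[of _ \<xi>] exI[of _ \<eta>]) (simp add: algebra_simps)
qed

text \<open>For every scale \<open>s\<close> the symmetric second difference is \<open>s * s\<close>
  times either mixed derivative at some point near \<open>z\<close>. Different values at
  \<open>z\<close> would remain separated near \<open>z\<close> by continuity.\<close>

lemma dd_commute:
  fixes u :: "'a::real_normed_vector \<Rightarrow> real"
  assumes u: "\<And>z. u differentiable (at z)" "\<And>z. dd v u differentiable (at z)" "\<And>z. dd w u differentiable (at z)"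
    and c: "isCont (dd w (dd v u)) z" "isCont (dd v (dd w u)) z"
  shows "dd w (dd v u) z = dd v (dd w u) z"
proof (rule ccontr)
  let ?a = "dd w (dd v u)" and ?b = "dd v (dd w u)"
  assume ne: "?a z \<noteq> ?b z"
  \<comment> \<open>Half the gap, so that the \<open>e\<close>-neighbourhoods of the two values are
    disjoint.\<close>
  define e where "e = \<bar>?a z - ?b z\<bar> / 2"
  have e: "e > 0" using ne by (simp add: e_def)
  obtain d1 where d1: "d1 > 0" "\<And>y. dist y z < d1 \<Longrightarrow> dist (?a y) (?a z) < e"
    using c(1) e unfolding continuous_at_eps_delta by meson
  obtain d2 where d2: "d2 > 0" "\<And>y. dist y z < d2 \<Longrightarrow> dist (?b y) (?b z) < e"
    using c(2) e unfolding continuous_at_eps_delta by meson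
  \<comment> \<open>At this scale all points produced by \<open>second_difference\<close> lie within
    both radii; the summand 1 excludes a zero denominator.\<close>
  define s where "s = min d1 d2 / (norm v + norm w + 1)"
  have pos: "norm v + norm w + 1 > 0"
    by (simp add: add_nonneg_pos)
  have s: "s > 0" "s * (norm v + norm w) < min d1 d2"
  proof -
    show "s > 0" using d1(1) d2(1) pos by (simp add: s_def)
    then have "s * (norm v + norm w) < s * (norm v + norm w + 1)" by simp
    also have "\<dots> = min d1 d2" using pos by (simp add: s_def)
    finally show "s * (norm v + norm w) < min d1 d2" .
  qed
  have close: "norm (\<xi> *\<^sub>R v + \<eta> *\<^sub>R w) < min d1 d2"
    if "0 < \<xi>" "\<xi> < s" "0 < \<eta>" "\<eta> < s" for \<xi> \<eta>
  proof -
    have "norm (\<xi> *\<^sub>R v + \<eta> *\<^sub>R w) \<le> \<xi> * norm v + \<eta> * norm w"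
      using that by (intro order_trans[OF norm_triangle_ineq]) simp
    also have "\<dots> \<le> s * norm v + s * norm w"
      using that by (intro add_mono mult_right_mono) auto
    finally show ?thesis using s(2) by (simp add: algebra_simps)
  qed
  obtain \<xi> \<eta> where 1: "0 < \<xi>" "\<xi> < s" "0 < \<eta>" "\<eta> < s"
    "u (z + s *\<^sub>R v + s *\<^sub>R w) - u (z + s *\<^sub>R v) - u (z + s *\<^sub>R w) + u z =
      s * (s * ?a (z + \<xi> *\<^sub>R v + \<eta> *\<^sub>R w))"
    using second_difference[OF u(1,2) s(1)] by blast
  obtain \<xi>' \<eta>' where 2: "0 < \<xi>'" "\<xi>' < s" "0 < \<eta>'" "\<eta>' < s"
    "u (z + s *\<^sub>R w + s *\<^sub>R v) - u (z + s *\<^sub>R w) - u (z + s *\<^sub>R v) + u z =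
      s * (s * ?b (z + \<xi>' *\<^sub>R w + \<eta>' *\<^sub>R v))"
    using second_difference[OF u(1,3) s(1)] by blast
  have "s * (s * ?a (z + \<xi> *\<^sub>R v + \<eta> *\<^sub>R w)) = s * (s * ?b (z + \<xi>' *\<^sub>R w + \<eta>' *\<^sub>R v))"
    unfolding 1(5)[symmetric] 2(5)[symmetric] by (simp add: algebra_simps)
  then have "?a (z + \<xi> *\<^sub>R v + \<eta> *\<^sub>R w) = ?b (z + \<xi>' *\<^sub>R w + \<eta>' *\<^sub>R v)"
    using s(1) by simp
  moreover have "dist (?a (z + \<xi> *\<^sub>R v + \<eta> *\<^sub>R w)) (?a z) < e"
    using close[OF 1(1-4)] by (intro d1(2)) (simp add: dist_norm add.assoc)
  moreover have "dist (?b (z + \<xi>' *\<^sub>R w + \<eta>' *\<^sub>R v)) (?b z) < e"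
    using close[OF 2(3,4,1,2)] by (intro d2(2)) (simp add: dist_norm add.commute[of "_ *\<^sub>R w"] add.assoc)
  ultimately show False
    unfolding e_def dist_real_def by (simp add: abs_if split: if_splits)
qed

text \<open>The bounds \<open>m\<close> and \<open>L\<close> hold at all points, so one radius
  serves everywhere: on a ball of radius \<open>2 * \<rho>\<close> the map differs from the
  derivative at the centre by a map of Lipschitz constant \<open>m / 2\<close>, hence
  \<open>norm (F a - F b)\<close> is at least \<open>m / 2\<close> times
  \<open>norm (a - b)\<close>. Target balls of one common radius \<open>\<sigma>\<close> are then
  evenly covered.\<close>

lemma bij_uniform_local_diffeo:
  fixes F :: "'a::euclidean_space \<Rightarrow> 'a"
  assumes der: "\<And>x. (F has_derivative F' x) (at x)"
    and m: "m > 0" "\<And>x v. m * norm v \<le> norm (F' x v)"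
    and L: "\<And>x y v. norm (F' x v - F' y v) \<le> L * norm (x - y) * norm v"
  shows "bij F"
proof -
  \<comment> \<open>The derivative oscillates by at most \<open>m / 2\<close> between the centre and
    a point at distance \<open>2 * \<rho>\<close>; the summand 1 covers
    \<open>L = 0\<close>.\<close>
  define \<rho> where "\<rho> = m / (4 * (\<bar>L\<bar> + 1))"
  have \<rho>: "\<rho> > 0" "\<bar>L\<bar> * (2 * \<rho>) \<le> m / 2"
    using m(1) by (auto simp: \<rho>_def field_simps)
  have cont: "continuous_on S F" for S
    using der by (meson continuous_at_imp_continuous_on has_derivative_continuous)
  have lin: "linear (F' x)" for x
    using der has_derivative_linear by blast
  have bl: "bounded_linear (F' x)" for x
    using der has_derivative_bounded_linear by blast
  have lower: "m / 2 * norm (a - b) \<le> norm (F a - F b)" if ab: "a \<in> ball x (2 * \<rho>)" "b \<in> ball x (2 * \<rho>)" for x a b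
  proof -
    have "norm ((F a - F' x a) - (F b - F' x b)) \<le> m / 2 * norm (a - b)"
    proof (rule differentiable_bound[OF convex_ball _ _ ab])
      fix y assume y: "y \<in> ball x (2 * \<rho>)"
      show "((\<lambda>y. F y - F' x y) has_derivative (\<lambda>v. F' y v - F' x v)) (at y within ball x (2 * \<rho>))"
        by (intro has_derivative_diff has_derivative_at_withinI[OF der] bounded_linear_imp_has_derivative bl)
      show "onorm (\<lambda>v. F' y v - F' x v) \<le> m / 2"
      proof (rule onorm_le)
        fix v :: 'a
        have "norm (y - x) \<le> 2 * \<rho>"
          using y by (simp add: dist_norm norm_minus_commute)
        then have "L * norm (y - x) \<le> \<bar>L\<bar> * (2 * \<rho>)"
          by (intro mult_mono) auto
        then have "L * norm (y - x) * norm v \<le> m / 2 * norm v"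
          using \<rho>(2) by (intro mult_right_mono) auto
        then show "norm (F' y v - F' x v) \<le> m / 2 * norm v"
          using L[of y v x] by linarith
      qed
    qed
    moreover have "(F a - F' x a) - (F b - F' x b) = (F a - F b) - F' x (a - b)"
      by (simp add: linear_diff[OF lin])
    ultimately have "norm (F' x (a - b)) - norm (F a - F b) \<le> m / 2 * norm (a - b)"
      by (metis norm_minus_commute norm_triangle_ineq2 order_trans)
    with m(2)[of "a - b" x] show ?thesis
      by linarith
  qed
  \<comment> \<open>Injectivity on the doubled radius is what later separates the sheets: two
    preimages of one point that both lie within \<open>\<rho>\<close> of a third point
    coincide.\<close>
  have inj2: "inj_on F (ball x (2 * \<rho>))" for x
  proof (rule inj_onI)
    fix a b assume "a \<in> ball x (2 * \<rho>)" "b \<in> ball x (2 * \<rho>)" "F a = F b"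
    then show "a = b" using lower[of a x b] m(1) by (simp add: mult_le_0_iff)
  qed
  then have inj1: "inj_on F (ball x \<rho>)" for x
    by (rule inj_on_subset[where A="ball x (2 * \<rho>)"]) (use \<rho> in \<open>auto intro!: subset_ball\<close>)
  \<comment> \<open>The sphere of radius \<open>\<rho>\<close> about \<open>x\<close> is mapped to
    points at distance at least \<open>\<sigma>\<close> from \<open>F x\<close>.\<close>
  define \<sigma> where "\<sigma> = m / 2 * \<rho>"
  have \<sigma>: "\<sigma> > 0" using m \<rho> by (simp add: \<sigma>_def)
  \<comment> \<open>The ball about \<open>F x\<close> is covered by the image of the open
    \<open>\<rho>\<close>-ball, open by invariance of domain, and the complement of the image of the
    closed one; the sphere is mapped too far away. Being connected and meeting the first set in
    \<open>F x\<close>, the ball lies in it.\<close>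
  have image: "ball (F x) \<sigma> \<subseteq> F ` ball x \<rho>" for x
  proof -
    let ?V = "- F ` cball x \<rho>"
    have o: "open (F ` ball x \<rho>)" "open ?V"
      by (intro invariance_of_domain cont open_ball inj1)
        (simp add: open_Compl compact_imp_closed compact_continuous_image cont)
    have far: "\<sigma> \<le> dist (F x) (F z)" if "dist x z = \<rho>" for z
      using lower[of x x z] that \<rho>(1) by (simp add: \<sigma>_def dist_norm)
    have cover: "ball (F x) \<sigma> \<subseteq> F ` ball x \<rho> \<union> ?V"
    proof
      fix y assume y: "y \<in> ball (F x) \<sigma>"
      show "y \<in> F ` ball x \<rho> \<union> ?V"
      proof (cases "y \<in> F ` cball x \<rho>")
        case True
        then obtain z where z: "y = F z" "dist x z \<le> \<rho>" by auto
        then have "dist x z \<noteq> \<rho>" using far[of z] y by auto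
        with z show ?thesis by auto
      qed auto
    qed
    have disj: "F ` ball x \<rho> \<inter> ?V \<inter> ball (F x) \<sigma> = {}"
      using ball_subset_cball[of x \<rho>] by blast
    have "F x \<in> F ` ball x \<rho> \<inter> ball (F x) \<sigma>"
      using \<rho> \<sigma> by simp
    then have "?V \<inter> ball (F x) \<sigma> = {}"
      using connectedD[OF connected_ball o disj cover] by blast
    with cover show ?thesis by blast
  qed
  have "range F = UNIV"
  proof -
    have "range F = (\<Union>x. F ` ball x \<rho>)"
    proof (intro equalityI subsetI)
      fix y assume "y \<in> range F"
      then obtain x where "y = F x" by blast
      then have "y \<in> F ` ball x \<rho>" using \<rho>(1) by simp
      then show "y \<in> (\<Union>x. F ` ball x \<rho>)" by blast
    qed blast
    then have "open (range F)"
      using invariance_of_domain[OF cont open_ball inj1] by auto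
    \<comment> \<open>Since \<open>\<sigma>\<close> does not depend on the point, a limit of values
      lies in the \<open>\<sigma>\<close>-ball about one of them.\<close>
    moreover have "closed (range F)"
      unfolding closure_eq[symmetric]
    proof (rule antisym[OF _ closure_subset], rule subsetI)
      fix y assume "y \<in> closure (range F)"
      then obtain z where "dist (F z) y < \<sigma>"
        using \<sigma> by (auto simp: closure_approachable)
      then show "y \<in> range F" using image[of z] by auto
    qed
    ultimately show ?thesis
      using clopen[of "range F"] by auto
  qed
  moreover have "covering_space UNIV F UNIV"
  proof (rule covering_spaceI[OF cont \<open>range F = UNIV\<close>])
    fix y :: 'a
    define T where "T = ball y \<sigma>"
    \<comment> \<open>The sheets over \<open>T\<close>, one for each preimage \<open>x\<close> of
      \<open>y\<close>. They exhaust the preimage of \<open>T\<close> because \<open>image\<close>,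
      applied at a point \<open>z\<close> of it, finds a preimage of \<open>y\<close> within
      \<open>\<rho>\<close> of \<open>z\<close>.\<close>
    define U where "U x = ball x \<rho> \<inter> F -` T" for x
    have oU: "open (U x)" for x
      unfolding U_def T_def using cont[of UNIV] by (intro open_Int open_ball open_vimage)
    have "\<Union> (U ` (F -` {y})) = UNIV \<inter> F -` T"
    proof (intro equalityI subsetI)
      fix z assume "z \<in> UNIV \<inter> F -` T"
      then have z: "dist (F z) y < \<sigma>" by (simp add: T_def dist_commute)
      then obtain x where "dist z x < \<rho>" "F x = y"
        using image[of z] by auto
      then show "z \<in> \<Union> (U ` (F -` {y}))"
        using z by (auto simp: U_def T_def dist_commute)
    qed (auto simp: U_def)
    moreover have "pairwise disjnt (U ` (F -` {y}))"
    proof (rule pairwiseI)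
      fix A B assume AB: "A \<in> U ` (F -` {y})" "B \<in> U ` (F -` {y})" "A \<noteq> B"
      then obtain a b where ab: "A = U a" "B = U b" "F a = y" "F b = y" "a \<noteq> b" by auto
      have False if "z \<in> A" "z \<in> B" for z
      proof -
        have "dist a z < \<rho>" "dist b z < \<rho>" using that ab by (auto simp: U_def)
        then have "dist a b < 2 * \<rho>"
          using dist_triangle2[of a b z] by linarith
        then have "a = b"
          using inj_onD[OF inj2[of a], of a b] ab \<rho> by auto
        with ab show False by simp
      qed
      then show "disjnt A B" by (auto simp: disjnt_def)
    qed
    moreover have "\<exists>q. homeomorphism (U x) T F q" if "F x = y" for x
    proof -
      have "F ` U x = T"
        using image[of x] that by (auto simp: U_def T_def)
      moreover have "inj_on F (U x)"
        by (rule inj_on_subset[OF inj1[of x]]) (auto simp: U_def)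
      ultimately show ?thesis
        using invariance_of_domain_homeomorphism[OF oU[of x] cont] by (metis order_refl)
    qed
    ultimately show "\<exists>T. y \<in> T \<and> openin (top_of_set UNIV) T \<and>
        (\<exists>v. \<Union> v = UNIV \<inter> F -` T \<and> (\<forall>u\<in>v. openin (top_of_set UNIV) u) \<and>
             pairwise disjnt v \<and> (\<forall>u\<in>v. \<exists>q. homeomorphism u T F q))"
    proof (intro exI[of _ T] exI[of _ "U ` (F -` {y})"] conjI)
      show "y \<in> T" "openin (top_of_set UNIV) T"
        using \<sigma> by (simp_all add: T_def)
      show "\<forall>u\<in>U ` (F -` {y}). openin (top_of_set UNIV) u"
        using oU by simp
    qed (simp_all only: ball_simps vimage_singleton_eq, blast)
  qed
  then have "inj F"
  proof -
    assume cov: "covering_space UNIV F UNIV"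
    show "inj F"
    proof (rule injI)
      fix x0 x1 assume eq: "F x0 = F x1"
      \<comment> \<open>The identity of the simply connected target lifts to a section
        \<open>g\<close> through \<open>x0\<close>. Both \<open>g \<circ> F\<close> and
        \<open>id\<close> lift \<open>F\<close> and agree at \<open>x0\<close>, so they are
        equal.\<close>
      obtain g where g: "continuous_on UNIV g" "g (F x0) = x0" "\<And>y. F (g y) = y"
        using covering_space_lift_strong[OF cov, of x0 "F x0" UNIV "\<lambda>y. y"]
        by (auto simp: convex_imp_simply_connected convex_imp_locally_path_connected)
      have "(g \<circ> F) x1 = id x1"
        by (rule covering_space_lift_unique[OF cov, of "g \<circ> F" x0 id UNIV F])
          (auto simp: g(2,3) cont intro!: continuous_on_compose2[OF g(1) cont])
      with g(2) eq show "x0 = x1" by simp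
    qed
  qed
  ultimately show ?thesis
    by (simp add: bij_def)
qed

section \<open>Families of diffeomorphisms and their inverses\<close>

lemma norm_matrix_vector_le:
  fixes M :: "real^'n^'m"
  assumes "\<And>i j. \<bar>M $ i $ j\<bar> \<le> B"
  shows "norm (M *v w) \<le> real CARD('m) * real CARD('n) * B * norm w"
proof -
  have B: "0 \<le> B" using assms[of undefined undefined] by linarith
  have "norm (M *v w) \<le> (\<Sum>i\<in>UNIV. \<bar>(M *v w) $ i\<bar>)"
    by (rule norm_le_l1_cart)
  also have "\<dots> \<le> (\<Sum>i\<in>(UNIV::'m set). \<Sum>j\<in>(UNIV::'n set). B * norm w)"
  proof (rule sum_mono)
    fix i
    have "\<bar>M $ i $ j * w $ j\<bar> \<le> B * norm w" for j
      unfolding abs_mult by (intro mult_mono component_le_norm_cart B assms abs_ge_zero)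
    then show "\<bar>(M *v w) $ i\<bar> \<le> (\<Sum>j\<in>(UNIV::'n set). B * norm w)"
      unfolding matrix_vector_mult_def vec_lambda_beta
      by (intro order_trans[OF sum_abs] sum_mono)
  qed
  finally show ?thesis by (simp add: algebra_simps)
qed

lemma slice_has_derivative:
  fixes u :: "real \<times> (real^'n) \<Rightarrow> real"
  assumes "u differentiable (at (t, x))"
  shows "((\<lambda>x. u (t, x)) has_derivative (\<lambda>h. \<Sum>i\<in>UNIV. h $ i * dd (dirv (Some i)) u (t, x))) (at x)"
proof -
  have "((\<lambda>x. (t, x)) has_derivative (\<lambda>h. (0, h))) (at x)"
    by (auto intro!: derivative_eq_intros)
  from has_derivative_compose[OF this has_derivative_dd[OF assms]]
  show ?thesis
    by (subst (asm) dd_spacetime[OF assms]) simp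
qed

section \<open>Partial derivatives of smooth maps\<close>

lemma partials_simps [simp]: "partials [] f = f" "partials (j # js) f = partial j (partials js f)"
  by (simp_all add: partials_def)

lemma partials_append: "partials (is @ js) f = partials is (partials js f)"
  by (simp add: partials_def)

lemma smooth_map_differentiable: "smooth_map f \<Longrightarrow> partials js f differentiable (at x)"
  by (simp add: smooth_map_def differentiable_on_def)

lemma smooth_map_partials: "smooth_map f \<Longrightarrow> smooth_map (partials js f)"
  unfolding smooth_map_def by (metis partials_append)

lemma smooth_map_continuous: "smooth_map f \<Longrightarrow> continuous_on S (partials js f)"
  by (simp add: smooth_map_differentiable continuous_at_imp_continuous_on differentiable_imp_continuous_within)

lemma smooth_map_continuous_component: "smooth_map f \<Longrightarrow> continuous_on S (\<lambda>x. partials js f x $ i)"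
  by (intro continuous_on_component smooth_map_continuous)

lemma smooth_map_has_derivative:
  fixes f :: "real^'n \<Rightarrow> real^'m"
  assumes "smooth_map f"
  shows "(partials js f has_derivative (\<lambda>h. \<Sum>i\<in>UNIV. h $ i *\<^sub>R partials (i # js) f x)) (at x)"
proof -
  have hd: "(partials js f has_derivative (\<lambda>h. dd h (partials js f) x)) (at x)"
    by (rule has_derivative_dd[OF smooth_map_differentiable[OF assms]])
  then interpret bounded_linear "\<lambda>h. dd h (partials js f) x"
    by (rule has_derivative_bounded_linear)
  have "dd h (partials js f) x = (\<Sum>i\<in>UNIV. h $ i *\<^sub>R partials (i # js) f x)" for h
  proof -
    have "dd h (partials js f) x = dd (\<Sum>i\<in>UNIV. h $ i *\<^sub>R axis i 1) (partials js f) x"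
      using basis_expansion[of h] by (simp add: scalar_mult_eq_scaleR)
    then show ?thesis by (simp add: sum scaleR partial_eq_dd)
  qed
  with hd show ?thesis by simp
qed

lemma partials_linear:
  assumes "smooth_map f" "smooth_map g"
  shows "partials js (\<lambda>x. a *\<^sub>R f x + b *\<^sub>R g x) = (\<lambda>x. a *\<^sub>R partials js f x + b *\<^sub>R partials js g x)"
proof (induction js)
  case (Cons j js)
  have "dd v (\<lambda>x. a *\<^sub>R partials js f x + b *\<^sub>R partials js g x) =
      (\<lambda>x. a *\<^sub>R dd v (partials js f) x + b *\<^sub>R dd v (partials js g) x)" for v
    by (intro ext dd_eqI has_derivative_add has_derivative_scaleR_right has_derivative_dd smooth_map_differentiable assms)
  then show ?case by (simp only: partials_simps partial_eq_dd Cons.IH)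
qed simp

lemma smooth_map_linear:
  assumes "smooth_map f" "smooth_map g"
  shows "smooth_map (\<lambda>x. a *\<^sub>R f x + b *\<^sub>R g x)"
  using assms unfolding smooth_map_def partials_linear[OF assms]
  by (auto intro!: differentiable_on_add differentiable_on_scaleR)

lemma smooth_map_zero: "smooth_map (\<lambda>_::real^'a. 0::real^'b)"
  and partials_zero: "partials js (\<lambda>_::real^'a. 0::real^'b) = (\<lambda>_. 0)"
proof -
  have p: "partials js (\<lambda>_::real^'a. 0::real^'b) = (\<lambda>_. 0)" for js :: "'a list"
    by (induction js) (auto simp: partial_eq_dd dd_const)
  then show "partials js (\<lambda>_::real^'a. 0::real^'b) = (\<lambda>_. 0)" .
  show "smooth_map (\<lambda>_::real^'a. 0::real^'b)"
    by (simp add: smooth_map_def p)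
qed

lemma smooth_map_diff:
  assumes "smooth_map f" "smooth_map g"
  shows "smooth_map (f - g)" "partials js (f - g) = (\<lambda>x. partials js f x - partials js g x)"
  using smooth_map_linear[OF assms, of 1 "-1"] partials_linear[OF assms, of _ 1 "-1"] by (simp_all add: fun_diff_def)

lemma smooth_map_add:
  assumes "smooth_map f" "smooth_map g"
  shows "smooth_map (f + g)" "partials js (f + g) = (\<lambda>x. partials js f x + partials js g x)"
  using smooth_map_linear[OF assms, of 1 "1"] partials_linear[OF assms, of _ 1 "1"] by (simp_all add: plus_fun_def)

lemma smooth_map_scaleR:
  assumes "smooth_map f"
  shows "smooth_map (c *\<^sub>R f)" "partials js (c *\<^sub>R f) = (\<lambda>x. c *\<^sub>R partials js f x)"
  using smooth_map_linear[OF assms assms, of c 0] partials_linear[OF assms assms, of _ c 0] by (simp_all add: scaleR_fun_def)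

text \<open>At a fixed time the space derivatives are derivatives along the directions
  \<open>Some j\<close>, by the chain rule for the inclusion of the slice. This turns tame functions
  into smooth maps with controlled partial derivatives.\<close>

lemma partials_slice:
  fixes u :: "'m::finite \<Rightarrow> real \<times> (real^'n) \<Rightarrow> real"
  assumes "\<And>i. tame \<N> (u i)"
  shows "partials js (\<lambda>x. \<chi> i. u i (t, x)) = (\<lambda>x. \<chi> i. dst (map Some js) (u i) (t, x))"
    and "smooth_map (\<lambda>x. \<chi> i. u i (t, x))"
proof -
  have hd: "((\<lambda>x. \<chi> i. dst (map Some js) (u i) (t, x)) has_derivative
      (\<lambda>h. \<chi> i. \<Sum>l\<in>UNIV. h $ l * dst (map Some (l # js)) (u i) (t, x))) (at x)" for js x
  proof -
    have "((\<lambda>x. dst (map Some js) (u i) (t, x)) has_derivative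
      (\<lambda>h. \<Sum>l\<in>UNIV. h $ l * dst (map Some (l # js)) (u i) (t, x))) (at x)" for i
      using slice_has_derivative[OF tame_differentiable[OF tame_dst[OF assms[of i], of "map Some js"]]] by simp
    then show ?thesis
      by (subst has_derivative_componentwise_within) (auto simp: Basis_vec_def inner_axis)
  qed
  have p: "partials js (\<lambda>x. \<chi> i. u i (t, x)) = (\<lambda>x. \<chi> i. dst (map Some js) (u i) (t, x))" for js
  proof (induction js)
    case (Cons j js)
    have "dd (axis j 1) (\<lambda>x. \<chi> i. dst (map Some js) (u i) (t, x)) = (\<lambda>x. \<chi> i. dst (map Some (j # js)) (u i) (t, x))"
      by (rule ext, subst dd_eqI[OF hd]) (simp add: axis_def if_distrib[of "\<lambda>x. x * _"] cong: if_cong)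
    then show ?case by (simp only: partials_simps partial_eq_dd Cons.IH)
  qed simp
  then show "partials js (\<lambda>x. \<chi> i. u i (t, x)) = (\<lambda>x. \<chi> i. dst (map Some js) (u i) (t, x))" .
  show "smooth_map (\<lambda>x. \<chi> i. u i (t, x))"
    unfolding smooth_map_def p differentiable_on_def using hd differentiable_def by blast
qed

lemma btame_slice_Lipschitz:
  fixes u :: "real \<times> (real^'n) \<Rightarrow> real"
  assumes "btame u"
  shows "\<exists>L. \<forall>t x y. \<bar>t\<bar> \<le> r \<longrightarrow> \<bar>u (t, x) - u (t, y)\<bar> \<le> L * norm (x - y)"
proof -
  have "\<exists>B. \<forall>t x. \<bar>t\<bar> \<le> r \<longrightarrow> \<bar>dd (dirv (Some i)) u (t, x)\<bar> \<le> B" for i :: 'n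
    by (rule btame_bounded[OF tame_dd[OF assms]])
  then obtain B where B: "\<And>i t x. \<bar>t\<bar> \<le> r \<Longrightarrow> \<bar>dd (dirv (Some i)) u (t, x)\<bar> \<le> B i"
    by metis
  have "norm (u (t, x) - u (t, y)) \<le> (\<Sum>i\<in>UNIV. B i) * norm (x - y)" if t: "\<bar>t\<bar> \<le> r" for t x y
  proof (rule differentiable_bound[OF convex_UNIV slice_has_derivative[OF tame_differentiable[OF assms]]])
    show "onorm (\<lambda>h. \<Sum>i\<in>UNIV. h $ i * dd (dirv (Some i)) u (t, x)) \<le> sum B UNIV" for x
    proof (rule onorm_le)
      fix h :: "real^'n"
      show "norm (\<Sum>i\<in>UNIV. h $ i * dd (dirv (Some i)) u (t, x)) \<le> sum B UNIV * norm h"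
        unfolding sum_distrib_right real_norm_def
        by (auto intro!: order_trans[OF sum_abs] sum_mono mult_mono component_le_norm_cart B[OF t]
            order_trans[OF abs_ge_zero B[OF t]] simp: abs_mult mult.commute[of "B _"])
    qed
  qed auto
  then show ?thesis by (auto simp: real_norm_def)
qed

text \<open>Keeping time as a coordinate makes a family of maps into one map: families are composed
  by composing shears, and the inverse family is the inverse of a single map whose joint smoothness
  can be studied at once.\<close>

definition shear :: "('n \<Rightarrow> real \<times> (real^'n) \<Rightarrow> real) \<Rightarrow> real \<times> (real^'n) \<Rightarrow> real \<times> (real^'n)" where
  "shear f z = (fst z, snd z + (\<chi> i. f i z))"

text \<open>Only the space block of the derivative of \<open>shear f\<close>: time is preserved, so
  the full derivative is block triangular with diagonal blocks 1 and \<open>Jac f z\<close>.\<close>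

definition Jac :: "('n \<Rightarrow> real \<times> (real^'n) \<Rightarrow> real) \<Rightarrow> real \<times> (real^'n) \<Rightarrow> real^'n^'n" where
  "Jac f z = (\<chi> i j. (if i = j then 1 else 0) + dd (dirv (Some j)) (f i) z)"

text \<open>Cramer's rule written out: column \<open>l\<close> is replaced by the
  \<open>j\<close>-th unit vector. The explicit form shows the entries to be polynomials in the
  entries of \<open>Jac f\<close> times the reciprocal of the determinant, so that they are again
  tame.\<close>

definition Jac_inv :: "('n \<Rightarrow> real \<times> (real^'n) \<Rightarrow> real) \<Rightarrow> real \<times> (real^'n) \<Rightarrow> real^'n^'n" where
  "Jac_inv f z = (\<chi> l j. det (\<chi> i j'. if j' = l then axis j 1 $ i else Jac f z $ i $ j') * (1 / det (Jac f z)))"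

definition nondegenerate :: "('n \<Rightarrow> real \<times> (real^'n) \<Rightarrow> real) \<Rightarrow> bool" where
  "nondegenerate f \<longleftrightarrow> (\<forall>r. \<exists>\<delta>>0. \<forall>t x. \<bar>t\<bar> \<le> r \<longrightarrow> \<delta> \<le> det (Jac f (t, x)))"

lemma nondegenerate_pos: "nondegenerate f \<Longrightarrow> det (Jac f z) > 0"
  unfolding nondegenerate_def by (metis order.refl order_less_le_trans prod.collapse)

lemma shear_has_derivative:
  fixes f :: "'n \<Rightarrow> real \<times> (real^'n) \<Rightarrow> real"
  assumes "\<And>i. btame (f i)"
  shows "(shear f has_derivative (\<lambda>w. (fst w, snd w + (\<chi> i. dd w (f i) z)))) (at z)"
proof -
  have "((\<lambda>z. \<chi> i. f i z) has_derivative (\<lambda>w. \<chi> i. dd w (f i) z)) (at z)"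
    unfolding has_derivative_componentwise_within[where f="\<lambda>z. \<chi> i. f i z"]
    using has_derivative_dd[OF tame_differentiable[OF assms]]
    by (auto simp: Basis_vec_def inner_axis)
  then show ?thesis
    unfolding shear_def[abs_def] by (auto intro!: derivative_eq_intros)
qed

lemma shear_derivative_eq:
  fixes f :: "'n \<Rightarrow> real \<times> (real^'n) \<Rightarrow> real"
  assumes "\<And>i. btame (f i)"
  shows "snd w + (\<chi> i. dd w (f i) z) = Jac f z *v snd w + fst w *\<^sub>R (\<chi> i. dd (dirv None) (f i) z)"
proof -
  have "(snd w + (\<chi> i. dd w (f i) z)) $ k = (Jac f z *v snd w + fst w *\<^sub>R (\<chi> i. dd (dirv None) (f i) z)) $ k" for k
  proof -
    have "(Jac f z *v snd w) $ k = snd w $ k + (\<Sum>j\<in>UNIV. dd (dirv (Some j)) (f k) z * snd w $ j)"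
      by (simp add: Jac_def matrix_vector_mult_def distrib_right sum.distrib if_distrib[of "\<lambda>x. x * _"] cong: if_cong)
    then show ?thesis
      by (simp add: dd_spacetime[OF tame_differentiable[OF assms], of w k z] mult.commute)
  qed
  then show ?thesis by (simp add: vec_eq_iff)
qed

lemma shear_diff: "(\<And>i. btame (f i)) \<Longrightarrow> shear f differentiable (at z)"
  using shear_has_derivative differentiable_def by blast

lemma fiber_has_derivative:
  fixes f :: "'n \<Rightarrow> real \<times> (real^'n) \<Rightarrow> real"
  assumes "\<And>i. btame (f i)"
  shows "((\<lambda>x. x + (\<chi> i. f i (t, x))) has_derivative (\<lambda>v. Jac f (t, x) *v v)) (at x)"
proof -
  have "((\<lambda>x. (t, x)) has_derivative (\<lambda>h. (0, h))) (at x)"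
    by (auto intro!: derivative_eq_intros)
  from has_derivative_snd[OF has_derivative_compose[OF this shear_has_derivative[OF assms]]]
  have "((\<lambda>x. snd (shear f (t, x))) has_derivative (\<lambda>h. snd (0, h) + (\<chi> i. dd (0, h) (f i) (t, x)))) (at x)"
    by simp
  moreover have "h + (\<chi> i. dd (0, h) (f i) (t, x)) = Jac f (t, x) *v h" for h
    using shear_derivative_eq[OF assms, where w="(0, h)" and z="(t, x)"] by simp
  ultimately show ?thesis
    by (simp add: shear_def)
qed

lemma btame_Jac: "(\<And>i. btame (f i)) \<Longrightarrow> btame (\<lambda>z. Jac f z $ i $ j)"
  unfolding Jac_def vec_lambda_beta by (intro btame_add btame_const tame_dd)

lemma btame_det_Jac: "(\<And>i. btame (f i)) \<Longrightarrow> btame (\<lambda>z. det (Jac f z))"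
  by (intro btame_det btame_Jac)

lemma btame_Jac_inv:
  assumes f: "\<And>i. btame (f i)" and nd: "nondegenerate f"
  shows "btame (\<lambda>z. Jac_inv f z $ l $ j)"
proof -
  have "btame (\<lambda>z. det (\<chi> i j'. if j' = l then axis j 1 $ i else Jac f z $ i $ j'))"
  proof (rule btame_det)
    fix a b
    show "btame (\<lambda>z. (\<chi> i j'. if j' = l then axis j 1 $ i else Jac f z $ i $ j') $ a $ b)"
      by (cases "b = l") (simp_all add: btame_const btame_Jac[OF f])
  qed
  moreover have "btame (\<lambda>z. 1 / det (Jac f z))"
    using nd by (intro btame_recip btame_det_Jac f) (simp add: nondegenerate_def)
  ultimately show ?thesis
    unfolding Jac_inv_def vec_lambda_beta by (rule btame_mult)
qed

lemma Jac_inv: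
  assumes "nondegenerate f"
  shows "Jac f z ** Jac_inv f z = mat 1" "Jac_inv f z ** Jac f z = mat 1"
proof -
  have "det (Jac f z) \<noteq> 0" using nondegenerate_pos[OF assms, of z] by simp
  note cr = cramer[OF this, THEN iffD2, OF refl]
  have "(Jac f z ** Jac_inv f z) $ i $ j = mat 1 $ i $ j" for i j
  proof -
    have "(Jac f z ** Jac_inv f z) $ i $ j = (Jac f z *v (\<chi> l. Jac_inv f z $ l $ j)) $ i"
      by (simp add: matrix_matrix_mult_def matrix_vector_mult_def)
    also have "\<dots> = axis j 1 $ i"
      unfolding Jac_inv_def using cr[of "axis j 1"] by simp
    finally show ?thesis by (simp add: axis_def mat_def)
  qed
  then show 1: "Jac f z ** Jac_inv f z = mat 1" by (simp add: vec_eq_iff)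
  then show "Jac_inv f z ** Jac f z = mat 1" by (simp add: matrix_left_right_inverse)
qed

lemma Jac_inv_bounded:
  fixes f :: "'n \<Rightarrow> real \<times> (real^'n) \<Rightarrow> real"
  assumes f: "\<And>i. btame (f i)" and nd: "nondegenerate f"
  shows "\<exists>K>0. \<forall>t x v. \<bar>t\<bar> \<le> r \<longrightarrow> norm (Jac_inv f (t, x) *v v) \<le> K * norm v"
proof -
  have "\<exists>B. \<forall>t x. \<bar>t\<bar> \<le> r \<longrightarrow> \<bar>Jac_inv f (t, x) $ i $ j\<bar> \<le> B" for i j
    by (rule btame_bounded[OF btame_Jac_inv[OF assms]])
  then obtain B where B: "\<And>i j t x. \<bar>t\<bar> \<le> r \<Longrightarrow> \<bar>Jac_inv f (t, x) $ i $ j\<bar> \<le> B i j"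
    by metis
  define M where "M = (\<Sum>i\<in>UNIV. \<Sum>j\<in>UNIV. \<bar>B i j\<bar>) + 1"
  have "B i j \<le> M" for i j
  proof -
    have "\<bar>B i j\<bar> \<le> (\<Sum>j\<in>UNIV. \<bar>B i j\<bar>)" by (rule member_le_sum) auto
    also have "\<dots> \<le> (\<Sum>i\<in>UNIV. \<Sum>j\<in>UNIV. \<bar>B i j\<bar>)"
      by (rule member_le_sum[of i UNIV "\<lambda>i. \<Sum>j\<in>UNIV. \<bar>B i j\<bar>"]) (auto intro: sum_nonneg)
    finally show ?thesis by (simp add: M_def)
  qed
  then have "norm (Jac_inv f (t, x) *v v) \<le> (real CARD('n) * real CARD('n) * M) * norm v" if "\<bar>t\<bar> \<le> r" for t x v
    using B[OF that] by (intro norm_matrix_vector_le) (meson order_trans)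
  moreover have "real CARD('n) * real CARD('n) * M > 0"
    unfolding M_def by (intro mult_pos_pos add_nonneg_pos sum_nonneg) auto
  ultimately show ?thesis by blast
qed

text \<open>Uniform data for \<open>bij_uniform_local_diffeo\<close> at a fixed time: a bound
  \<open>K\<close> on the inverse Jacobian gives the lower bound \<open>1 / K\<close>, and the
  entries of the Jacobian are Lipschitz because the second derivatives of \<open>f\<close> are
  bounded.\<close>

lemma bij_fiber:
  fixes f :: "'n \<Rightarrow> real \<times> (real^'n) \<Rightarrow> real"
  assumes f: "\<And>i. btame (f i)" and nd: "nondegenerate f"
  shows "bij (\<lambda>x. x + (\<chi> i. f i (t, x)))"
proof -
  obtain K where K: "K > 0" "\<And>x v. norm (Jac_inv f (t, x) *v v) \<le> K * norm v"
    using Jac_inv_bounded[OF assms, of "\<bar>t\<bar>"] by auto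
  have "\<exists>L. \<forall>x y. \<bar>Jac f (t, x) $ i $ j - Jac f (t, y) $ i $ j\<bar> \<le> L * norm (x - y)" for i j
    using btame_slice_Lipschitz[OF btame_Jac[where f=f and i=i and j=j, OF f], of "\<bar>t\<bar>"] by auto
  then obtain L where L: "\<And>i j x y. \<bar>Jac f (t, x) $ i $ j - Jac f (t, y) $ i $ j\<bar> \<le> L i j * norm (x - y)"
    by metis
  define M where "M = (\<Sum>i\<in>UNIV. \<Sum>j\<in>UNIV. \<bar>L i j\<bar>)"
  have M: "L i j \<le> M" for i j
  proof -
    have "\<bar>L i j\<bar> \<le> (\<Sum>j\<in>UNIV. \<bar>L i j\<bar>)" by (rule member_le_sum) auto
    also have "\<dots> \<le> (\<Sum>i\<in>UNIV. \<Sum>j\<in>UNIV. \<bar>L i j\<bar>)"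
      by (rule member_le_sum[of i UNIV "\<lambda>i. \<Sum>j\<in>UNIV. \<bar>L i j\<bar>"]) (auto intro: sum_nonneg)
    finally show ?thesis by (simp add: M_def)
  qed
  show ?thesis
  proof (rule bij_uniform_local_diffeo[OF fiber_has_derivative[OF f]])
    show "1 / K > 0" using K by simp
    show "1 / K * norm v \<le> norm (Jac f (t, x) *v v)" for x v
    proof -
      have "v = Jac_inv f (t, x) *v (Jac f (t, x) *v v)"
        by (simp add: matrix_vector_mul_assoc Jac_inv[OF nd])
      then have "norm v \<le> K * norm (Jac f (t, x) *v v)"
        by (metis K(2))
      then show ?thesis using K(1) by (simp add: field_simps)
    qed
    show "norm (Jac f (t, x) *v v - Jac f (t, y) *v v)
      \<le> (real CARD('n) * real CARD('n) * M) * norm (x - y) * norm v" for x y v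
    proof -
      have "\<bar>(Jac f (t, x) - Jac f (t, y)) $ i $ j\<bar> \<le> M * norm (x - y)" for i j
        using L[where i=i and j=j and x=x and y=y] mult_right_mono[OF M[of i j] norm_ge_zero[of "x - y"]] by simp
      from norm_matrix_vector_le[OF this, of v]
      show ?thesis by (simp add: matrix_vector_mult_diff_rdistrib mult_ac)
    qed
  qed
qed

lemma bij_shear:
  fixes f :: "'n \<Rightarrow> real \<times> (real^'n) \<Rightarrow> real"
  assumes f: "\<And>i. btame (f i)" and nd: "nondegenerate f"
  shows "bij (shear f)"
proof (rule bijI)
  have b: "bij (\<lambda>x. x + (\<chi> i. f i (t, x)))" for t using bij_fiber[OF assms] .
  show "inj (shear f)"
  proof (rule injI)
    fix z w assume "shear f z = shear f w"
    then show "z = w"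
      using injD[OF bij_is_inj[OF b[of "fst z"]], of "snd z" "snd w"]
      by (cases z; cases w) (simp add: shear_def)
  qed
  show "surj (shear f)"
    unfolding surj_def
  proof
    fix z :: "real \<times> (real^'n)"
    obtain x where "snd z = x + (\<chi> i. f i (fst z, x))"
      using bij_is_surj[OF b[of "fst z"]] unfolding surj_def by blast
    then show "\<exists>w. z = shear f w"
      by (intro exI[of _ "(fst z, x)"]) (simp add: shear_def prod_eq_iff)
  qed
qed

section \<open>The inverse shear and composition with tame functions\<close>

abbreviation unshear :: "('n \<Rightarrow> real \<times> (real^'n) \<Rightarrow> real) \<Rightarrow> real \<times> (real^'n) \<Rightarrow> real \<times> (real^'n)" where
  "unshear f \<equiv> inv_into UNIV (shear f)"

text \<open>The block triangular derivative of \<open>shear f\<close> is solved for the space part: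
  first the time contribution is subtracted, then the inverse Jacobian is applied.\<close>

lemma unshear_has_derivative:
  fixes f :: "'n \<Rightarrow> real \<times> (real^'n) \<Rightarrow> real"
  assumes f: "\<And>i. btame (f i)" and nd: "nondegenerate f"
  shows "(unshear f has_derivative (\<lambda>w. (fst w, Jac_inv f (unshear f z) *v
      (snd w - fst w *\<^sub>R (\<chi> i. dd (dirv None) (f i) (unshear f z)))))) (at z)"
proof (rule has_derivative_inverse_basic[OF shear_has_derivative[OF f], where T=UNIV])
  have b: "bij (shear f)" by (rule bij_shear[OF assms])
  show "bounded_linear (\<lambda>w. (fst w, Jac_inv f (unshear f z) *v
      (snd w - fst w *\<^sub>R (\<chi> i. dd (dirv None) (f i) (unshear f z)))))"
    by (intro bounded_linear_Pair bounded_linear_fst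
        bounded_linear_compose[OF matrix_vector_mul_bounded_linear] bounded_linear_sub bounded_linear_snd
        bounded_linear_scaleR_left[THEN bounded_linear_compose])
  show "(\<lambda>w. (fst w, Jac_inv f (unshear f z) *v
      (snd w - fst w *\<^sub>R (\<chi> i. dd (dirv None) (f i) (unshear f z))))) \<circ>
      (\<lambda>w. (fst w, snd w + (\<chi> i. dd w (f i) (unshear f z)))) = id"
    unfolding shear_derivative_eq[OF f]
    by (simp add: fun_eq_iff matrix_vector_mul_assoc Jac_inv[OF nd])
  \<comment> \<open>Invariance of domain makes the inverse continuous before anything is known about
    its differentiability.\<close>
  have "continuous_on (range (shear f)) (unshear f)"
  proof (rule continuous_on_inverse_open)
    show "continuous_on UNIV (shear f)"
      using shear_diff[of f] f by (simp add: continuous_at_imp_continuous_on differentiable_imp_continuous_within)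
  qed (simp_all add: inv_f_f[OF bij_is_inj[OF b]])
  then show "continuous (at z) (unshear f)"
    unfolding bij_is_surj[OF b] by (simp add: continuous_on_eq_continuous_at del: split_paired_All)
  show "shear f (unshear f y) = y" for y
    by (simp add: surj_f_inv_f bij_is_surj[OF b])
qed simp_all

lemma fst_unshear:
  fixes f :: "'n \<Rightarrow> real \<times> (real^'n) \<Rightarrow> real"
  assumes f: "\<And>i. btame (f i)" and nd: "nondegenerate f"
  shows "fst (unshear f z) = fst z"
  by (metis bij_inv_eq_iff bij_shear[OF assms] fst_conv shear_def)

lemma snd_unshear:
  fixes f :: "'n \<Rightarrow> real \<times> (real^'n) \<Rightarrow> real"
  assumes f: "\<And>i. btame (f i)" and nd: "nondegenerate f"
  shows "snd (unshear f z) = snd z - (\<chi> i. f i (unshear f z))"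
proof -
  have "shear f (unshear f z) = z"
    by (simp add: surj_f_inv_f bij_is_surj[OF bij_shear[OF assms]])
  moreover have "snd (shear f y) = snd y + (\<chi> i. f i y)" for y
    by (simp add: shear_def)
  ultimately have "snd (unshear f z) + (\<chi> i. f i (unshear f z)) = snd z"
    by metis
  then show ?thesis by (simp add: algebra_simps)
qed

lemma fiber_displacement:
  fixes f :: "'n \<Rightarrow> real \<times> (real^'n) \<Rightarrow> real"
  assumes f: "\<And>i. btame (f i)"
  shows "\<exists>R. \<forall>t x. \<bar>t\<bar> \<le> r \<longrightarrow> norm (\<chi> i. f i (t, x)) \<le> R"
proof -
  have "\<exists>B. \<forall>t x. \<bar>t\<bar> \<le> r \<longrightarrow> \<bar>f i (t, x)\<bar> \<le> B" for i
    by (rule btame_bounded[OF f])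
  then obtain B where B: "\<And>i t x. \<bar>t\<bar> \<le> r \<Longrightarrow> \<bar>f i (t, x)\<bar> \<le> B i"
    by metis
  have "norm (\<chi> i. f i (t, x)) \<le> (\<Sum>i\<in>UNIV. B i)" if t: "\<bar>t\<bar> \<le> r" for t x
    using B[OF t] by (intro order_trans[OF norm_le_l1_cart] sum_mono) simp
  then show ?thesis by blast
qed

text \<open>
  No inverse, Lipschitz or Jacobian bound on \<open>F\<close> enters: allowing derivatives of \<open>f\<close> on the
  right-hand side makes a change of variables superfluous for the \<open>L\<^sup>p\<close> norms.
\<close>

definition displacement_control ::
  "((real^'n \<Rightarrow> real) \<Rightarrow> real \<Rightarrow> bool) \<Rightarrow> ((real^'n \<Rightarrow> real) \<Rightarrow> real \<Rightarrow> bool) \<Rightarrow> real \<Rightarrow> 'n list set \<Rightarrow> real \<Rightarrow> bool"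
where
  "displacement_control N N' R J K \<longleftrightarrow> finite J \<and> 0 \<le> K \<and>
     (\<forall>F (f :: real^'n \<Rightarrow> real^'n) i C. continuous_on UNIV F \<longrightarrow> (\<forall>x. norm (F x - x) \<le> R) \<longrightarrow>
        0 < C \<longrightarrow> smooth_map f \<longrightarrow> (\<forall>js\<in>J. N' (\<lambda>x. partials js f x $ i) C) \<longrightarrow>
        N (\<lambda>x. f (F x) $ i) (K * C))"

lemma displacement_controlD:
  fixes f :: "real^'n \<Rightarrow> real^'n"
  assumes "displacement_control N N' R J K" "continuous_on UNIV F" "\<And>x. norm (F x - x) \<le> R"
    "0 < C" "smooth_map f" "\<And>js. js \<in> J \<Longrightarrow> N' (\<lambda>x. partials js f x $ i) C"
  shows "N (\<lambda>x. f (F x) $ i) (K * C)"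
  using assms unfolding displacement_control_def by simp

text \<open>The norm \<open>N'\<close> on the right may differ from \<open>N\<close>: a weight has
  to be replaced by one that dominates its shift. For L^p the norm stays the same and derivatives
  enter through \<open>J\<close> instead.\<close>

definition reparametrizable :: "((real^'n \<Rightarrow> real) \<Rightarrow> real \<Rightarrow> bool) set \<Rightarrow> bool" where
  "reparametrizable \<N> \<longleftrightarrow> (\<forall>N\<in>\<N>. \<forall>R. \<exists>N'\<in>\<N>. \<exists>J K. displacement_control N N' R J K)"

text \<open>\<open>displacement_control\<close> and \<open>controls_sup\<close> speak of vector
  fields; a scalar \<open>v\<close> enters as the field with all components equal to
  \<open>v\<close>. \<open>D\<close> dominates the constants of the finitely many words in
  \<open>J\<close>, and its summand 1 makes it positive, as both predicates demand.\<close>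

lemma tame_slice_bound:
  fixes v :: "real \<times> (real^'n) \<Rightarrow> real" and J :: "'n list set"
  assumes v: "tame \<N> v" and N: "N \<in> \<N>" "size_bound N" and J: "finite J"
  shows "\<exists>D>0. \<forall>t js. \<bar>t\<bar> \<le> r \<longrightarrow> js \<in> J \<longrightarrow> N (\<lambda>x. partials js (\<lambda>x. \<chi> k::'n. v (t, x)) x $ i) D"
proof -
  have "\<forall>js. \<exists>C. \<forall>t. \<bar>t\<bar> \<le> r \<longrightarrow> N (\<lambda>x. dst (map Some js) v (t, x)) C"
    using tame_bounded[OF tame_dst[OF v] N(1)] by blast
  then obtain C where C: "\<And>js t. \<bar>t\<bar> \<le> r \<Longrightarrow> N (\<lambda>x. dst (map Some js) v (t, x)) (C js)"
    by metis
  define D where "D = 1 + (\<Sum>js\<in>J. \<bar>C js\<bar>)"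
  have D: "0 < D" unfolding D_def by (intro add_pos_nonneg sum_nonneg) auto
  have "C js \<le> D" if "js \<in> J" for js
    using member_le_sum[OF that, of "\<lambda>js. \<bar>C js\<bar>"] J by (simp add: D_def)
  then have "N (\<lambda>x. dst (map Some js) v (t, x)) D" if "\<bar>t\<bar> \<le> r" "js \<in> J" for t js
    using size_bound.weaken[OF N(2) C[OF that(1)]] that(2) by blast
  with D show ?thesis
    by (intro exI[of _ D]) (simp add: partials_slice(1)[where u="\<lambda>_. v", OF v])
qed

lemma tame_displaced:
  fixes a :: "real \<times> (real^'n) \<Rightarrow> real"
  assumes \<N>: "\<forall>N\<in>\<N>. size_bound N" "reparametrizable \<N>" and N: "N \<in> \<N>" and a: "tame \<N> a"
    and F: "\<And>t. continuous_on UNIV (F t)" and R: "\<And>t x. \<bar>t\<bar> \<le> r \<Longrightarrow> norm (F t x - x) \<le> R"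
  shows "\<exists>C. \<forall>t. \<bar>t\<bar> \<le> r \<longrightarrow> N (\<lambda>x. a (t, F t x)) C"
proof -
  obtain N' J K where N': "N' \<in> \<N>" and ctl: "displacement_control N N' R J K"
    using \<N>(2) N unfolding reparametrizable_def by blast
  have N's: "size_bound N'" and J: "finite J"
    using \<N>(1) N' ctl by (auto simp: displacement_control_def)
  obtain D where D: "D > 0"
    "\<forall>t js. \<bar>t\<bar> \<le> r \<longrightarrow> js \<in> J \<longrightarrow> N' (\<lambda>x. partials js (\<lambda>x. \<chi> k::'n. a (t, x)) x $ undefined) D"
    using tame_slice_bound[OF a N' N's J, of r undefined] by blast
  have "N (\<lambda>x. (\<chi> k::'n. a (t, F t x)) $ undefined) (K * D)" if t: "\<bar>t\<bar> \<le> r" for t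
    by (rule displacement_controlD[OF ctl F R[OF t] D(1) partials_slice(2)[where u="\<lambda>_. a", OF a]])
      (use D(2) t in simp_all)
  then show ?thesis by auto
qed

text \<open>The class of all \<open>a (unshear f z)\<close> with tame \<open>a\<close> is stable
  under derivatives: the chain rule coefficients, built from \<open>Jac_inv f\<close> and the time
  derivative of \<open>f\<close>, are evaluated at \<open>unshear f z\<close> too and merge with
  \<open>a\<close> into a new tame function. Tameness of the inverse is thus not
  presupposed.\<close>

lemma tame_unshear:
  fixes f :: "'n \<Rightarrow> real \<times> (real^'n) \<Rightarrow> real"
  assumes \<N>: "\<forall>N\<in>\<N>. size_bound N" "reparametrizable \<N>"
    and f: "\<And>i. btame (f i)" and nd: "nondegenerate f" and a: "tame \<N> a"
  shows "tame \<N> (\<lambda>z. a (unshear f z))"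
proof (rule tame_coinduct[where X="\<lambda>u. \<exists>a. tame \<N> a \<and> u = (\<lambda>z. a (unshear f z))"])
  show "\<exists>a'. tame \<N> a' \<and> (\<lambda>z. a (unshear f z)) = (\<lambda>z. a' (unshear f z))" using a by blast
  fix u assume "\<exists>a. tame \<N> a \<and> u = (\<lambda>z. a (unshear f z))"
  then obtain a where a: "tame \<N> a" and u: "u = (\<lambda>z. a (unshear f z))" by blast
  have hd: "(u has_derivative (\<lambda>w. dd (fst w, Jac_inv f (unshear f z) *v
      (snd w - fst w *\<^sub>R (\<chi> i. dd (dirv None) (f i) (unshear f z)))) a (unshear f z))) (at z)" for z
    unfolding u
    by (rule has_derivative_compose[OF unshear_has_derivative[OF f nd] has_derivative_dd[OF tame_differentiable[OF a]]])
  show "u differentiable (at z)" for z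
    using hd[of z] unfolding differentiable_def by blast
  have b: "bij (shear f)" by (rule bij_shear[OF f nd])
  have cu: "continuous_on UNIV (unshear f)"
    using unshear_has_derivative[OF f nd] by (meson continuous_at_imp_continuous_on has_derivative_continuous)
  have uf: "unshear f (t, x) = (t, snd (unshear f (t, x)))" for t x
    using fst_unshear[OF f nd, of "(t, x)"] by (simp add: prod_eq_iff)
  have su: "shear f (unshear f z) = z" and us: "unshear f (shear f z) = z" for z
    by (simp_all add: surj_f_inv_f bij_is_surj[OF b] inv_f_f bij_is_inj[OF b])
  have sf: "shear f (t, x) = (t, snd (shear f (t, x)))" for t x
    by (simp add: shear_def)
  show "\<exists>C. \<forall>t. \<bar>t\<bar> \<le> r \<longrightarrow> N (\<lambda>x. u (t, x)) C" if N: "N \<in> \<N>" for N r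
  proof -
    obtain R where R: "\<And>t x. \<bar>t\<bar> \<le> r \<Longrightarrow> norm (\<chi> i. f i (t, x)) \<le> R"
      using fiber_displacement[of f r] f by blast
    have "\<exists>C. \<forall>t. \<bar>t\<bar> \<le> r \<longrightarrow> N (\<lambda>x. a (t, snd (unshear f (t, x)))) C"
    proof (rule tame_displaced[OF \<N> N a])
      show "continuous_on UNIV (\<lambda>x. snd (unshear f (t, x)))" for t
        by (intro continuous_on_snd continuous_on_compose2[OF cu]) (auto intro!: continuous_intros)
      show "norm (snd (unshear f (t, x)) - x) \<le> R" if "\<bar>t\<bar> \<le> r" for t x
        using R[OF that, of "snd (unshear f (t, x))"] snd_unshear[OF f nd, of "(t, x)"] uf[of t x] by simp
    qed
    then show ?thesis unfolding u using uf by simp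
  qed
  fix j
  \<comment> \<open>The chain rule in direction \<open>dirv j\<close> with
    \<open>unshear f z\<close> replaced by a free point \<open>z\<close>: \<open>c\<close> is the
    vector to which the inverse Jacobian is applied, and \<open>a'\<close> is the new outer
    function.\<close>
  define c where "c z l = snd (dirv j) $ l - fst (dirv j) * dd (dirv None) (f l) z" for z and l :: 'n
  define a' where "a' z = fst (dirv j) * dd (dirv None) a z +
     (\<Sum>i\<in>UNIV. (\<Sum>l\<in>UNIV. Jac_inv f z $ i $ l * c z l) * dd (dirv (Some i)) a z)" for z
  have "tame \<N> a'"
    unfolding a'_def c_def
    by (intro tame_add tame_cmult tame_sum tame_mult btame_sum btame_mult btame_diff btame_cmult btame_const
        btame_Jac_inv tame_dd \<N> f nd a)
  moreover have "dd (dirv j) u z = a' (unshear f z)" for z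
    unfolding dd_eqI[OF hd[of z], of "dirv j"] a'_def
    by (subst dd_spacetime[OF tame_differentiable[OF a]]) (simp add: matrix_vector_mult_def c_def)
  ultimately show "\<exists>a. tame \<N> a \<and> dd (dirv j) u = (\<lambda>z. a (unshear f z))"
    by blast
qed

text \<open>In contrast to \<open>tame_unshear\<close>, the derivatives of \<open>f\<close> in the
  chain rule are evaluated at \<open>z\<close> and not at \<open>shear f z\<close>. They cannot be
  absorbed into \<open>a\<close>; hence the span with bounded coefficients.\<close>

lemma tame_shear:
  fixes f :: "'n \<Rightarrow> real \<times> (real^'n) \<Rightarrow> real"
  assumes \<N>: "\<forall>N\<in>\<N>. size_bound N" "reparametrizable \<N>"
    and f: "\<And>i. btame (f i)" and a: "tame \<N> a"
  shows "tame \<N> (\<lambda>z. a (shear f z))"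
proof (rule chain_span_tame[OF \<N>(1) shear_diff[OF f]])
  have sf: "shear g (t, x) = (t, snd (shear g (t, x)))" for g :: "'n \<Rightarrow> real \<times> (real^'n) \<Rightarrow> real" and t x
    by (simp add: shear_def)
  show "\<exists>C. \<forall>t. \<bar>t\<bar> \<le> r \<longrightarrow> N (\<lambda>x. a (shear f (t, x))) C" if a: "tame \<N> a" and N: "N \<in> \<N>" for a N r
  proof -
    obtain R where R: "\<And>t x. \<bar>t\<bar> \<le> r \<Longrightarrow> norm (\<chi> i. f i (t, x)) \<le> R"
      using fiber_displacement[of f r] f by blast
    have "\<exists>C. \<forall>t. \<bar>t\<bar> \<le> r \<longrightarrow> N (\<lambda>x. a (t, snd (shear f (t, x)))) C"
    proof (rule tame_displaced[OF \<N> N a])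
      show "continuous_on UNIV (\<lambda>x. snd (shear f (t, x)))" for t
        using fiber_has_derivative[of f t] f unfolding shear_def
        by (simp) (meson continuous_at_imp_continuous_on has_derivative_continuous)
      show "norm (snd (shear f (t, x)) - x) \<le> R" if "\<bar>t\<bar> \<le> r" for t x
        using R[OF that, of x] by (simp add: shear_def)
    qed
    then show ?thesis using sf[of f] by simp
  qed
  show "\<exists>c. (\<forall>l. btame (c l)) \<and> dd (dirv j) (\<lambda>z. a (shear f z)) = (\<lambda>z. \<Sum>l\<in>UNIV. c l z * dd (dirv l) a (shear f z))"
    if a: "tame \<N> a" for a j
  proof -
    \<comment> \<open>The components of the derivative of \<open>shear f\<close> applied to
      \<open>dirv j\<close>.\<close>
    define c where "c l = (case l of None \<Rightarrow> (\<lambda>z. fst (dirv j :: real \<times> (real^'n)))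
      | Some i \<Rightarrow> (\<lambda>z. snd (dirv j) $ i + dd (dirv j) (f i) z))" for l
    have "btame (c l)" for l
      by (cases l) (auto simp: c_def btame_const intro!: btame_add btame_const tame_dd f)
    moreover have "dd (dirv j) (\<lambda>z. a (shear f z)) z = (\<Sum>l\<in>UNIV. c l z * dd (dirv l) a (shear f z))" for z
      by (subst dd_eqI[OF has_derivative_compose[OF shear_has_derivative[OF f] has_derivative_dd[OF tame_differentiable[OF a]]]],
          subst dd_spacetime[OF tame_differentiable[OF a]]) (simp add: sum_option c_def)
    ultimately show ?thesis by blast
  qed
qed (use a in \<open>rule chain_span.base\<close>)

section \<open>A mean value inequality for size bounds\<close>

text \<open>Partial derivatives alone give no joint derivative; uniformity in \<open>w\<close> of
  the time quotient does. The increment from \<open>(t, x)\<close> to \<open>(s, w)\<close> splits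
  into the time error at \<open>w\<close>, the oscillation of \<open>v\<close> between
  \<open>w\<close> and \<open>x\<close>, and the slice error, each given a third of
  \<open>e\<close>.\<close>

lemma has_derivative_uniform_slices:
  fixes u :: "real \<times> 'a::real_normed_vector \<Rightarrow> real"
  assumes unif: "\<And>e. e > 0 \<Longrightarrow> \<exists>d>0. \<forall>s w. \<bar>s - t\<bar> < d \<longrightarrow> \<bar>u (s, w) - u (t, w) - (s - t) * v w\<bar> \<le> e * \<bar>s - t\<bar>"
    and v: "isCont v x"
    and D: "((\<lambda>w. u (t, w)) has_derivative D) (at x)"
  shows "(u has_derivative (\<lambda>w. fst w * v x + D (snd w))) (at (t, x))"
  unfolding has_derivative_at_alt
proof (intro conjI allI impI)
  show "bounded_linear (\<lambda>w. fst w * v x + D (snd w))"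
    by (intro bounded_linear_add bounded_linear_compose[OF has_derivative_bounded_linear[OF D]]
        bounded_linear_snd bounded_linear_mult_const bounded_linear_fst)
  fix e :: real assume "e > 0"
  then have e: "e / 3 > 0" by simp
  obtain d1 where d1: "d1 > 0" "\<And>s w. \<bar>s - t\<bar> < d1 \<Longrightarrow> \<bar>u (s, w) - u (t, w) - (s - t) * v w\<bar> \<le> e / 3 * \<bar>s - t\<bar>"
    using unif[OF e] by blast
  obtain d2 where d2: "d2 > 0" "\<And>w. dist w x < d2 \<Longrightarrow> dist (v w) (v x) < e / 3"
    using v e unfolding continuous_at_eps_delta by meson
  obtain d3 where d3: "d3 > 0" "\<And>w. norm (w - x) < d3 \<Longrightarrow> norm (u (t, w) - u (t, x) - D (w - x)) \<le> e / 3 * norm (w - x)"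
    using D e unfolding has_derivative_at_alt by meson
  show "\<exists>d>0. \<forall>y. norm (y - (t, x)) < d \<longrightarrow>
      norm (u y - u (t, x) - (fst (y - (t, x)) * v x + D (snd (y - (t, x))))) \<le> e * norm (y - (t, x))"
  proof (intro exI[of _ "min d1 (min d2 d3)"] conjI allI impI)
    fix y :: "real \<times> 'a" assume y: "norm (y - (t, x)) < min d1 (min d2 d3)"
    obtain s w where y_eq: "y = (s, w)" by (cases y)
    define n where "n = norm (y - (t, x))"
    have ns: "\<bar>s - t\<bar> \<le> n" and nw: "norm (w - x) \<le> n"
      using norm_fst_le[of "s - t" "w - x"] norm_snd_le[of "w - x" "s - t"] by (auto simp: n_def y_eq)
    have 1: "\<bar>u (s, w) - u (t, w) - (s - t) * v w\<bar> \<le> e / 3 * n"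
    proof (rule order_trans)
      show "\<bar>u (s, w) - u (t, w) - (s - t) * v w\<bar> \<le> e / 3 * \<bar>s - t\<bar>"
        using ns y by (intro d1(2)) (simp add: n_def[symmetric])
    qed (use mult_left_mono[OF ns, of "e / 3"] e in simp)
    have 2: "\<bar>(s - t) * v w - (s - t) * v x\<bar> \<le> e / 3 * n"
    proof -
      have "\<bar>v w - v x\<bar> \<le> e / 3"
        using d2(2)[of w] nw y by (simp add: dist_norm n_def[symmetric])
      then have "\<bar>v w - v x\<bar> * \<bar>s - t\<bar> \<le> e / 3 * n"
        using ns e by (intro mult_mono) auto
      moreover have "\<bar>(s - t) * v w - (s - t) * v x\<bar> = \<bar>v w - v x\<bar> * \<bar>s - t\<bar>"
        unfolding right_diff_distrib[symmetric] abs_mult by (rule mult.commute)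
      ultimately show ?thesis by linarith
    qed
    have 3: "\<bar>u (t, w) - u (t, x) - D (w - x)\<bar> \<le> e / 3 * n"
    proof (rule order_trans)
      show "\<bar>u (t, w) - u (t, x) - D (w - x)\<bar> \<le> e / 3 * norm (w - x)"
        using nw y d3(2)[of w] by (simp add: n_def[symmetric])
    qed (use mult_left_mono[OF nw, of "e / 3"] e in simp)
    show "norm (u y - u (t, x) - (fst (y - (t, x)) * v x + D (snd (y - (t, x))))) \<le> e * norm (y - (t, x))"
    proof -
      have "u y - u (t, x) - (fst (y - (t, x)) * v x + D (snd (y - (t, x)))) =
          (u (s, w) - u (t, w) - (s - t) * v w) + ((s - t) * v w - (s - t) * v x) + (u (t, w) - u (t, x) - D (w - x))"
        by (simp add: y_eq)
      then show ?thesis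
        unfolding n_def[symmetric] real_norm_def using 1 2 3 by linarith
    qed
  qed (use d1 d2 d3 in auto)
qed

context size_bound
begin

text \<open>Riemann sums of \<open>\<psi>'\<close> are averages of functions of size at most
  \<open>C\<close>, so they have size at most \<open>C\<close> themselves. They converge pointwise
  to the increment of \<open>\<psi>\<close>, and \<open>Fatou\<close> transfers the bound.\<close>

lemma mean_value_unit:
  fixes \<psi> :: "real \<Rightarrow> real^'n \<Rightarrow> real"
  assumes d1: "\<And>s x. ((\<lambda>s. \<psi> s x) has_real_derivative \<psi>' s x) (at s)"
    and d2: "\<And>s x. ((\<lambda>s. \<psi>' s x) has_real_derivative \<psi>'' s x) (at s)"
    and c0: "\<And>s. continuous_on UNIV (\<psi> s)" and c1: "\<And>s. continuous_on UNIV (\<psi>' s)"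
    and c2: "\<And>x. continuous_on UNIV (\<lambda>s. \<psi>'' s x)"
    and bound: "\<And>s. s \<in> {0..1} \<Longrightarrow> N (\<psi>' s) C"
  shows "N (\<lambda>x. \<psi> 1 x - \<psi> 0 x) C"
proof -
  \<comment> \<open>Left endpoint sums; \<open>Suc n\<close> keeps the number of nodes
    positive.\<close>
  define F where "F n x = (\<Sum>i<Suc n. (1 / Suc n) * \<psi>' (i / Suc n) x)" for n :: nat and x
  show ?thesis
  proof (rule Fatou[of F])
    show "continuous_on UNIV (F n)" for n
      unfolding F_def by (intro continuous_intros c1)
    show "continuous_on UNIV (\<lambda>x. \<psi> 1 x - \<psi> 0 x)"
      by (intro continuous_intros c0)
    show "N (F n) C" for n
    proof -
      have "N (\<lambda>x. \<Sum>i<Suc n. (1 / Suc n) * \<psi>' (i / Suc n) x) (\<Sum>i<Suc n. \<bar>1 / real (Suc n)\<bar> * C)"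
        by (intro sum_bound continuous_on_mult continuous_on_const c1 scale bound) (auto simp: divide_simps)
      also have "(\<Sum>i<Suc n. \<bar>1 / real (Suc n)\<bar> * C) = C"
        by (simp add: divide_simps)
      finally show ?thesis unfolding F_def .
    qed
    fix x
    \<comment> \<open>The bound \<open>M\<close> on the second derivative depends on
      \<open>x\<close>, which is harmless as \<open>Fatou\<close> asks only for pointwise
      convergence.\<close>
    have "compact ((\<lambda>s. \<psi>'' s x) ` {0..1})"
      by (intro compact_continuous_image continuous_on_subset[OF c2]) auto
    then have "bounded ((\<lambda>s. \<psi>'' s x) ` {0..1})" by (rule compact_imp_bounded)
    then obtain M where "\<forall>y\<in>(\<lambda>s. \<psi>'' s x) ` {0..1}. norm y \<le> M"
      unfolding bounded_iff by blast
    then have M: "\<bar>\<psi>'' s x\<bar> \<le> M" if "s \<in> {0..1}" for s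
      using that by (metis imageI real_norm_def)
    have M0: "0 \<le> M" using M[of 0] by auto
    \<comment> \<open>Quadratic remainder from two uses of the mean value theorem; summed over
      \<open>Suc n\<close> intervals it leaves an error of order \<open>1 / Suc n\<close>.\<close>
    have step: "\<bar>\<psi> b x - \<psi> a x - (b - a) * \<psi>' a x\<bar> \<le> M * (b - a)\<^sup>2" if ab: "0 \<le> a" "a < b" "b \<le> 1" for a b
    proof -
      obtain \<xi> where \<xi>: "a < \<xi>" "\<xi> < b" "\<psi> b x - \<psi> a x = (b - a) * \<psi>' \<xi> x"
        using MVT2[OF ab(2) d1] by blast
      obtain \<eta> where \<eta>: "a < \<eta>" "\<eta> < \<xi>" "\<psi>' \<xi> x - \<psi>' a x = (\<xi> - a) * \<psi>'' \<eta> x"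
        using MVT2[OF \<xi>(1) d2] by blast
      have "\<psi> b x - \<psi> a x - (b - a) * \<psi>' a x = (b - a) * ((\<xi> - a) * \<psi>'' \<eta> x)"
        unfolding \<xi>(3) \<eta>(3)[symmetric] by (simp add: algebra_simps)
      also have "\<bar>\<dots>\<bar> \<le> (b - a) * ((b - a) * M)"
        unfolding abs_mult using ab \<xi> \<eta> M[of \<eta>] by (intro mult_mono) auto
      finally show ?thesis by (simp add: power2_eq_square mult_ac)
    qed
    have err: "\<bar>\<psi> 1 x - \<psi> 0 x - F n x\<bar> \<le> M * (1 / Suc n)" for n
    proof -
      have "\<psi> 1 x - \<psi> 0 x = (\<Sum>i<Suc n. \<psi> (Suc i / Suc n) x - \<psi> (i / Suc n) x)"
        by (subst sum_lessThan_telescope[of "\<lambda>i. \<psi> (real i / real (Suc n)) x" "Suc n"]) simp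
      then have "\<psi> 1 x - \<psi> 0 x - F n x =
          (\<Sum>i<Suc n. \<psi> (Suc i / Suc n) x - \<psi> (i / Suc n) x - (1 / Suc n) * \<psi>' (i / Suc n) x)"
        by (simp only: F_def sum_subtractf)
      also have "\<bar>\<dots>\<bar> \<le> (\<Sum>i<Suc n. M * (1 / Suc n)\<^sup>2)"
      proof (rule order_trans[OF sum_abs sum_mono])
        fix i assume "i \<in> {..<Suc n}"
        then have i: "i < Suc n" by simp
        have eq: "real (Suc i) / real (Suc n) - real i / real (Suc n) = 1 / real (Suc n)"
          by (simp only: diff_divide_distrib[symmetric] of_nat_Suc) simp
        have "0 \<le> real i / real (Suc n)" "real i / real (Suc n) < real (Suc i) / real (Suc n)"
          by (auto intro!: divide_strict_right_mono)
        moreover have "real (Suc i) / real (Suc n) \<le> 1"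
          using i by (auto simp only: divide_le_eq_1_pos of_nat_0_less_iff of_nat_le_iff zero_less_Suc Suc_le_eq)
        ultimately have "\<bar>\<psi> (Suc i / Suc n) x - \<psi> (i / Suc n) x - (Suc i / Suc n - i / Suc n) * \<psi>' (i / Suc n) x\<bar>
            \<le> M * (Suc i / Suc n - i / Suc n)\<^sup>2"
          by (rule step)
        then show "\<bar>\<psi> (Suc i / Suc n) x - \<psi> (i / Suc n) x - (1 / Suc n) * \<psi>' (i / Suc n) x\<bar> \<le> M * (1 / Suc n)\<^sup>2"
          unfolding eq .
      qed
      also have "\<dots> = M * (1 / Suc n)"
        by (simp add: power2_eq_square divide_simps)
      finally show ?thesis .
    qed
    have lim: "(\<lambda>n. M * (1 / Suc n)) \<longlonglongrightarrow> 0"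
      using tendsto_mult[OF tendsto_const[of M] LIMSEQ_Suc[OF lim_1_over_n]] by (simp only: mult_zero_right)
    have "(\<lambda>n. \<psi> 1 x - \<psi> 0 x - F n x) \<longlonglongrightarrow> 0"
      by (rule Lim_null_comparison[OF _ lim], rule always_eventually, rule allI, unfold real_norm_def, rule err)
    from tendsto_diff[OF tendsto_const this, of "\<psi> 1 x - \<psi> 0 x"]
    show "(\<lambda>n. F n x) \<longlonglongrightarrow> \<psi> 1 x - \<psi> 0 x" by simp
  qed
qed

lemma mean_value:
  fixes \<phi> :: "real \<Rightarrow> real^'n \<Rightarrow> real"
  assumes d1: "\<And>s x. ((\<lambda>s. \<phi> s x) has_real_derivative \<phi>' s x) (at s)"
    and d2: "\<And>s x. ((\<lambda>s. \<phi>' s x) has_real_derivative \<phi>'' s x) (at s)"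
    and c0: "\<And>s. continuous_on UNIV (\<phi> s)" and c1: "\<And>s. continuous_on UNIV (\<phi>' s)"
    and c2: "\<And>x. continuous_on UNIV (\<lambda>s. \<phi>'' s x)"
    and bound: "\<And>s. \<bar>s - a\<bar> \<le> \<bar>b - a\<bar> \<Longrightarrow> N (\<phi>' s) C"
  shows "N (\<lambda>x. \<phi> b x - \<phi> a x) (\<bar>b - a\<bar> * C)"
proof -
  define p where "p s = a + s * (b - a)" for s
  have p: "(p has_real_derivative (b - a)) (at s)" for s
    unfolding p_def by (auto intro!: derivative_eq_intros)
  have "N (\<lambda>x. \<phi> (p 1) x - \<phi> (p 0) x) (\<bar>b - a\<bar> * C)"
  proof (rule mean_value_unit[where \<psi>="\<lambda>s. \<phi> (p s)" and \<psi>'="\<lambda>s x. (b - a) * \<phi>' (p s) x" and \<psi>''="\<lambda>s x. (b - a) * (\<phi>'' (p s) x * (b - a))"])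
    show "((\<lambda>s. \<phi> (p s) x) has_real_derivative (b - a) * \<phi>' (p s) x) (at s)" for s x
      using DERIV_chain2[OF d1 p] by (simp add: mult.commute)
    show "((\<lambda>s. (b - a) * \<phi>' (p s) x) has_real_derivative (b - a) * (\<phi>'' (p s) x * (b - a))) (at s)" for s x
      using DERIV_cmult[OF DERIV_chain2[OF d2 p]] by simp
    show "continuous_on UNIV (\<lambda>s. (b - a) * (\<phi>'' (p s) x * (b - a)))" for x
      unfolding p_def by (intro continuous_intros continuous_on_compose2[OF c2]) auto
    show "N (\<lambda>x. (b - a) * \<phi>' (p s) x) (\<bar>b - a\<bar> * C)" if "s \<in> {0..1}" for s
      using that by (intro scale c1 bound) (auto simp: p_def abs_mult intro!: mult_left_le_one_le)
  qed (intro continuous_intros c0 c1)+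
  then show ?thesis by (simp add: p_def)
qed

end

lemma tame_DERIV_time:
  assumes "tame \<N> u"
  shows "((\<lambda>s. u (s, x)) has_real_derivative dd (dirv None) u (s, x)) (at s)"
  using DERIV_line[OF tame_differentiable[OF assms], of "(0, x)" "(1, 0)" s] by (simp add: dirv_def)

text \<open>A Taylor remainder of second order, measured by \<open>N\<close>. The mean value
  inequality bounds the increment of the time derivative first and then the remainder
  itself.\<close>

lemma tame_difference_quotient:
  fixes v :: "real \<times> (real^'n) \<Rightarrow> real"
  assumes v: "tame \<N> v" and N: "N \<in> \<N>" "size_bound N"
  shows "\<exists>C. \<forall>h. \<bar>h\<bar> \<le> 1 \<longrightarrow> N (\<lambda>x. v (t + h, x) - v (t, x) - h * dd (dirv None) v (t, x)) (\<bar>h\<bar> * (\<bar>h\<bar> * C))"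
proof -
  interpret size_bound N by (rule N)
  let ?v' = "dd (dirv None) v" and ?v'' = "dd (dirv None) (dd (dirv None) v)"
  have v': "tame \<N> ?v'" and v'': "tame \<N> ?v''" and v''': "tame \<N> (dd (dirv None) ?v'')"
    by (intro tame_dd v)+
  have cs: "continuous_on UNIV (\<lambda>s. w (s, x))" if "tame \<N> w" for w x
    by (rule continuous_on_compose2[OF tame_continuous[OF that, of UNIV]]) (auto intro!: continuous_intros)
  obtain C where C: "\<And>s. \<bar>s\<bar> \<le> \<bar>t\<bar> + 1 \<Longrightarrow> N (\<lambda>x. ?v'' (s, x)) C"
    using tame_bounded[OF v'' N(1)] by blast
  have 1: "N (\<lambda>x. ?v' (s, x) - ?v' (t, x)) (\<bar>h\<bar> * C)" if "\<bar>s - t\<bar> \<le> \<bar>h\<bar>" "\<bar>h\<bar> \<le> 1" for s h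
  proof (rule weaken)
    show "N (\<lambda>x. ?v' (s, x) - ?v' (t, x)) (\<bar>s - t\<bar> * C)"
      using that
      by (intro mean_value[where \<phi>="\<lambda>s x. ?v' (s, x)" and \<phi>'="\<lambda>s x. ?v'' (s, x)" and \<phi>''="\<lambda>s x. dd (dirv None) ?v'' (s, x)"]
          tame_DERIV_time[OF v'] tame_DERIV_time[OF v''] tame_continuous_slice[OF v'] tame_continuous_slice[OF v''] cs v''' C) auto
    have "0 \<le> C" using nonneg C[of 0] by auto
    then show "\<bar>s - t\<bar> * C \<le> \<bar>h\<bar> * C" using that by (intro mult_right_mono)
  qed
  \<comment> \<open>A term linear in \<open>s\<close> is subtracted, so that the time derivative
    becomes the increment just bounded.\<close>
  have "N (\<lambda>x. (v (t + h, x) - (t + h) * ?v' (t, x)) - (v (t, x) - t * ?v' (t, x))) (\<bar>(t + h) - t\<bar> * (\<bar>h\<bar> * C))" if h: "\<bar>h\<bar> \<le> 1" for h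
    by (rule mean_value[where \<phi>="\<lambda>s x. v (s, x) - s * ?v' (t, x)" and \<phi>'="\<lambda>s x. ?v' (s, x) - ?v' (t, x)" and \<phi>''="\<lambda>s x. ?v'' (s, x)"])
      (use h in \<open>auto intro!: derivative_eq_intros tame_DERIV_time[OF v] tame_DERIV_time[OF v'] continuous_intros
         tame_continuous_slice[OF v] tame_continuous_slice[OF v'] cs[OF v''] 1\<close>)
  then show ?thesis by (intro exI[of _ C]) (simp add: algebra_simps)
qed

lemma tame_dd_commute:
  assumes "tame \<N> u"
  shows "dd (dirv i) (dd (dirv j) u) = dd (dirv j) (dd (dirv i) u)"
proof
  fix z
  have c: "isCont w z" if "tame \<N> w" for w
    using tame_differentiable[OF that] by (rule differentiable_imp_continuous_within)
  show "dd (dirv i) (dd (dirv j) u) z = dd (dirv j) (dd (dirv i) u) z"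
    by (rule dd_commute) (intro c tame_differentiable[where \<N>=\<N>] tame_dd assms)+
qed

lemma dst_time_commute:
  assumes "tame \<N> u"
  shows "dst js (dd (dirv j) u) = dd (dirv j) (dst js u)"
  by (induction js) (simp_all add: tame_dd_commute[OF tame_dst[OF assms]])

section \<open>Smooth curves in function spaces\<close>

lemma lctvs_continuous_translation:
  assumes "lctvs T" "a \<in> topspace T"
  shows "continuous_map T T (\<lambda>x. x + a)"
proof -
  have "continuous_map T (prod_topology T T) (\<lambda>x. (x, a))"
    using assms(2) by (simp add: continuous_map_pairedI)
  moreover have "continuous_map (prod_topology T T) T (\<lambda>(x, y). x + y)"
    using assms(1) by (simp add: lctvs_def)
  ultimately have "continuous_map T T ((\<lambda>(x, y). x + y) \<circ> (\<lambda>x. (x, a)))"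
    by (rule continuous_map_compose)
  then show ?thesis by (simp add: o_def)
qed

lemma lctvs_limitin_shift:
  assumes "lctvs T" "a \<in> topspace T" "limitin T f l F"
  shows "limitin T (\<lambda>h. f h + a) (l + a) F"
  using continuous_map_limit[OF lctvs_continuous_translation[OF assms(1,2)] assms(3)] by (simp add: o_def)

text \<open>Convergence is moved to 0, the only point at which the topologies are compared with
  sizes.\<close>

lemma lctvs_limitin_iff:
  assumes "lctvs T" "l \<in> topspace T"
  shows "limitin T f l F \<longleftrightarrow> limitin T (\<lambda>h. f h - l) 0 F"
proof -
  have "- l \<in> topspace T"
    using assms subspace_neg by (auto simp: lctvs_def)
  then show ?thesis
    using lctvs_limitin_shift[OF assms(1), of "- l" f l F] lctvs_limitin_shift[OF assms, of "\<lambda>h. f h - l" 0 F]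
    by auto
qed

text \<open>The Sobolev embedding in abstract form; the single \<open>C\<close> stands for a common
  bound on the derivatives in \<open>J\<close>.\<close>

definition controls_sup :: "((real^'n \<Rightarrow> real) \<Rightarrow> real \<Rightarrow> bool) \<Rightarrow> 'n list set \<Rightarrow> real \<Rightarrow> bool" where
  "controls_sup N J K \<longleftrightarrow> finite J \<and> 0 \<le> K \<and>
     (\<forall>(f :: real^'n \<Rightarrow> real^'n) i C. 0 < C \<longrightarrow> smooth_map f \<longrightarrow>
        (\<forall>js\<in>J. N (\<lambda>x. partials js f x $ i) C) \<longrightarrow> (\<forall>x. \<bar>f x $ i\<bar> \<le> K * C))"

lemma controls_supD:
  fixes f :: "real^'n \<Rightarrow> real^'n"
  assumes "controls_sup N J K" "0 < C" "smooth_map f" "\<And>js. js \<in> J \<Longrightarrow> N (\<lambda>x. partials js f x $ i) C"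
  shows "\<bar>f x $ i\<bar> \<le> K * C"
  using assms unfolding controls_sup_def by simp

text \<open>\<open>zero_neighbourhood\<close> makes every size small near 0, and
  \<open>sequence_convergence\<close> is the converse for sequences: together they say that
  \<open>T\<close> and the sizes have the same null sequences. \<open>embedding\<close> and
  \<open>reparametrizable\<close> are the analytic input, on which the chain rule arguments
  rest.\<close>

locale function_space =
  fixes T :: "(real^'n \<Rightarrow> real^'n) topology"
    and \<N> :: "((real^'n \<Rightarrow> real) \<Rightarrow> real \<Rightarrow> bool) set"
  assumes lctvs: "lctvs T"
    and size: "\<forall>N\<in>\<N>. size_bound N"
    and topspace: "topspace T = {f. smooth_map f \<and> (\<forall>N\<in>\<N>. \<forall>js i. \<exists>C. N (\<lambda>x. partials js f x $ i) C)}"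
    and zero_neighbourhood: "\<And>N js i e. N \<in> \<N> \<Longrightarrow> 0 < e \<Longrightarrow>
          \<exists>U. openin T U \<and> 0 \<in> U \<and> (\<forall>f\<in>U. N (\<lambda>x. partials js f x $ i) e)"
    and sequence_convergence: "\<And>f. range f \<subseteq> topspace T \<Longrightarrow>
          (\<And>N js i e. N \<in> \<N> \<Longrightarrow> 0 < e \<Longrightarrow> \<forall>\<^sub>F n in sequentially. N (\<lambda>x. partials js (f n) x $ i) e) \<Longrightarrow>
          limitin T f 0 sequentially"
    and embedding: "\<exists>N\<in>\<N>. \<exists>J K. controls_sup N J K"
    and reparametrizable: "reparametrizable \<N>"
begin

lemma smooth: "f \<in> topspace T \<Longrightarrow> smooth_map f"
  by (simp add: topspace)

lemma subspace: "subspace (topspace T)"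
  using lctvs by (simp add: lctvs_def)

lemma zero_neighbourhoodE:
  assumes "N \<in> \<N>" "0 < e"
  obtains U where "openin T U" "0 \<in> U" "\<And>f. f \<in> U \<Longrightarrow> N (\<lambda>x. partials js f x $ i) e"
proof (rule exE[OF zero_neighbourhood[OF assms, of js i]], elim conjE)
  fix U assume 1: "openin T U" "0 \<in> U" and 2: "\<forall>f\<in>U. N (\<lambda>x. partials js f x $ i) e"
  show thesis by (rule that[OF 1]) (rule bspec[OF 2])
qed

text \<open>Components of a curve in the space may therefore serve as bounded coefficients in chain
  rules and determinants. The embedding is applied to every iterated derivative.\<close>

lemma tame_imp_btame:
  assumes a: "tame \<N> a"
  shows "btame a"
proof -
  obtain N J K where N: "N \<in> \<N>" and emb: "controls_sup N J K"
    using embedding by blast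
  then have J: "finite J" and Ns: "size_bound N" using size by (auto simp: controls_sup_def)
  have "\<exists>C. \<forall>t. \<bar>t\<bar> \<le> r \<longrightarrow> sup_bound (\<lambda>x. v (t, x)) C" if v: "tame \<N> v" for v r
  proof -
    obtain D where D: "D > 0"
      "\<forall>t js. \<bar>t\<bar> \<le> r \<longrightarrow> js \<in> J \<longrightarrow> N (\<lambda>x. partials js (\<lambda>x. \<chi> k::'n. v (t, x)) x $ undefined) D"
      using tame_slice_bound[OF v N Ns J, of r undefined] by blast
    have "\<bar>(\<chi> k::'n. v (t, x)) $ undefined\<bar> \<le> K * D" if t: "\<bar>t\<bar> \<le> r" for t x
      by (rule controls_supD[OF emb D(1) partials_slice(2)[where u="\<lambda>_. v", OF v]])
        (use D(2) t in simp)
    then show ?thesis by (auto simp: sup_bound_def)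
  qed
  from this[OF tame_dst[OF a]] show ?thesis
    using a unfolding tame_def by simp
qed

text \<open>Let \<open>u k js\<close> be the component of \<open>partials js\<close> of the k-th
  derivative curve. Time derivatives raise \<open>k\<close> and space derivatives lengthen
  \<open>js\<close>, so this family is closed under differentiation. The embedding turns convergence
  of quotients in size into uniform convergence, which gives joint differentiability.\<close>

lemma smooth_curve_imp_tame:
  assumes "smooth_curve T c"
  shows "tame \<N> (\<lambda>z. c (fst z) (snd z) $ i)"
proof -
  obtain d where d0: "d 0 = c" and
    d: "\<And>k t. limitin T (\<lambda>h. (1 / h) *\<^sub>R (d k (t + h) - d k t)) (d (Suc k) t) (at 0)"
    using assms unfolding smooth_curve_def by blast
  have dE: "d k t \<in> topspace T" for k t
    using limitin_topspace[OF d] assms d0 unfolding smooth_curve_def by (cases k) auto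
  define u where "u k js z = partials js (d k (fst z)) (snd z) $ i" for k js z
  have ucont: "continuous_on UNIV (\<lambda>x. u k js (t, x))" for k js t
    unfolding u_def using smooth[OF dE] by (simp add: smooth_map_continuous_component)
  have quotient: "\<forall>\<^sub>F h in at 0. N (\<lambda>x. (1 / h) * (u k js (t + h, x) - u k js (t, x)) - u (Suc k) js (t, x)) e"
    if N: "N \<in> \<N>" and e: "0 < e" for N e k js t
  proof -
    obtain U where U: "openin T U" "0 \<in> U" "\<And>f. f \<in> U \<Longrightarrow> N (\<lambda>x. partials js f x $ i) e"
      by (rule zero_neighbourhoodE[OF N e, where js=js and i=i]) (rule that, assumption+)
    have "\<forall>\<^sub>F h in at 0. (1 / h) *\<^sub>R (d k (t + h) - d k t) - d (Suc k) t \<in> U"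
      using d[of k t, unfolded lctvs_limitin_iff[OF lctvs dE]] U(1,2) by (simp add: limitin_def)
    then show ?thesis
    proof eventually_elim
      case (elim h)
      show ?case
        using U(3)[OF elim]
        by (simp add: smooth_map_diff smooth_map_scaleR smooth[OF dE] u_def)
    qed
  qed
  obtain N0 J K where N0: "N0 \<in> \<N>" and emb: "controls_sup N0 J K"
    using embedding by blast
  then have J: "finite J" "0 \<le> K" by (simp_all add: controls_sup_def)
  have unif: "\<forall>\<^sub>F h in at 0. \<forall>x. \<bar>(1 / h) * (u k js (t + h, x) - u k js (t, x)) - u (Suc k) js (t, x)\<bar> \<le> e"
    if e: "0 < e" for e k js t
  proof -
    \<comment> \<open>The derivatives along \<open>js' @ js\<close> with \<open>js'\<close> in
      \<open>J\<close> are made this small; the embedding then bounds the one along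
      \<open>js\<close> by \<open>K * (e / (K + 1))\<close>, at most \<open>e\<close> even for
      \<open>K = 0\<close>.\<close>
    have pos: "0 < e / (K + 1)" using J(2) e by simp
    have "\<forall>\<^sub>F h in at 0. \<forall>js'\<in>J.
        N0 (\<lambda>x. (1 / h) * (u k (js' @ js) (t + h, x) - u k (js' @ js) (t, x)) - u (Suc k) (js' @ js) (t, x)) (e / (K + 1))"
      using quotient[OF N0 pos] J(1) by (simp add: eventually_ball_finite)
    then show ?thesis
    proof eventually_elim
      case (elim h)
      define g where "g = (1 / h) *\<^sub>R (d k (t + h) - d k t) - d (Suc k) t"
      have g: "smooth_map g" "\<And>js. partials js g = (\<lambda>x. (1 / h) *\<^sub>R (partials js (d k (t + h)) x - partials js (d k t) x) - partials js (d (Suc k) t) x)"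
        unfolding g_def by (simp_all add: smooth_map_diff smooth_map_scaleR smooth[OF dE])
      have gi: "partials js g x $ i = (1 / h) * (u k js (t + h, x) - u k js (t, x)) - u (Suc k) js (t, x)" for js x
        by (simp add: g u_def)
      have "\<bar>partials js g x $ i\<bar> \<le> K * (e / (K + 1))" for x
        by (rule controls_supD[OF emb pos smooth_map_partials[OF g(1)]])
          (use elim in \<open>simp add: partials_append[symmetric] gi\<close>)
      moreover have "K * (e / (K + 1)) \<le> e"
        using J(2) e by (simp add: field_simps)
      ultimately show ?case unfolding gi by (meson order_trans)
    qed
  qed
  have hd: "(u k js has_derivative (\<lambda>w. fst w * u (Suc k) js (t, x) + (\<Sum>l\<in>UNIV. snd w $ l * u k (l # js) (t, x)))) (at (t, x))" for k js t x
  proof (rule has_derivative_uniform_slices[where v="\<lambda>x. u (Suc k) js (t, x)"])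
    fix e :: real assume e: "0 < e"
    obtain \<delta> where \<delta>: "\<delta> > 0" and le: "\<And>h x. h \<noteq> 0 \<Longrightarrow> \<bar>h\<bar> < \<delta> \<Longrightarrow>
        \<bar>(1 / h) * (u k js (t + h, x) - u k js (t, x)) - u (Suc k) js (t, x)\<bar> \<le> e"
      using unif[OF e, of k js t] unfolding eventually_at by (auto simp: dist_real_def)
    have "\<bar>u k js (s, w) - u k js (t, w) - (s - t) * u (Suc k) js (t, w)\<bar> \<le> e * \<bar>s - t\<bar>" if st: "\<bar>s - t\<bar> < \<delta>" for s w
    proof (cases "s = t")
      case False
      have "u k js (s, w) - u k js (t, w) - (s - t) * u (Suc k) js (t, w) =
          (s - t) * ((1 / (s - t)) * (u k js (t + (s - t), w) - u k js (t, w)) - u (Suc k) js (t, w))"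
        using False by (simp add: field_simps)
      also have "\<bar>\<dots>\<bar> \<le> \<bar>s - t\<bar> * e"
        unfolding abs_mult using le[of "s - t" w] False st by (intro mult_left_mono) auto
      finally show ?thesis by (simp add: mult.commute)
    qed simp
    then show "\<exists>\<delta>>0. \<forall>s w. \<bar>s - t\<bar> < \<delta> \<longrightarrow> \<bar>u k js (s, w) - u k js (t, w) - (s - t) * u (Suc k) js (t, w)\<bar> \<le> e * \<bar>s - t\<bar>"
      using \<delta> by blast
  next
    show "isCont (\<lambda>x. u (Suc k) js (t, x)) x"
      using ucont by (simp add: continuous_on_eq_continuous_at)
    have "((\<lambda>x. partials js (d k t) x $ i) has_derivative (\<lambda>h. (\<Sum>l\<in>UNIV. h $ l *\<^sub>R partials (l # js) (d k t) x) $ i)) (at x)"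
      by (rule bounded_linear.has_derivative[OF bounded_linear_vec_nth smooth_map_has_derivative[OF smooth[OF dE]]])
    then show "((\<lambda>w. u k js (t, w)) has_derivative (\<lambda>h. \<Sum>l\<in>UNIV. h $ l * u k (l # js) (t, x))) (at x)"
      by (simp add: u_def)
  qed
  have "tame \<N> (u 0 [])"
  proof (rule tame_coinduct[where X="\<lambda>w. \<exists>k js. w = u k js"])
    fix w assume "\<exists>k js. w = u k js"
    then obtain k js where w: "w = u k js" by blast
    show "w differentiable (at z)" for z
      using hd[of k js "fst z" "snd z"] unfolding w differentiable_def by auto
    show "\<exists>k js. dd (dirv j) w = u k js" for j
    proof (cases j)
      case None
      then have "dd (dirv j) w z = u (Suc k) js z" for z
        unfolding w using dd_eqI[OF hd, of "dirv None" k js "fst z" "snd z"] by (simp add: dirv_def)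
      then show ?thesis by blast
    next
      case (Some l)
      then have "dd (dirv j) w z = u k (l # js) z" for z
        unfolding w using dd_eqI[OF hd, of "dirv (Some l)" k js "fst z" "snd z"]
        by (simp add: dirv_def axis_def if_distrib[of "\<lambda>x. x * _"] cong: if_cong)
      then show ?thesis by blast
    qed
    show "\<exists>C. \<forall>t. \<bar>t\<bar> \<le> r \<longrightarrow> N (\<lambda>x. w (t, x)) C" if N: "N \<in> \<N>" for N r
    proof -
      interpret N: size_bound N using size N by blast
      have ex: "\<exists>C. N (\<lambda>x. u k js (t, x)) C" for k t
        using dE[of k t] N by (simp add: topspace u_def)
      have "\<exists>C. \<forall>t. -\<bar>r\<bar> \<le> t \<and> t \<le> \<bar>r\<bar> \<longrightarrow> N (\<lambda>x. u k js (t, x)) C"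
      \<comment> \<open>Compactness of the time interval by bisection: bounds glue over adjacent
        intervals and exist near each \<open>t0\<close>.\<close>
      proof (rule Bolzano[of "-\<bar>r\<bar>" "\<bar>r\<bar>" "\<lambda>a b. \<exists>C. \<forall>t. a \<le> t \<and> t \<le> b \<longrightarrow> N (\<lambda>x. u k js (t, x)) C"])
        fix a b c assume "\<exists>C. \<forall>t. a \<le> t \<and> t \<le> b \<longrightarrow> N (\<lambda>x. u k js (t, x)) C" "\<exists>C. \<forall>t. b \<le> t \<and> t \<le> c \<longrightarrow> N (\<lambda>x. u k js (t, x)) C"
        then obtain C D where C: "\<And>t. a \<le> t \<and> t \<le> b \<Longrightarrow> N (\<lambda>x. u k js (t, x)) C"
          and D: "\<And>t. b \<le> t \<and> t \<le> c \<Longrightarrow> N (\<lambda>x. u k js (t, x)) D" by blast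
        have "N (\<lambda>x. u k js (t, x)) (max C D)" if "a \<le> t \<and> t \<le> c" for t
          using C[of t] D[of t] that by (cases "t \<le> b") (auto intro: N.weaken)
        then show "\<exists>C. \<forall>t. a \<le> t \<and> t \<le> c \<longrightarrow> N (\<lambda>x. u k js (t, x)) C" by blast
      next
        fix t0
        obtain C0 C1 where C0: "N (\<lambda>x. u k js (t0, x)) C0" and C1: "N (\<lambda>x. u (Suc k) js (t0, x)) C1"
          using ex by blast
        obtain \<delta> where \<delta>: "\<delta> > 0" and q: "\<And>h. h \<noteq> 0 \<Longrightarrow> \<bar>h\<bar> < \<delta> \<Longrightarrow>
            N (\<lambda>x. (1 / h) * (u k js (t0 + h, x) - u k js (t0, x)) - u (Suc k) js (t0, x)) 1"
          using quotient[OF N zero_less_one, of k js t0] unfolding eventually_at by (auto simp: dist_real_def)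
        \<comment> \<open>The value at \<open>t\<close> is the value at \<open>t0\<close> plus
          \<open>h\<close> times the sum of the quotient error, of size at most 1, and the
          derivative, of size at most \<open>C1\<close>.\<close>
        have near: "N (\<lambda>x. u k js (t, x)) (C0 + (1 + C1))" if t: "\<bar>t - t0\<bar> < min \<delta> 1" for t
        proof (cases "t = t0")
          case True
          then show ?thesis
            using N.weaken[OF C0] N.nonneg[OF C1] by auto
        next
          case False
          define h where "h = t - t0"
          have h: "h \<noteq> 0" "\<bar>h\<bar> < \<delta>" "\<bar>h\<bar> \<le> 1" using t False by (auto simp: h_def)
          have "N (\<lambda>x. u k js (t0, x) + h * (((1 / h) * (u k js (t0 + h, x) - u k js (t0, x)) - u (Suc k) js (t0, x)) + u (Suc k) js (t0, x)))
              (C0 + \<bar>h\<bar> * (1 + C1))"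
            by (intro N.triangle N.scale C0 C1 q h continuous_intros ucont)
          moreover have "u k js (t0, x) + h * (((1 / h) * (u k js (t0 + h, x) - u k js (t0, x)) - u (Suc k) js (t0, x)) + u (Suc k) js (t0, x)) = u k js (t, x)" for x
            using h(1) by (simp add: h_def)
          moreover have "C0 + \<bar>h\<bar> * (1 + C1) \<le> C0 + (1 + C1)"
            using h(3) N.nonneg[OF C1] by (simp add: mult_left_le_one_le)
          ultimately show ?thesis using N.weaken by simp
        qed
        show "\<exists>d>0. \<forall>a b. a \<le> t0 \<and> t0 \<le> b \<and> b - a < d \<longrightarrow> (\<exists>C. \<forall>t. a \<le> t \<and> t \<le> b \<longrightarrow> N (\<lambda>x. u k js (t, x)) C)"
          by (rule exI[of _ "min \<delta> 1"]) (use \<delta> in \<open>auto intro!: exI[of _ "C0 + (1 + C1)"] near\<close>)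
      qed auto
      then show ?thesis unfolding w by (metis abs_ge_self abs_le_iff order_trans minus_le_iff)
    qed
  qed auto
  then show ?thesis by (simp add: u_def[abs_def] d0)
qed

lemma tame_slice_in_topspace:
  assumes "\<And>i. tame \<N> (u i)"
  shows "(\<lambda>x. \<chi> i. u i (t, x)) \<in> topspace T"
  unfolding topspace mem_Collect_eq
proof (intro conjI ballI allI)
  show "smooth_map (\<lambda>x. \<chi> i. u i (t, x))"
    using assms by (rule partials_slice(2))
  show "\<exists>C. N (\<lambda>x. partials js (\<lambda>x. \<chi> i. u i (t, x)) x $ i) C" if "N \<in> \<N>" for N js i
    using tame_bounded[OF tame_dst[OF assms[of i], of "map Some js"] that, of "\<bar>t\<bar>"]
    by (auto simp: partials_slice(1)[of \<N> u, OF assms])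
qed

text \<open>The slices of the k-th time derivative are the candidates for the k-th derivative curve.
  By \<open>tame_difference_quotient\<close> the quotients miss them by an error whose sizes are of
  order \<open>\<bar>h\<bar>\<close>.\<close>

lemma tame_imp_smooth_curve:
  assumes c: "\<And>i. tame \<N> (\<lambda>z. c (fst z) (snd z) $ i)"
  shows "smooth_curve T c"
proof -
  define w where "w k i = dst (replicate k None) (\<lambda>z. c (fst z) (snd z) $ i)" for k i
  have w: "tame \<N> (w k i)" for k i
    unfolding w_def by (intro tame_dst c)
  have wSuc: "w (Suc k) i = dd (dirv None) (w k i)" for k i
    by (simp add: w_def)
  define d where "d k t = (\<lambda>x. \<chi> i. w k i (t, x))" for k t
  have d0: "d 0 = c"
    by (simp add: d_def w_def fun_eq_iff vec_eq_iff)
  have dE: "d k t \<in> topspace T" for k t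
    unfolding d_def by (rule tame_slice_in_topspace[OF w])
  have dp: "partials js (d k t) x $ i = dst (map Some js) (w k i) (t, x)" for js k t x i
    unfolding d_def by (simp add: partials_slice(1)[of \<N> "w k", OF w])
  have "limitin T (\<lambda>h. (1 / h) *\<^sub>R (d k (t + h) - d k t)) (d (Suc k) t) (at 0)" for k t
    unfolding limitin_def
  proof (intro conjI allI impI dE)
    fix U assume U: "openin T U \<and> d (Suc k) t \<in> U"
    show "\<forall>\<^sub>F h in at 0. (1 / h) *\<^sub>R (d k (t + h) - d k t) \<in> U"
    \<comment> \<open>Passing to sequences \<open>h n\<close> makes
      \<open>sequence_convergence\<close> applicable.\<close>
    proof (rule sequentially_imp_eventually_at, intro allI impI)
      fix h :: "nat \<Rightarrow> real" assume h: "(\<forall>n. h n \<noteq> 0) \<and> h \<longlonglongrightarrow> 0"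
      define g where "g n = (1 / h n) *\<^sub>R (d k (t + h n) - d k t) - d (Suc k) t" for n
      have gE: "range g \<subseteq> topspace T"
        unfolding g_def by (auto intro!: subspace_diff subspace_scale subspace dE)
      have "limitin T g 0 sequentially"
      proof (rule sequence_convergence[OF gE])
        fix N js i and e :: real assume N: "N \<in> \<N>" and e: "0 < e"
        interpret N: size_bound N using size N by blast
        define v where "v = dst (map Some js) (w k i)"
        have v: "tame \<N> v" unfolding v_def by (intro tame_dst w)
        \<comment> \<open>Time and space derivatives commute, so the remainder estimate applies to
          the space derivative \<open>v\<close> directly.\<close>
        have v': "dst (map Some js) (w (Suc k) i) = dd (dirv None) v"
          unfolding wSuc v_def by (rule dst_time_commute[OF w])
        obtain C where C: "\<And>h. \<bar>h\<bar> \<le> 1 \<Longrightarrow> N (\<lambda>x. v (t + h, x) - v (t, x) - h * dd (dirv None) v (t, x)) (\<bar>h\<bar> * (\<bar>h\<bar> * C))"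
          using tame_difference_quotient[OF v N N.size_bound_axioms] by blast
        have "(\<lambda>n. \<bar>h n\<bar> * C) \<longlonglongrightarrow> 0"
          using h by (auto intro: tendsto_mult_left_zero tendsto_rabs_zero)
        then have "\<forall>\<^sub>F n in sequentially. \<bar>h n\<bar> * C < e" using e by (rule order_tendstoD)
        moreover have "\<forall>\<^sub>F n in sequentially. \<bar>h n\<bar> < 1"
          using h by (intro order_tendstoD[OF tendsto_rabs_zero]) auto
        ultimately show "\<forall>\<^sub>F n in sequentially. N (\<lambda>x. partials js (g n) x $ i) e"
        proof eventually_elim
          case (elim n)
          have hn: "h n \<noteq> 0" using h by blast
          have "N (\<lambda>x. (1 / h n) * (v (t + h n, x) - v (t, x) - h n * dd (dirv None) v (t, x))) (\<bar>1 / h n\<bar> * (\<bar>h n\<bar> * (\<bar>h n\<bar> * C)))"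
            using elim by (intro N.scale C continuous_intros tame_continuous_slice[OF v] tame_continuous_slice[OF tame_dd[OF v]]) auto
          moreover have "partials js (g n) x $ i = (1 / h n) * (v (t + h n, x) - v (t, x) - h n * dd (dirv None) v (t, x))" for x
          proof -
            have "partials js (g n) x $ i = (1 / h n) * (v (t + h n, x) - v (t, x)) - dst (map Some js) (w (Suc k) i) (t, x)"
              unfolding g_def v_def using smooth[OF dE] by (simp add: smooth_map_diff smooth_map_scaleR dp)
            then show ?thesis unfolding v' using hn by (simp add: field_simps)
          qed
          moreover have "\<bar>1 / h n\<bar> * (\<bar>h n\<bar> * (\<bar>h n\<bar> * C)) = \<bar>h n\<bar> * C" using hn by simp
          ultimately show ?case using N.weaken elim by simp
        qed
      qed
      then have "limitin T (\<lambda>n. (1 / h n) *\<^sub>R (d k (t + h n) - d k t)) (d (Suc k) t) sequentially"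
        unfolding g_def[abs_def] lctvs_limitin_iff[OF lctvs dE] .
      then show "\<forall>\<^sub>F n in sequentially. (1 / h n) *\<^sub>R (d k (t + h n) - d k t) \<in> U"
        using U by (simp add: limitin_def)
    qed
  qed
  then show ?thesis
    unfolding smooth_curve_def using d0 dE[of 0] by (intro conjI exI[of _ d]) auto
qed

end

section \<open>The inverse and the composition of smooth curves\<close>

text \<open>Both sides represent the derivative of one fibre map, read once as \<open>w\<close> and
  once by the chain rule.\<close>

lemma Jac_chain:
  fixes f :: "'n \<Rightarrow> real \<times> (real^'n) \<Rightarrow> real"
  assumes f: "\<And>i. btame (f i)" and g: "\<And>i. btame (g i)" and w: "\<And>i. btame (w i)"
    and eq: "\<And>z. shear w z = shear f (shear g z)"
  shows "Jac w z = Jac f (shear g z) ** Jac g z"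
proof -
  obtain t x where z: "z = (t, x)" by (cases z)
  have fib: "snd (shear h (t, y)) = y + (\<chi> i. h i (t, y))" for h :: "'n \<Rightarrow> real \<times> (real^'n) \<Rightarrow> real" and y
    by (simp add: shear_def)
  have sg: "shear g (t, y) = (t, y + (\<chi> i. g i (t, y)))" for y
    by (simp add: shear_def)
  have "((\<lambda>y. (y + (\<chi> i. g i (t, y))) + (\<chi> i. f i (t, y + (\<chi> i. g i (t, y))))) has_derivative
      (\<lambda>v. Jac f (t, x + (\<chi> i. g i (t, x))) *v (Jac g (t, x) *v v))) (at x)"
    by (rule has_derivative_compose[OF fiber_has_derivative[OF g] fiber_has_derivative[OF f]])
  moreover have "(y + (\<chi> i. g i (t, y))) + (\<chi> i. f i (t, y + (\<chi> i. g i (t, y)))) = y + (\<chi> i. w i (t, y))" for y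
    using arg_cong[OF eq[of "(t, y)"], of snd] unfolding sg fib by simp
  ultimately have "((\<lambda>y. y + (\<chi> i. w i (t, y))) has_derivative
      (\<lambda>v. (Jac f (shear g z) ** Jac g z) *v v)) (at x)"
    by (simp add: z sg matrix_vector_mul_assoc)
  from has_derivative_unique[OF fiber_has_derivative[OF w] this]
  show ?thesis by (simp add: z matrix_eq fun_eq_iff)
qed

lemma btame_time_Lipschitz:
  assumes v: "btame v"
  shows "\<exists>M\<ge>0. \<forall>s t x. \<bar>s\<bar> \<le> r \<longrightarrow> \<bar>t\<bar> \<le> r \<longrightarrow> \<bar>v (s, x) - v (t, x)\<bar> \<le> M * \<bar>s - t\<bar>"
proof -
  obtain M where M: "\<And>t x. \<bar>t\<bar> \<le> r \<Longrightarrow> \<bar>dd (dirv None) v (t, x)\<bar> \<le> M"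
    using btame_bounded[OF tame_dd[OF v]] by blast
  have "norm (v (s, x) - v (t, x)) \<le> \<bar>M\<bar> * norm (s - t)" if "\<bar>s\<bar> \<le> r" "\<bar>t\<bar> \<le> r" for s t x
  proof (rule field_differentiable_bound[where S="{-r..r}"])
    show "((\<lambda>s. v (s, x)) has_field_derivative dd (dirv None) v (s, x)) (at s within {-r..r})" for s
      by (rule has_field_derivative_at_within[OF tame_DERIV_time[OF v]])
    show "norm (dd (dirv None) v (s, x)) \<le> \<bar>M\<bar>" if "s \<in> {-r..r}" for s
      using M[of s x] that by (auto simp: abs_le_iff minus_le_iff)
  qed (use that in auto)
  then show ?thesis by (intro exI[of _ "\<bar>M\<bar>"]) simp
qed

text \<open>The determinant is Lipschitz in time with a constant uniform in \<open>x\<close>, so a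
  lower bound at \<open>t0\<close> is at worst halved nearby. Both the openness of the chart domain
  and local uniformity in time come from here.\<close>

lemma det_Jac_locally_bounded_below:
  fixes f :: "'n \<Rightarrow> real \<times> (real^'n) \<Rightarrow> real"
  assumes f: "\<And>i. btame (f i)" and \<delta>: "0 < \<delta>" "\<And>x. \<delta> \<le> det (Jac f (t0, x))"
  shows "\<exists>d>0. \<forall>t x. \<bar>t - t0\<bar> < d \<longrightarrow> \<delta> / 2 \<le> det (Jac f (t, x))"
proof -
  obtain M where M: "0 \<le> M" "\<And>s t x. \<bar>s\<bar> \<le> \<bar>t0\<bar> + 1 \<Longrightarrow> \<bar>t\<bar> \<le> \<bar>t0\<bar> + 1 \<Longrightarrow>
      \<bar>det (Jac f (s, x)) - det (Jac f (t, x))\<bar> \<le> M * \<bar>s - t\<bar>"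
    using btame_time_Lipschitz[OF btame_det_Jac[of f, OF f], of "\<bar>t0\<bar> + 1"] by blast
  \<comment> \<open>The cap 1 keeps \<open>t\<close> in the range where \<open>M\<close> is valid;
    the other term gives a change of at most \<open>\<delta> / 2\<close>.\<close>
  define d where "d = min 1 (\<delta> / (2 * (M + 1)))"
  have d: "0 < d" using \<delta> M(1) by (simp add: d_def)
  have "\<delta> / 2 \<le> det (Jac f (t, x))" if t: "\<bar>t - t0\<bar> < d" for t x
  proof -
    have "M * \<bar>t - t0\<bar> \<le> (M + 1) * (\<delta> / (2 * (M + 1)))"
      using t M(1) by (intro mult_mono) (auto simp: d_def)
    moreover have "(M + 1) * (\<delta> / (2 * (M + 1))) = \<delta> / 2" using M(1) by (simp add: divide_simps)
    ultimately have "M * \<bar>t - t0\<bar> \<le> \<delta> / 2" by linarith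
    moreover have "\<bar>det (Jac f (t, x)) - det (Jac f (t0, x))\<bar> \<le> M * \<bar>t - t0\<bar>"
      using t by (intro M(2)) (auto simp: d_def)
    ultimately show ?thesis using \<delta>(2)[of x] by linarith
  qed
  with d show ?thesis by blast
qed

text \<open>Lower bounds at single times become locally uniform in time by bisection: they persist
  near each time, and minima glue them.\<close>

lemma nondegenerateI:
  fixes f :: "'n \<Rightarrow> real \<times> (real^'n) \<Rightarrow> real"
  assumes f: "\<And>i. btame (f i)" and \<delta>: "\<And>t. \<exists>\<delta>>0. \<forall>x. \<delta> \<le> det (Jac f (t, x))"
  shows "nondegenerate f"
  unfolding nondegenerate_def
proof
  fix r :: real
  have "\<exists>\<delta>>0. \<forall>t x. -\<bar>r\<bar> \<le> t \<and> t \<le> \<bar>r\<bar> \<longrightarrow> \<delta> \<le> det (Jac f (t, x))"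
  proof (rule Bolzano[of "-\<bar>r\<bar>" "\<bar>r\<bar>" "\<lambda>a b. \<exists>\<delta>>0. \<forall>t x. a \<le> t \<and> t \<le> b \<longrightarrow> \<delta> \<le> det (Jac f (t, x))"])
    fix a b c
    assume "\<exists>\<delta>>0. \<forall>t x. a \<le> t \<and> t \<le> b \<longrightarrow> \<delta> \<le> det (Jac f (t, x))" "\<exists>\<delta>>0. \<forall>t x. b \<le> t \<and> t \<le> c \<longrightarrow> \<delta> \<le> det (Jac f (t, x))"
    then obtain \<delta> \<delta>' where \<delta>: "\<delta> > 0" "\<And>t x. a \<le> t \<and> t \<le> b \<Longrightarrow> \<delta> \<le> det (Jac f (t, x))"
      and \<delta>': "\<delta>' > 0" "\<And>t x. b \<le> t \<and> t \<le> c \<Longrightarrow> \<delta>' \<le> det (Jac f (t, x))" by blast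
    have "min \<delta> \<delta>' \<le> det (Jac f (t, x))" if "a \<le> t \<and> t \<le> c" for t x
      using \<delta>(2)[of t x] \<delta>'(2)[of t x] that by (cases "t \<le> b") auto
    then show "\<exists>\<delta>>0. \<forall>t x. a \<le> t \<and> t \<le> c \<longrightarrow> \<delta> \<le> det (Jac f (t, x))"
      using \<delta>(1) \<delta>'(1) by (intro exI[of _ "min \<delta> \<delta>'"]) simp
  next
    fix t0
    obtain \<delta>0 where \<delta>0: "\<delta>0 > 0" "\<And>x. \<delta>0 \<le> det (Jac f (t0, x))" using \<delta> by blast
    obtain d where "d > 0" "\<And>t x. \<bar>t - t0\<bar> < d \<Longrightarrow> \<delta>0 / 2 \<le> det (Jac f (t, x))"
      using det_Jac_locally_bounded_below[of f \<delta>0 t0] f \<delta>0 by blast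
    then show "\<exists>d>0. \<forall>a b. a \<le> t0 \<and> t0 \<le> b \<and> b - a < d \<longrightarrow>
        (\<exists>\<delta>>0. \<forall>t x. a \<le> t \<and> t \<le> b \<longrightarrow> \<delta> \<le> det (Jac f (t, x)))"
      using \<delta>0(1) by (intro exI[of _ d] conjI allI impI exI[of _ "\<delta>0 / 2"]) auto
  qed auto
  then show "\<exists>\<delta>>0. \<forall>t x. \<bar>t\<bar> \<le> r \<longrightarrow> \<delta> \<le> det (Jac f (t, x))"
    by (auto simp: abs_le_iff minus_le_iff)
qed

context function_space
begin

text \<open>From x + u(x) = y follows x = y - u(x), so the inverse is the identity plus
  \<open>k = - u \<circ> unshear u\<close>. Its determinant is the reciprocal of a determinant that
  is bounded above, hence bounded below.\<close>

lemma inverse_coordinates: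
  assumes u: "\<And>i. tame \<N> (u i)" and nd: "nondegenerate u"
  obtains k where "\<And>i. tame \<N> (k i)" "nondegenerate k"
    "\<And>z. shear u (shear k z) = z" "\<And>z. shear k (shear u z) = z"
proof -
  have bu: "btame (u i)" for i using tame_imp_btame u by blast
  define k where "k i z = - u i (unshear u z)" for i z
  have k: "tame \<N> (k i)" for i
    using tame_cmult[OF size tame_unshear[OF size reparametrizable bu nd u[of i]], of "-1"] by (simp add: k_def[abs_def])
  then have bk: "btame (k i)" for i using tame_imp_btame by blast
  have b: "bij (shear u)" using bij_shear[OF bu nd] .
  have uk: "unshear u = shear k"
    using fst_unshear[of u, OF bu nd] snd_unshear[of u, OF bu nd]
    by (auto simp: fun_eq_iff shear_def k_def prod_eq_iff vec_eq_iff)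
  have su: "shear u (shear k z) = z" and us: "shear k (shear u z) = z" for z
    unfolding uk[symmetric] by (simp_all add: surj_f_inv_f bij_is_surj[OF b] inv_f_f bij_is_inj[OF b])
  \<comment> \<open>The zero displacement stands for the identity, so this is the chain rule for the
    composition of the shear with its inverse.\<close>
  have "Jac (\<lambda>_ _. 0) z = Jac u (shear k z) ** Jac k z" for z
    by (rule Jac_chain[OF bu bk btame_const]) (simp only: su, simp add: shear_def prod_eq_iff vec_eq_iff)
  then have "det (Jac u (shear k z)) * det (Jac k z) = 1" for z
  proof -
    have "Jac (\<lambda>_ _. 0) z = (mat 1 :: real^'n^'n)"
      by (simp add: Jac_def mat_def dd_const)
    then show ?thesis
      using \<open>\<And>z. Jac (\<lambda>_ _. 0) z = Jac u (shear k z) ** Jac k z\<close>[of z] by (metis det_I det_mul)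
  qed
  then have det: "det (Jac k z) = 1 / det (Jac u (shear k z))" for z
    using nondegenerate_pos[OF nd, of "shear k z"] by (simp add: field_simps)
  have "nondegenerate k"
    unfolding nondegenerate_def
  proof
    fix r
    obtain M where M: "\<And>t x. \<bar>t\<bar> \<le> r \<Longrightarrow> \<bar>det (Jac u (t, x))\<bar> \<le> M"
      using btame_bounded[OF btame_det_Jac[of u, OF bu]] by blast
    have "1 / (\<bar>M\<bar> + 1) \<le> det (Jac k (t, x))" if t: "\<bar>t\<bar> \<le> r" for t x
    proof -
      have "shear k (t, x) = (t, snd (shear k (t, x)))" by (simp add: shear_def)
      then have "det (Jac u (shear k (t, x))) \<le> \<bar>M\<bar> + 1"
        using M[OF t, of "snd (shear k (t, x))"] by (metis abs_ge_self add_increasing2 order_trans zero_le_one)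
      then show ?thesis
        unfolding det using nondegenerate_pos[OF nd, of "shear k (t, x)"] by (intro divide_left_mono) auto
    qed
    then show "\<exists>\<delta>>0. \<forall>t x. \<bar>t\<bar> \<le> r \<longrightarrow> \<delta> \<le> det (Jac k (t, x))"
      by (intro exI[of _ "1 / (\<bar>M\<bar> + 1)"]) (simp add: add_nonneg_pos)
  qed
  with that k su us show thesis by blast
qed

text \<open>The displacement of (Id + f) o (Id + g) is g + f o (Id + g). Determinants multiply, and
  so do their lower bounds.\<close>

lemma composite_coordinates:
  assumes f: "\<And>i. tame \<N> (f i)" "nondegenerate f" and g: "\<And>i. tame \<N> (g i)" "nondegenerate g"
  defines "w \<equiv> \<lambda>i z. g i z + f i (shear g z)"
  shows "tame \<N> (w i)" "nondegenerate w" "shear w z = shear f (shear g z)"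
proof -
  have bf: "btame (f i)" and bg: "btame (g i)" for i using tame_imp_btame f g by blast+
  show w: "tame \<N> (w i)" for i
    unfolding w_def by (intro tame_add tame_shear size reparametrizable f g bg)
  then have bw: "btame (w i)" for i using tame_imp_btame by blast
  show s: "shear w z = shear f (shear g z)" for z
    by (simp add: shear_def w_def prod_eq_iff vec_eq_iff)
  have det: "det (Jac w z) = det (Jac f (shear g z)) * det (Jac g z)" for z
    using Jac_chain[of f g w, OF bf bg bw s] by (simp add: det_mul)
  show "nondegenerate w"
    unfolding nondegenerate_def
  proof
    fix r
    obtain \<delta> where \<delta>: "\<delta> > 0" "\<And>t x. \<bar>t\<bar> \<le> r \<Longrightarrow> \<delta> \<le> det (Jac f (t, x))"
      using f(2) unfolding nondegenerate_def by meson
    obtain \<delta>' where \<delta>': "\<delta>' > 0" "\<And>t x. \<bar>t\<bar> \<le> r \<Longrightarrow> \<delta>' \<le> det (Jac g (t, x))"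
      using g(2) unfolding nondegenerate_def by meson
    have "\<delta> * \<delta>' \<le> det (Jac w (t, x))" if t: "\<bar>t\<bar> \<le> r" for t x
    proof -
      have "shear g (t, x) = (t, snd (shear g (t, x)))" by (simp add: shear_def)
      then have "\<delta> \<le> det (Jac f (shear g (t, x)))"
        using \<delta>(2)[OF t] by metis
      then show ?thesis
        unfolding det using \<delta>(1) \<delta>'(1) \<delta>'(2)[OF t, of x] by (intro mult_mono) auto
    qed
    then show "\<exists>\<delta>>0. \<forall>t x. \<bar>t\<bar> \<le> r \<longrightarrow> \<delta> \<le> det (Jac w (t, x))"
      using \<delta>(1) \<delta>'(1) by (intro exI[of _ "\<delta> * \<delta>'"]) simp
  qed
qed

section \<open>The chart domain and its smooth curves\<close>

definition chart_domain :: "(real^'n \<Rightarrow> real^'n) set" where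
  "chart_domain = {f \<in> topspace T. \<exists>\<delta>>0. \<forall>x. \<delta> \<le> det (mat 1 + jacobian f (at x))}"

definition coords :: "(real \<Rightarrow> real^'n \<Rightarrow> real^'n) \<Rightarrow> 'n \<Rightarrow> real \<times> (real^'n) \<Rightarrow> real" where
  "coords c i = (\<lambda>z. c (fst z) (snd z) $ i)"

definition curve :: "('n \<Rightarrow> real \<times> (real^'n) \<Rightarrow> real) \<Rightarrow> real \<Rightarrow> real^'n \<Rightarrow> real^'n" where
  "curve u t = (\<lambda>x. \<chi> i. u i (t, x))"

lemma curve_coords [simp]: "curve (coords c) = c"
  by (simp add: curve_def coords_def fun_eq_iff vec_eq_iff)

lemma coords_curve [simp]: "coords (curve u) = u"
  by (simp add: curve_def coords_def fun_eq_iff)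

lemma shear_eq: "shear u (t, x) = (t, x + curve u t x)"
  by (simp add: shear_def curve_def)

lemma smooth_curve_iff: "smooth_curve T c \<longleftrightarrow> (\<forall>i. tame \<N> (coords c i))"
  using smooth_curve_imp_tame tame_imp_smooth_curve unfolding coords_def by blast

lemma Jac_curve:
  assumes "\<And>i. tame \<N> (u i)"
  shows "Jac u (t, x) = mat 1 + jacobian (curve u t) (at x)"
proof -
  have "partials [j] (curve u t) x $ i = dd (dirv (Some j)) (u i) (t, x)" for i j
    unfolding curve_def by (subst partials_slice(1)[where u=u, OF assms]) simp
  then have "jacobian (curve u t) (at x) $ i $ j = dd (dirv (Some j)) (u i) (t, x)" for i j
    by (simp add: jacobian_def matrix_def partial_def)
  then show ?thesis
    by (simp add: Jac_def vec_eq_iff mat_def)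
qed

lemma chart_domain_iff:
  assumes "\<And>i. tame \<N> (u i)"
  shows "curve u t \<in> chart_domain \<longleftrightarrow> (\<exists>\<delta>>0. \<forall>x. \<delta> \<le> det (Jac u (t, x)))"
  unfolding chart_domain_def Jac_curve[OF assms] curve_def
  using tame_slice_in_topspace[of u, OF assms] by simp

lemma nondegenerate_curve:
  assumes u: "\<And>i. tame \<N> (u i)"
  shows "nondegenerate u \<longleftrightarrow> (\<forall>t. curve u t \<in> chart_domain)"
proof
  assume "nondegenerate u"
  then show "\<forall>t. curve u t \<in> chart_domain"
    unfolding chart_domain_iff[OF u] nondegenerate_def by (meson order_refl)
next
  assume "\<forall>t. curve u t \<in> chart_domain"
  then show "nondegenerate u"
    unfolding chart_domain_iff[OF u] using tame_imp_btame[OF u] by (intro nondegenerateI) auto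
qed

text \<open>Openness is tested on curves, so the time estimate for the determinant along a single
  curve suffices.\<close>

lemma c_infty_open_chart_domain: "c_infty_open T chart_domain"
  unfolding c_infty_open_def
proof (intro conjI allI impI)
  show "chart_domain \<subseteq> topspace T" by (auto simp: chart_domain_def)
  fix c assume c: "smooth_curve T c"
  define u where "u = coords c"
  have u: "tame \<N> (u i)" for i using c by (simp add: smooth_curve_iff u_def)
  have cu: "c = curve u" by (simp add: u_def)
  show "open (c -` chart_domain)"
    unfolding open_dist
  proof
    fix t0 assume "t0 \<in> c -` chart_domain"
    then obtain \<delta> where \<delta>: "\<delta> > 0" "\<And>x. \<delta> \<le> det (Jac u (t0, x))"
      using chart_domain_iff[OF u] by (auto simp: cu)
    then obtain d where d: "d > 0" "\<And>t x. \<bar>t - t0\<bar> < d \<Longrightarrow> \<delta> / 2 \<le> det (Jac u (t, x))"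
      using det_Jac_locally_bounded_below[of u, OF tame_imp_btame[OF u]] by blast
    have "t \<in> c -` chart_domain" if "dist t t0 < d" for t
      using d(2)[of t] that \<delta>(1) chart_domain_iff[OF u]
      by (auto simp: cu dist_real_def intro!: exI[of _ "\<delta> / 2"])
    with d(1) show "\<exists>e>0. \<forall>y. dist y t0 < e \<longrightarrow> y \<in> c -` chart_domain" by blast
  qed
qed

lemma smooth_curve_const:
  assumes "f \<in> topspace T"
  shows "smooth_curve T (\<lambda>_. f)"
  unfolding smooth_curve_def
proof (intro conjI exI[of _ "\<lambda>k t. if k = 0 then f else 0"] allI)
  show "limitin T (\<lambda>h. (1 / h) *\<^sub>R ((if k = 0 then f else 0) - (if k = 0 then f else 0))) (if Suc k = 0 then f else 0) (at 0)" for k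
    using subspace_0[OF subspace] by simp
qed (use assms in auto)

lemma smooth_curve_inverse:
  assumes c: "smooth_curve T c" "range c \<subseteq> chart_domain"
  obtains e where "smooth_curve T e" "range e \<subseteq> chart_domain"
    "\<And>t x. e t x + c t (x + e t x) = 0" "\<And>t x. c t x + e t (x + c t x) = 0"
proof -
  have u: "tame \<N> (coords c i)" for i using c by (simp add: smooth_curve_iff)
  have "nondegenerate (coords c)" using c(2) by (auto simp: nondegenerate_curve[OF u])
  then obtain k where k: "\<And>i. tame \<N> (k i)" "nondegenerate k"
    "\<And>z. shear (coords c) (shear k z) = z" "\<And>z. shear k (shear (coords c) z) = z"
    using inverse_coordinates[of "coords c", OF u] by blast
  show thesis
  proof (rule that[of "curve k"])
    show "smooth_curve T (curve k)" "range (curve k) \<subseteq> chart_domain"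
      using k(1,2) nondegenerate_curve[of k, OF k(1)] by (auto simp: smooth_curve_iff)
    show "curve k t x + c t (x + curve k t x) = 0" for t x
      using k(3)[of "(t, x)"] by (simp add: shear_eq add.assoc)
    show "c t x + curve k t (x + c t x) = 0" for t x
      using k(4)[of "(t, x)"] by (simp add: shear_eq add.assoc)
  qed
qed

lemma smooth_curve_composition:
  assumes f: "smooth_curve T f" "range f \<subseteq> chart_domain" and g: "smooth_curve T g" "range g \<subseteq> chart_domain"
  defines "h \<equiv> \<lambda>t x. g t x + f t (x + g t x)"
  shows "smooth_curve T h" "range h \<subseteq> chart_domain"
proof -
  have u: "tame \<N> (coords f i)" "tame \<N> (coords g i)" for i using f g by (simp_all add: smooth_curve_iff)
  have nd: "nondegenerate (coords f)" "nondegenerate (coords g)"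
    using f(2) g(2) by (auto simp: nondegenerate_curve[OF u(1)] nondegenerate_curve[OF u(2)])
  have "coords h i = (\<lambda>z. coords g i z + coords f i (shear (coords g) z))" for i
    by (simp add: coords_def h_def shear_def fun_eq_iff vec_lambda_eta)
  then have *: "coords h = (\<lambda>i z. coords g i z + coords f i (shear (coords g) z))" by (simp add: fun_eq_iff)
  have ch: "tame \<N> (coords h i)" "nondegenerate (coords h)" for i
    unfolding * by (intro composite_coordinates u nd)+
  then show "smooth_curve T h" by (simp add: smooth_curve_iff)
  show "range h \<subseteq> chart_domain"
    using ch(2) nondegenerate_curve[of "coords h", OF ch(1)] by auto
qed

end

section \<open>Convenience of function spaces\<close>

lemma ereal_INF_pos_iff: "0 < (INF x. ereal (g x)) \<longleftrightarrow> (\<exists>\<delta>>0. \<forall>x. \<delta> \<le> g x)"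
proof
  assume "0 < (INF x. ereal (g x))"
  then obtain z where z: "0 < ereal z" "ereal z < (INF x. ereal (g x))"
    using ereal_dense2 by blast
  have "z \<le> g x" for x
    using order.strict_trans2[OF z(2) INF_lower[of x UNIV]] by simp
  with z(1) show "\<exists>\<delta>>0. \<forall>x. \<delta> \<le> g x" by auto
next
  assume "\<exists>\<delta>>0. \<forall>x. \<delta> \<le> g x"
  then obtain \<delta> where "\<delta> > 0" "\<And>x. \<delta> \<le> g x" by blast
  then have "ereal \<delta> \<le> (INF x. ereal (g x))" by (intro INF_greatest) simp
  with \<open>\<delta> > 0\<close> show "0 < (INF x. ereal (g x))"
    by (metis ereal_less(2) order_less_le_trans)
qed

lemma smooth_map_ident: "smooth_map (\<lambda>x::real^'n. x)"
proof -
  have "partials js (\<lambda>x::real^'n. x) = (\<lambda>x. x) \<or> (\<exists>a. partials js (\<lambda>x::real^'n. x) = (\<lambda>_. a))" for js :: "'n list"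
  proof (induction js)
    case (Cons j js)
    have "dd v (\<lambda>x::real^'n. x) = (\<lambda>_. v)" for v
      by (intro ext dd_eqI[where f'="\<lambda>v. v"]) simp
    with Cons show ?case by (auto simp: partial_eq_dd dd_const)
  qed simp
  then have "partials js (\<lambda>x::real^'n. x) differentiable_on UNIV" for js :: "'n list"
    by (metis differentiable_on_const differentiable_on_ident)
  then show ?thesis by (simp add: smooth_map_def)
qed

context function_space
begin

lemma sup_neighbourhood:
  assumes e: "0 < e"
  obtains U where "openin T U" "0 \<in> U" "\<And>f x. f \<in> U \<Longrightarrow> \<bar>f x $ i\<bar> \<le> e"
proof -
  obtain N J K where N: "N \<in> \<N>" and emb: "controls_sup N J K"
    using embedding by blast
  then have J: "finite J" "0 \<le> K" by (simp_all add: controls_sup_def)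
  define \<delta> where "\<delta> = e / (K + 1)"
  have \<delta>: "0 < \<delta>" "K * \<delta> \<le> e" using J(2) e by (simp_all add: \<delta>_def field_simps)
  obtain U where U: "\<And>js. openin T (U js)" "\<And>js. 0 \<in> U js" "\<And>js f. f \<in> U js \<Longrightarrow> N (\<lambda>x. partials js f x $ i) \<delta>"
    using zero_neighbourhood[OF N \<delta>(1), of _ i] by metis
  show thesis
  \<comment> \<open>Intersecting with \<open>topspace T\<close> covers an empty \<open>J\<close>,
    where the intersection over \<open>J\<close> is everything.\<close>
  proof (rule that[of "topspace T \<inter> (\<Inter>js\<in>J. U js)"])
    show "openin T (topspace T \<inter> (\<Inter>js\<in>J. U js))"
    proof (cases "J = {}")
      case False
      then show ?thesis using J(1) U(1) by (intro openin_Int openin_Inter) auto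
    qed simp
    show "0 \<in> topspace T \<inter> (\<Inter>js\<in>J. U js)"
      using U(2) subspace_0[OF subspace] by simp
    show "\<bar>f x $ i\<bar> \<le> e" if f: "f \<in> topspace T \<inter> (\<Inter>js\<in>J. U js)" for f x
    proof -
      have "\<bar>f x $ i\<bar> \<le> K * \<delta>"
        by (rule controls_supD[OF emb \<delta>(1)]) (use f in \<open>auto intro: smooth U(3)\<close>)
      with \<delta>(2) show ?thesis by linarith
    qed
  qed
qed

text \<open>Point evaluations of components are continuous by the embedding and separate maps. With
  \<open>e\<close> a third of the gap, membership in both translated neighbourhoods would leave a
  gap of at most \<open>2 * e\<close>.\<close>

lemma Hausdorff: "Hausdorff_space T"
  unfolding Hausdorff_space_def
proof (intro allI impI)
  fix f g assume fg: "f \<in> topspace T \<and> g \<in> topspace T \<and> f \<noteq> g"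
  then obtain x i where ne: "f x $ i \<noteq> g x $ i" by (auto simp: fun_eq_iff vec_eq_iff)
  define e where "e = \<bar>f x $ i - g x $ i\<bar> / 3"
  have e: "0 < e" using ne by (simp add: e_def)
  obtain U where U: "openin T U" "0 \<in> U" "\<And>f x. f \<in> U \<Longrightarrow> \<bar>f x $ i\<bar> \<le> e"
    by (rule sup_neighbourhood[OF e, where i=i]) (rule that, assumption+)
  define V where "V h = {k \<in> topspace T. k + (- h) \<in> U}" for h
  have V: "openin T (V h)" if "h \<in> topspace T" for h
    unfolding V_def
    by (rule openin_continuous_map_preimage[OF lctvs_continuous_translation[OF lctvs] U(1)])
      (use that subspace_neg[OF subspace] in auto)
  have "k \<notin> V f \<inter> V g" for k
  proof
    assume k: "k \<in> V f \<inter> V g"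
    have "\<bar>k x $ i - f x $ i\<bar> \<le> e" "\<bar>k x $ i - g x $ i\<bar> \<le> e"
      using k U(3)[of "k + - f" x] U(3)[of "k + - g" x] by (simp_all add: V_def)
    then have "\<bar>f x $ i - g x $ i\<bar> \<le> 2 * e" by linarith
    then show False
      using e by (simp add: e_def)
  qed
  then show "\<exists>A B. openin T A \<and> openin T B \<and> f \<in> A \<and> g \<in> B \<and> disjnt A B"
    using V fg U(2) by (intro exI[of _ "V f"] exI[of _ "V g"]) (auto simp: V_def disjnt_def)
qed

lemma bounded_set_size:
  assumes B: "tvs_bounded T B" and N: "N \<in> \<N>"
  shows "\<exists>C\<ge>0. \<forall>b\<in>B. N (\<lambda>x. partials js b x $ i) C"
proof -
  interpret N: size_bound N using size N by blast
  obtain U where U: "openin T U" "0 \<in> U" "\<And>f. f \<in> U \<Longrightarrow> N (\<lambda>x. partials js f x $ i) 1"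
    by (rule zero_neighbourhoodE[OF N zero_less_one, where js=js and i=i]) (rule that, assumption+)
  obtain r where r: "r > 0" "B \<subseteq> (\<lambda>x. r *\<^sub>R x) ` U"
    using B U unfolding tvs_bounded_def by blast
  have "N (\<lambda>x. partials js b x $ i) (\<bar>r\<bar> * 1)" if bB: "b \<in> B" for b
  proof -
    obtain f where f: "f \<in> U" "b = r *\<^sub>R f" using r(2) bB by blast
    have sm: "smooth_map f" using openin_subset[OF U(1)] f(1) smooth by blast
    have "N (\<lambda>x. r * (partials js f x $ i)) (\<bar>r\<bar> * 1)"
      by (intro N.scale U(3) f smooth_map_continuous_component sm)
    then show ?thesis by (simp add: f(2) smooth_map_scaleR[OF sm])
  qed
  with r(1) show ?thesis by (intro exI[of _ "\<bar>r\<bar> * 1"]) auto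
qed

text \<open>Such sequences are Cauchy for every size, with the bounded set supplying the constant.
  By the embedding all partial derivatives converge uniformly, so the limit is smooth with the
  expected derivatives; \<open>Fatou\<close> upgrades pointwise convergence to convergence in
  size.\<close>

lemma Mackey_Cauchy_converges:
  assumes "Mackey_Cauchy T x"
  shows "\<exists>l. limitin T x l sequentially"
proof -
  have xE: "x n \<in> topspace T" for n using assms by (auto simp: Mackey_Cauchy_def)
  have sx: "smooth_map (x n)" for n by (rule smooth[OF xE])
  obtain B \<mu> where B: "tvs_bounded T B" and \<mu>: "(\<mu> \<longlongrightarrow> (0::real)) (sequentially \<times>\<^sub>F sequentially)"
    and xB: "\<And>m n. \<exists>b\<in>B. x m - x n = \<mu> (m, n) *\<^sub>R b"
    using assms unfolding Mackey_Cauchy_def by blast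
  have cauchy: "\<exists>M. \<forall>m\<ge>M. \<forall>n\<ge>M. N (\<lambda>y. partials js (x m) y $ i - partials js (x n) y $ i) e"
    if N: "N \<in> \<N>" and e: "0 < e" for N js i e
  proof -
    interpret N: size_bound N using size N by blast
    obtain C where C: "C \<ge> 0" "\<And>b. b \<in> B \<Longrightarrow> N (\<lambda>x. partials js b x $ i) C"
      using bounded_set_size[OF B N, of js i] by blast
    have "\<forall>\<^sub>F p in sequentially \<times>\<^sub>F sequentially. \<bar>\<mu> p\<bar> < e / (C + 1)"
      using C(1) e by (intro order_tendstoD[OF tendsto_rabs_zero[OF \<mu>]]) auto
    then obtain M where M: "\<And>m n. m \<ge> M \<Longrightarrow> n \<ge> M \<Longrightarrow> \<bar>\<mu> (n, m)\<bar> < e / (C + 1)"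
      unfolding eventually_prod_sequentially by blast
    have "N (\<lambda>y. partials js (x m) y $ i - partials js (x n) y $ i) e" if mn: "m \<ge> M" "n \<ge> M" for m n
    proof -
      obtain b where b: "b \<in> B" "x m - x n = \<mu> (m, n) *\<^sub>R b" using xB by blast
      have sb: "smooth_map b" using B b(1) smooth by (auto simp: tvs_bounded_def)
      have "N (\<lambda>y. \<mu> (m, n) * (partials js b y $ i)) (\<bar>\<mu> (m, n)\<bar> * C)"
        by (intro N.scale C(2) b smooth_map_continuous_component sb)
      moreover have "\<mu> (m, n) * (partials js b y $ i) = partials js (x m) y $ i - partials js (x n) y $ i" for y
        using arg_cong[OF b(2), of "\<lambda>f. partials js f y $ i"]
        by (simp add: smooth_map_diff sx smooth_map_scaleR sb)
      moreover have "\<bar>\<mu> (m, n)\<bar> * C \<le> e"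
      proof -
        have "\<bar>\<mu> (m, n)\<bar> * C \<le> e / (C + 1) * C"
          using M[OF mn(2,1)] C(1) by (intro mult_right_mono) auto
        also have "\<dots> \<le> e" using C(1) e by (simp add: field_simps)
        finally show ?thesis .
      qed
      ultimately show ?thesis using N.weaken by simp
    qed
    then show ?thesis by blast
  qed
  obtain N0 J K where N0: "N0 \<in> \<N>" and emb: "controls_sup N0 J K"
    using embedding by blast
  then have J: "finite J" "0 \<le> K" by (simp_all add: controls_sup_def)
  have ucauchy: "\<exists>M. \<forall>m\<ge>M. \<forall>n\<ge>M. \<forall>y. \<bar>partials js (x m) y $ i - partials js (x n) y $ i\<bar> \<le> e"
    if e: "0 < e" for js i e
  proof -
    define \<delta> where "\<delta> = e / (K + 1)"
    have \<delta>: "0 < \<delta>" "K * \<delta> \<le> e" using J(2) e by (simp_all add: \<delta>_def field_simps)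
    have "\<exists>M. \<forall>m\<ge>M. \<forall>n\<ge>M. N0 (\<lambda>y. partials (js' @ js) (x m) y $ i - partials (js' @ js) (x n) y $ i) \<delta>" for js'
      using cauchy[OF N0 \<delta>(1)] .
    then obtain M where M: "\<And>js' m n. m \<ge> M js' \<Longrightarrow> n \<ge> M js' \<Longrightarrow>
        N0 (\<lambda>y. partials (js' @ js) (x m) y $ i - partials (js' @ js) (x n) y $ i) \<delta>"
      by metis
    define M' where "M' = (\<Sum>js'\<in>J. M js')"
    have M': "M js' \<le> M'" if "js' \<in> J" for js'
      unfolding M'_def using that J(1) by (intro member_le_sum) auto
    have "\<bar>partials js (x m) y $ i - partials js (x n) y $ i\<bar> \<le> e" if mn: "m \<ge> M'" "n \<ge> M'" for m n y
    proof -
      have d: "smooth_map (x m - x n)" "\<And>js. partials js (x m - x n) = (\<lambda>y. partials js (x m) y - partials js (x n) y)"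
        by (simp_all add: smooth_map_diff sx)
      have "\<bar>partials js (x m - x n) y $ i\<bar> \<le> K * \<delta>"
      proof (rule controls_supD[OF emb \<delta>(1) smooth_map_partials[OF d(1)]])
        fix js' assume js': "js' \<in> J"
        have "partials js' (partials js (x m - x n)) y $ i = partials (js' @ js) (x m) y $ i - partials (js' @ js) (x n) y $ i" for y
          unfolding partials_append[of js' js "x m - x n", symmetric] d(2)[of "js' @ js"] by simp
        then show "N0 (\<lambda>y. partials js' (partials js (x m - x n)) y $ i) \<delta>"
          using M[of js' m n] M'[OF js'] mn by simp
      qed
      with \<delta>(2) show ?thesis by (simp add: d(2))
    qed
    then show ?thesis by blast
  qed
  have "uniformly_Cauchy_on UNIV (\<lambda>n. partials js (x n))" for js
    unfolding uniformly_Cauchy_on_def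
  proof (intro allI impI)
    fix e :: real assume e: "0 < e"
    \<comment> \<open>The factor 2 leaves a strict inequality after summation over the
      components.\<close>
    define \<delta> where "\<delta> = e / (2 * real CARD('n))"
    have \<delta>: "0 < \<delta>" using e by (simp add: \<delta>_def)
    obtain M where M: "\<And>i m n y. m \<ge> M i \<Longrightarrow> n \<ge> M i \<Longrightarrow> \<bar>partials js (x m) y $ i - partials js (x n) y $ i\<bar> \<le> \<delta>"
      using ucauchy[OF \<delta>, of js] by metis
    define M' where "M' = (\<Sum>i\<in>UNIV. M i)"
    have M': "M i \<le> M'" for i
      unfolding M'_def by (intro member_le_sum) auto
    have "dist (partials js (x m) y) (partials js (x n) y) < e" if mn: "m \<ge> M'" "n \<ge> M'" for m n y
    proof -
      have "norm (partials js (x m) y - partials js (x n) y) \<le> (\<Sum>i\<in>(UNIV::'n set). \<delta>)"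
      proof (rule order_trans[OF norm_le_l1_cart sum_mono])
        show "\<bar>(partials js (x m) y - partials js (x n) y) $ i\<bar> \<le> \<delta>" for i
          using M[of i m n y] M'[of i] mn by simp
      qed
      also have "\<dots> = e / 2" by (simp add: \<delta>_def)
      finally show ?thesis using e by (simp add: dist_norm)
    qed
    then show "\<exists>M. \<forall>x'\<in>UNIV. \<forall>m\<ge>M. \<forall>n\<ge>M. dist (partials js (x m) x') (partials js (x n) x') < e" by blast
  qed
  then have "uniformly_convergent_on UNIV (\<lambda>n. partials js (x n))" for js
    by (rule Cauchy_uniformly_convergent)
  then obtain G where G: "\<And>js. uniform_limit UNIV (\<lambda>n. partials js (x n)) (G js) sequentially"
    unfolding uniformly_convergent_on_def by metis
  have Gpt: "(\<lambda>n. partials js (x n) y) \<longlonglongrightarrow> G js y" for js y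
    using tendsto_uniform_limitI[OF G] by simp
  have Ghd: "(G js has_derivative (\<lambda>h. \<Sum>l\<in>UNIV. h $ l *\<^sub>R G (l # js) y)) (at y)" for js y
  proof -
    have "\<exists>g. \<forall>y\<in>UNIV. (\<lambda>n. partials js (x n) y) \<longlonglongrightarrow> g y \<and>
        (g has_derivative (\<lambda>h. \<Sum>l\<in>UNIV. h $ l *\<^sub>R G (l # js) y)) (at y within UNIV)"
    proof (rule has_derivative_sequence[OF convex_UNIV smooth_map_has_derivative[OF sx] _ UNIV_I Gpt])
      fix e :: real assume e: "0 < e"
      define \<delta> where "\<delta> = e / real CARD('n)"
      have \<delta>: "0 < \<delta>" using e by (simp add: \<delta>_def)
      have "\<forall>\<^sub>F n in sequentially. \<forall>l\<in>UNIV. \<forall>y\<in>UNIV. dist (partials (l # js) (x n) y) (G (l # js) y) < \<delta>"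
        by (intro eventually_ball_finite finite ballI uniform_limitD[OF G \<delta>])
      then show "\<forall>\<^sub>F n in sequentially. \<forall>y\<in>UNIV. \<forall>h. norm ((\<Sum>l\<in>UNIV. h $ l *\<^sub>R partials (l # js) (x n) y) - (\<Sum>l\<in>UNIV. h $ l *\<^sub>R G (l # js) y)) \<le> e * norm h"
      proof eventually_elim
        case (elim n)
        show ?case
        proof (intro ballI allI)
          fix y h :: "real^'n"
          have "norm ((\<Sum>l\<in>UNIV. h $ l *\<^sub>R partials (l # js) (x n) y) - (\<Sum>l\<in>UNIV. h $ l *\<^sub>R G (l # js) y))
              = norm (\<Sum>l\<in>UNIV. h $ l *\<^sub>R (partials (l # js) (x n) y - G (l # js) y))"
            by (simp add: sum_subtractf[symmetric] scaleR_diff_right)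
          also have "\<dots> \<le> (\<Sum>l\<in>(UNIV::'n set). norm h * \<delta>)"
          proof (rule order_trans[OF norm_sum sum_mono])
            fix l
            show "norm (h $ l *\<^sub>R (partials (l # js) (x n) y - G (l # js) y)) \<le> norm h * \<delta>"
              unfolding norm_scaleR
              using elim[rule_format, of l y] component_le_norm_cart[of h l]
              by (intro mult_mono) (auto simp: dist_norm)
          qed
          also have "\<dots> = e * norm h" by (simp add: \<delta>_def)
          finally show "norm ((\<Sum>l\<in>UNIV. h $ l *\<^sub>R partials (l # js) (x n) y) - (\<Sum>l\<in>UNIV. h $ l *\<^sub>R G (l # js) y)) \<le> e * norm h" .
        qed
      qed
    qed
    then obtain g where g: "\<And>y. (\<lambda>n. partials js (x n) y) \<longlonglongrightarrow> g y"
      "\<And>y. (g has_derivative (\<lambda>h. \<Sum>l\<in>UNIV. h $ l *\<^sub>R G (l # js) y)) (at y)" by auto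
    have "g = G js" using LIMSEQ_unique[OF g(1) Gpt] by (simp add: fun_eq_iff)
    with g(2) show ?thesis by simp
  qed
  define f where "f = G []"
  have pf: "partials js f = G js" for js
  proof (induction js)
    case (Cons j js)
    have "dd (axis j 1) (G js) = G (j # js)"
      by (rule ext, subst dd_eqI[OF Ghd]) (simp add: axis_def if_distrib[of "\<lambda>x. x *\<^sub>R _"] cong: if_cong)
    then show ?case by (simp only: partials_simps partial_eq_dd Cons.IH)
  qed (simp add: f_def)
  have sf: "smooth_map f"
    unfolding smooth_map_def pf differentiable_on_def using Ghd differentiable_def by blast
  have conv: "\<exists>M. \<forall>m\<ge>M. N (\<lambda>y. partials js (x m) y $ i - partials js f y $ i) e"
    if N: "N \<in> \<N>" and e: "0 < e" for N js i e
  proof -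
    interpret N: size_bound N using size N by blast
    obtain M where M: "\<And>m n. m \<ge> M \<Longrightarrow> n \<ge> M \<Longrightarrow> N (\<lambda>y. partials js (x m) y $ i - partials js (x n) y $ i) e"
      using cauchy[OF N e, of js i] by blast
    have "N (\<lambda>y. partials js (x m) y $ i - partials js f y $ i) e" if m: "m \<ge> M" for m
    \<comment> \<open>With \<open>m\<close> fixed, the second index of the Cauchy estimate runs to
      infinity.\<close>
    proof (rule N.Fatou[where F="\<lambda>n y. partials js (x m) y $ i - partials js (x (n + M)) y $ i"])
      show "(\<lambda>n. partials js (x m) y $ i - partials js (x (n + M)) y $ i) \<longlonglongrightarrow> partials js (x m) y $ i - partials js f y $ i" for y
        unfolding pf by (intro tendsto_diff tendsto_const tendsto_vec_nth LIMSEQ_ignore_initial_segment[OF Gpt])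
      show "N (\<lambda>y. partials js (x m) y $ i - partials js (x (n + M)) y $ i) e" for n
        using M[OF m, of "n + M"] by simp
    qed (intro continuous_on_diff smooth_map_continuous_component sx sf)+
    then show ?thesis by blast
  qed
  have fE: "f \<in> topspace T"
    unfolding topspace mem_Collect_eq
  proof (intro conjI ballI allI sf)
    fix N js i assume N: "N \<in> \<N>"
    interpret N: size_bound N using size N by blast
    obtain M where M: "N (\<lambda>y. partials js (x M) y $ i - partials js f y $ i) 1"
      using conv[OF N zero_less_one, of js i] by blast
    obtain C where C: "N (\<lambda>y. partials js (x M) y $ i) C"
      using xE[of M, unfolded topspace] N by blast
    \<comment> \<open>The limit is \<open>x M\<close> minus a difference, both of finite
      size.\<close>
    have "N (\<lambda>y. partials js (x M) y $ i - (partials js (x M) y $ i - partials js f y $ i)) (C + 1)"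
      by (intro N.difference M C continuous_on_diff smooth_map_continuous_component sx sf)
    then show "\<exists>C. N (\<lambda>y. partials js f y $ i) C" by auto
  qed
  have "limitin T (\<lambda>n. x n - f) 0 sequentially"
  proof (rule sequence_convergence)
    show "range (\<lambda>n. x n - f) \<subseteq> topspace T"
      by (auto intro!: subspace_diff subspace xE fE)
    show "\<forall>\<^sub>F n in sequentially. N (\<lambda>y. partials js (x n - f) y $ i) e" if "N \<in> \<N>" "0 < e" for N js i e
      using conv[OF that, of js i] unfolding eventually_sequentially by (simp add: smooth_map_diff sx sf)
  qed
  then have "limitin T x f sequentially"
    unfolding lctvs_limitin_iff[OF lctvs fE] .
  then show ?thesis by blast
qed

lemma convenient: "convenient T"
  unfolding convenient_def using lctvs Hausdorff Mackey_Cauchy_converges by blast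

end

section \<open>The Lie group\<close>

context function_space
begin

lemma Diff_eq: "Diff T = (\<lambda>f x. x + f x) ` chart_domain"
  unfolding Diff_def chart_domain_def ereal_INF_pos_iff by auto

lemma Diff_chart_add [simp]: "Diff_chart (\<lambda>x. x + f x) = f"
  by (simp add: Diff_chart_def)

lemma chart_image: "Diff_chart ` Diff T = chart_domain"
  unfolding Diff_eq by (simp add: image_image)

lemma inj_chart: "inj_on Diff_chart (Diff T)"
  unfolding Diff_eq by (auto simp: inj_on_def)

lemma chart_inverse: "f \<in> chart_domain \<Longrightarrow> inv_into (Diff T) Diff_chart f = (\<lambda>x. x + f x)"
  using inv_into_f_f[OF inj_chart, of "\<lambda>x. x + f x"] by (simp add: Diff_eq)

lemma zero_in_chart_domain: "0 \<in> chart_domain"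
proof -
  have "jacobian (\<lambda>_::real^'n. 0::real^'n) (at x) = 0" for x
    by (simp add: jacobian_def matrix_def vec_eq_iff)
  then show ?thesis
    unfolding chart_domain_def using subspace_0[OF subspace]
    by (auto simp: zero_fun_def intro!: exI[of _ 1])
qed

lemma chart_domain_smooth_curve:
  "f \<in> chart_domain \<Longrightarrow> smooth_curve T (\<lambda>_. f)"
  by (rule smooth_curve_const) (simp add: chart_domain_def)

text \<open>The inverse of a single map is that of the constant curve, evaluated at any
  time.\<close>

lemma chart_domain_inverse:
  assumes "f \<in> chart_domain"
  obtains k where "k \<in> chart_domain" "\<And>x. k x + f (x + k x) = 0" "\<And>x. f x + k (x + f x) = 0"
proof -
  obtain e where e: "smooth_curve T e" "range e \<subseteq> chart_domain"
    "\<And>t x. e t x + f (x + e t x) = 0" "\<And>t x. f x + e t (x + f x) = 0"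
    using smooth_curve_inverse[OF chart_domain_smooth_curve[OF assms]] assms by (metis image_subsetI)
  show thesis
    by (rule that[of "e 0"]) (use e in auto)
qed

lemma chart_domain_composition:
  assumes "f \<in> chart_domain" "g \<in> chart_domain"
  shows "(\<lambda>x. g x + f (x + g x)) \<in> chart_domain"
  using smooth_curve_composition(2)[OF chart_domain_smooth_curve[OF assms(1)] _ chart_domain_smooth_curve[OF assms(2)]]
    assms by auto

lemma composition_eq: "(\<lambda>x. x + f x) \<circ> (\<lambda>x. x + g x) = (\<lambda>x. x + (g x + f (x + g x)))"
  for f g :: "real^'n \<Rightarrow> real^'n"
  by (simp add: fun_eq_iff add.assoc)

lemma Diff_smooth_diffeomorphism:
  assumes "F \<in> Diff T"
  shows "smooth_diffeomorphism F"
proof -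
  have sm: "smooth_map (\<lambda>x. x + f x)" if "f \<in> chart_domain" for f
    using smooth_map_linear[OF smooth_map_ident smooth[of f], of 1 1] that by (simp add: chart_domain_def)
  obtain f where f: "f \<in> chart_domain" "F = (\<lambda>x. x + f x)" using assms by (auto simp: Diff_eq)
  obtain k where k: "k \<in> chart_domain" "\<And>x. k x + f (x + k x) = 0" "\<And>x. f x + k (x + f x) = 0"
    using chart_domain_inverse[OF f(1)] by blast
  have FK: "F (x + k x) = x" and KF: "F x + k (F x) = x" for x
    using k(2,3)[of x] by (simp_all add: f(2) add.assoc)
  have b: "bij F"
    by (rule o_bij[where g="\<lambda>x. x + k x"]) (simp_all add: fun_eq_iff FK KF)
  moreover have "inv_into UNIV F = (\<lambda>x. x + k x)"
    by (rule inv_unique_comp) (simp_all add: fun_eq_iff FK KF)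
  ultimately show ?thesis
    unfolding smooth_diffeomorphism_def using sm[OF f(1)] sm[OF k(1)] f(2) by simp
qed

lemma group_Diff: "group (Diff_group T)"
proof (rule groupI)
  show "x \<otimes>\<^bsub>Diff_group T\<^esub> y \<in> carrier (Diff_group T)"
    if "x \<in> carrier (Diff_group T)" "y \<in> carrier (Diff_group T)" for x y
    using that chart_domain_composition by (auto simp: Diff_group_def Diff_eq composition_eq)
  show "\<one>\<^bsub>Diff_group T\<^esub> \<in> carrier (Diff_group T)"
  proof -
    have "\<one>\<^bsub>Diff_group T\<^esub> = (\<lambda>x. x + (0 :: real^'n \<Rightarrow> real^'n) x)"
      by (simp add: Diff_group_def fun_eq_iff)
    then show ?thesis
      unfolding Diff_group_def Diff_eq partial_object.simps by (rule image_eqI[OF _ zero_in_chart_domain])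
  qed
  show "\<exists>y\<in>carrier (Diff_group T). y \<otimes>\<^bsub>Diff_group T\<^esub> x = \<one>\<^bsub>Diff_group T\<^esub>"
    if x: "x \<in> carrier (Diff_group T)" for x
  proof -
    obtain f where f: "f \<in> chart_domain" "x = (\<lambda>x. x + f x)" using x by (auto simp: Diff_group_def Diff_eq)
    obtain k where k: "k \<in> chart_domain" "\<And>x. k x + f (x + k x) = 0" "\<And>x. f x + k (x + f x) = 0"
      using chart_domain_inverse[OF f(1)] by blast
    have "(\<lambda>x. x + k x) \<circ> x = id"
      unfolding f(2) composition_eq using k(3) by (simp add: fun_eq_iff)
    then show ?thesis
      using k(1) by (auto simp: Diff_group_def Diff_eq)
  qed
qed (auto simp: Diff_group_def o_assoc)

lemma Diff_group_inverse:
  assumes "f \<in> chart_domain" "k \<in> chart_domain" "\<And>x. f x + k (x + f x) = 0"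
  shows "m_inv (Diff_group T) (\<lambda>x. x + f x) = (\<lambda>x. x + k x)"
proof (rule group.inv_equality[OF group_Diff])
  show "(\<lambda>x. x + k x) \<otimes>\<^bsub>Diff_group T\<^esub> (\<lambda>x. x + f x) = \<one>\<^bsub>Diff_group T\<^esub>"
    unfolding Diff_group_def using assms(3) by (simp add: composition_eq) (simp add: fun_eq_iff)
qed (use assms in \<open>auto simp: Diff_group_def Diff_eq\<close>)

lemma smooth_curve_prod:
  assumes "smooth_curve (prod_topology T T) c"
  shows "smooth_curve T (\<lambda>t. fst (c t))" "smooth_curve T (\<lambda>t. snd (c t))"
proof -
  obtain d where d0: "d 0 = c" and
    d: "\<And>k t. limitin (prod_topology T T) (\<lambda>h. (1 / h) *\<^sub>R (d k (t + h) - d k t)) (d (Suc k) t) (at 0)"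
    and r: "range c \<subseteq> topspace (prod_topology T T)"
    using assms unfolding smooth_curve_def by blast
  have "limitin T (fst \<circ> (\<lambda>h. (1 / h) *\<^sub>R (d k (t + h) - d k t))) (fst (d (Suc k) t)) (at 0)"
    "limitin T (snd \<circ> (\<lambda>h. (1 / h) *\<^sub>R (d k (t + h) - d k t))) (snd (d (Suc k) t)) (at 0)" for k t
    using d[of k t] by (simp_all add: limitin_pairwise)
  then have l: "limitin T (\<lambda>h. (1 / h) *\<^sub>R (fst (d k (t + h)) - fst (d k t))) (fst (d (Suc k) t)) (at 0)"
    "limitin T (\<lambda>h. (1 / h) *\<^sub>R (snd (d k (t + h)) - snd (d k t))) (snd (d (Suc k) t)) (at 0)" for k t
    by (simp_all add: o_def)
  show "smooth_curve T (\<lambda>t. fst (c t))"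
    unfolding smooth_curve_def using r d0 l(1)
    by (intro conjI exI[of _ "\<lambda>k t. fst (d k t)"] allI) (auto simp: mem_Times_iff)
  show "smooth_curve T (\<lambda>t. snd (c t))"
    unfolding smooth_curve_def using r d0 l(2)
    by (intro conjI exI[of _ "\<lambda>k t. snd (d k t)"] allI) (auto simp: mem_Times_iff)
qed

theorem Diff_is_lie_group: "Diff_is_lie_group T"
  unfolding Diff_is_lie_group_def single_chart_lie_group_def Let_def
proof (intro conjI ballI)
  have carrier: "carrier (Diff_group T) = Diff T" by (simp add: Diff_group_def)
  show "smooth_diffeomorphism F" if "F \<in> Diff T" for F
    using that by (rule Diff_smooth_diffeomorphism)
  show "group (Diff_group T)" by (rule group_Diff)
  show "convenient T" by (rule convenient)
  show "inj_on Diff_chart (carrier (Diff_group T))" unfolding carrier by (rule inj_chart)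
  show "c_infty_open T (Diff_chart ` carrier (Diff_group T))"
    unfolding carrier chart_image by (rule c_infty_open_chart_domain)
  have comp: "Diff_chart (inv_into (Diff T) Diff_chart f \<otimes>\<^bsub>Diff_group T\<^esub> inv_into (Diff T) Diff_chart g)
      = (\<lambda>x. g x + f (x + g x))" if "f \<in> chart_domain" "g \<in> chart_domain" for f g
    using that by (simp add: chart_inverse Diff_group_def composition_eq)
  show "convenient_smooth (prod_topology T T)
      (Diff_chart ` carrier (Diff_group T) \<times> Diff_chart ` carrier (Diff_group T)) T
      (Diff_chart ` carrier (Diff_group T))
      (\<lambda>(u, v). Diff_chart (inv_into (carrier (Diff_group T)) Diff_chart u \<otimes>\<^bsub>Diff_group T\<^esub>
        inv_into (carrier (Diff_group T)) Diff_chart v))"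
    unfolding carrier chart_image convenient_smooth_def
  proof (intro conjI allI impI)
    show "(\<lambda>(u, v). Diff_chart (inv_into (Diff T) Diff_chart u \<otimes>\<^bsub>Diff_group T\<^esub> inv_into (Diff T) Diff_chart v)) `
        (chart_domain \<times> chart_domain) \<subseteq> chart_domain"
      using comp chart_domain_composition by auto
    fix c assume c: "smooth_curve (prod_topology T T) c \<and> range c \<subseteq> chart_domain \<times> chart_domain"
    then have "c t \<in> chart_domain \<times> chart_domain" for t by blast
    then have r: "fst (c t) \<in> chart_domain" "snd (c t) \<in> chart_domain" for t
      by (simp_all add: mem_Times_iff)
    have "smooth_curve T (\<lambda>t x. snd (c t) x + fst (c t) (x + snd (c t) x))"
      using smooth_curve_prod[of c] c r by (intro smooth_curve_composition) auto
    moreover have "(\<lambda>(u, v). Diff_chart (inv_into (Diff T) Diff_chart u \<otimes>\<^bsub>Diff_group T\<^esub> inv_into (Diff T) Diff_chart v)) \<circ> c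
        = (\<lambda>t x. snd (c t) x + fst (c t) (x + snd (c t) x))"
      using comp[OF r] by (simp add: fun_eq_iff case_prod_unfold)
    ultimately show "smooth_curve T ((\<lambda>(u, v). Diff_chart (inv_into (Diff T) Diff_chart u \<otimes>\<^bsub>Diff_group T\<^esub> inv_into (Diff T) Diff_chart v)) \<circ> c)"
      by simp
  qed
  have inverse: "Diff_chart (m_inv (Diff_group T) (inv_into (Diff T) Diff_chart f)) = k"
    if "f \<in> chart_domain" "k \<in> chart_domain" "\<And>x. f x + k (x + f x) = 0" for f k
    using that by (simp add: chart_inverse Diff_group_inverse)
  show "convenient_smooth T (Diff_chart ` carrier (Diff_group T)) T (Diff_chart ` carrier (Diff_group T))
      (\<lambda>u. Diff_chart (m_inv (Diff_group T) (inv_into (carrier (Diff_group T)) Diff_chart u)))"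
    unfolding carrier chart_image convenient_smooth_def
  proof (intro conjI allI impI)
    show "(\<lambda>u. Diff_chart (m_inv (Diff_group T) (inv_into (Diff T) Diff_chart u))) ` chart_domain \<subseteq> chart_domain"
    proof (rule image_subsetI)
      fix f assume f: "f \<in> chart_domain"
      obtain k where "k \<in> chart_domain" "\<And>x. k x + f (x + k x) = 0" "\<And>x. f x + k (x + f x) = 0"
        by (rule chart_domain_inverse[OF f]) (rule that, assumption+)
      then show "Diff_chart (m_inv (Diff_group T) (inv_into (Diff T) Diff_chart f)) \<in> chart_domain"
        using inverse[OF f] by simp
    qed
    fix c assume c: "smooth_curve T c \<and> range c \<subseteq> chart_domain"
    then obtain e where e: "smooth_curve T e" "range e \<subseteq> chart_domain" "\<And>t x. c t x + e t (x + c t x) = 0"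
      by (auto intro: smooth_curve_inverse[of c])
    \<comment> \<open>The map with displacement \<open>e t\<close> is a left inverse of the one with
      displacement \<open>c t\<close>, and group inverses are unique.\<close>
    have "(\<lambda>u. Diff_chart (m_inv (Diff_group T) (inv_into (Diff T) Diff_chart u))) \<circ> c = e"
    proof
      fix t
      show "((\<lambda>u. Diff_chart (m_inv (Diff_group T) (inv_into (Diff T) Diff_chart u))) \<circ> c) t = e t"
        using inverse[of "c t" "e t", OF _ _ e(3)] c e(2) by (simp add: image_subset_iff)
    qed
    with e(1) show "smooth_curve T ((\<lambda>u. Diff_chart (m_inv (Diff_group T) (inv_into (Diff T) Diff_chart u))) \<circ> c)"
      by simp
  qed
qed

end

section \<open>Seminorm topologies and their suprema\<close>

text \<open>Basic neighbourhoods involve finitely many seminorms, so one seminorm can be treated at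
  a time.\<close>

lemma continuous_map_seminorm_topologyI:
  assumes "\<And>x. x \<in> topspace X \<Longrightarrow> h x \<in> E"
    and "\<And>x q e. x \<in> topspace X \<Longrightarrow> q \<in> Q \<Longrightarrow> (0::real) < e \<Longrightarrow>
      \<exists>V. openin X V \<and> x \<in> V \<and> (\<forall>y\<in>V. q (h y - h x) < e)"
  shows "continuous_map X (seminorm_topology E Q) h"
  unfolding continuous_map_def
proof (intro conjI allI impI)
  show "h \<in> topspace X \<rightarrow> topspace (seminorm_topology E Q)" using assms(1) by simp
  fix U assume U: "openin (seminorm_topology E Q) U"
  show "openin X {x \<in> topspace X. h x \<in> U}"
  proof (subst openin_subopen, intro ballI)
    fix x assume x: "x \<in> {x \<in> topspace X. h x \<in> U}"
    then obtain F e where F: "finite F" "F \<subseteq> Q" "0 < e" "{g \<in> E. \<forall>q\<in>F. q (g - h x) < e} \<subseteq> U"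
      using U unfolding openin_seminorm_topology by blast
    have "\<forall>q\<in>F. \<exists>V. openin X V \<and> x \<in> V \<and> (\<forall>y\<in>V. q (h y - h x) < e)"
      using assms(2)[of x] x F(2,3) by blast
    then obtain V where V: "\<And>q. q \<in> F \<Longrightarrow> openin X (V q)" "\<And>q. q \<in> F \<Longrightarrow> x \<in> V q"
      "\<And>q y. q \<in> F \<Longrightarrow> y \<in> V q \<Longrightarrow> q (h y - h x) < e" by metis
    let ?W = "topspace X \<inter> (\<Inter>q\<in>F. V q)"
    have "openin X ?W"
    proof (cases "F = {}")
      case False
      then show ?thesis using F(1) V(1) by (intro openin_Int openin_Inter) auto
    qed simp
    moreover have "?W \<subseteq> {x \<in> topspace X. h x \<in> U}"
      using F(4) V(3) assms(1) by auto
    ultimately show "\<exists>W. openin X W \<and> x \<in> W \<and> W \<subseteq> {x \<in> topspace X. h x \<in> U}"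
      using V(2) x by (intro exI[of _ ?W]) auto
  qed
qed

text \<open>All laws are confined to \<open>E\<close>: outside of it the suprema and integrals in
  question take default values.\<close>

locale seminorms =
  fixes E :: "'a::real_vector set" and Q :: "('a \<Rightarrow> real) set"
  assumes E: "subspace E"
    and nonneg: "q \<in> Q \<Longrightarrow> f \<in> E \<Longrightarrow> 0 \<le> q f"
    and add: "q \<in> Q \<Longrightarrow> f \<in> E \<Longrightarrow> g \<in> E \<Longrightarrow> q (f + g) \<le> q f + q g"
    and scale: "q \<in> Q \<Longrightarrow> f \<in> E \<Longrightarrow> q (a *\<^sub>R f) \<le> \<bar>a\<bar> * q f"
begin

lemma ball_open:
  assumes q: "q \<in> Q" and f: "f \<in> E"
  shows "openin (seminorm_topology E Q) {g \<in> E. q (g - f) < e}"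
  unfolding openin_seminorm_topology
proof (intro conjI ballI)
  fix g assume g: "g \<in> {g \<in> E. q (g - f) < e}"
  have "q (h - f) < e" if h: "h \<in> E" "q (h - g) < e - q (g - f)" for h
    using add[OF q, of "h - g" "g - f"] h g subspace_diff[OF E] f by fastforce
  then show "\<exists>F \<epsilon>. finite F \<and> F \<subseteq> Q \<and> 0 < \<epsilon> \<and> {h \<in> E. \<forall>q\<in>F. q (h - g) < \<epsilon>} \<subseteq> {g \<in> E. q (g - f) < e}"
    using g q by (intro exI[of _ "{q}"] exI[of _ "e - q (g - f)"]) auto
qed auto

lemma zero_value: "q \<in> Q \<Longrightarrow> q 0 = 0"
  using scale[of q 0 0] nonneg[of q 0] subspace_0[OF E] by simp

lemma lctvs_topology: "lctvs (seminorm_topology E Q)"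
  unfolding lctvs_def topspace_seminorm_topology
proof (intro conjI allI impI E)
  let ?T = "seminorm_topology E Q"
  show "continuous_map (prod_topology ?T ?T) ?T (\<lambda>(x, y). x + y)"
  proof (rule continuous_map_seminorm_topologyI)
    fix x q and e :: real assume x: "x \<in> topspace (prod_topology ?T ?T)" and q: "q \<in> Q" and e: "0 < e"
    obtain f g where fg: "x = (f, g)" "f \<in> E" "g \<in> E" using x by auto
    define d where "d = e / 2"
    have d: "0 < d" "d + d = e" using e by (simp_all add: d_def)
    let ?B = "\<lambda>f. {g \<in> E. q (g - f) < d}"
    have "q ((f' + g') - (f + g)) < e" if "f' \<in> ?B f" "g' \<in> ?B g" for f' g'
    proof -
      have eq: "(f' + g') - (f + g) = (f' - f) + (g' - g)" by simp
      have mem: "f' - f \<in> E" "g' - g \<in> E" using that fg by (auto intro!: subspace_diff[OF E])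
      show ?thesis
        unfolding eq using add[OF q mem] that d(2) by (simp only: mem_Collect_eq) linarith
    qed
    then show "\<exists>V. openin (prod_topology ?T ?T) V \<and> x \<in> V \<and> (\<forall>y\<in>V. q ((case y of (x, y) \<Rightarrow> x + y) - (case x of (x, y) \<Rightarrow> x + y)) < e)"
      using ball_open[OF q] fg d(1) zero_value[OF q]
      by (intro exI[of _ "?B f \<times> ?B g"]) (auto simp: openin_prod_Times_iff)
  qed (auto intro: subspace_add[OF E])
  show "continuous_map (prod_topology euclideanreal ?T) ?T (\<lambda>(a, x). a *\<^sub>R x)"
  proof (rule continuous_map_seminorm_topologyI)
    fix x q and e :: real assume x: "x \<in> topspace (prod_topology euclideanreal ?T)" and q: "q \<in> Q" and e: "0 < e"
    obtain a f where af: "x = (a, f)" "f \<in> E" using x by auto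
    \<comment> \<open>The choices follow b g - a f = b (g - f) + (b - a) f: \<open>d\<close> bounds
      |b - a|, so the second term is below \<open>e / 2\<close> and |b| is at most |a| + 1, while
      \<open>d'\<close> bounds the seminorm of g - f.\<close>
    define d where "d = min 1 (e / (2 * (q f + 1)))"
    define d' where "d' = e / (2 * (\<bar>a\<bar> + 1))"
    have qf: "0 \<le> q f" using nonneg q af by blast
    have d: "0 < d" "d \<le> 1" "d * q f < e / 2"
    proof -
      show "0 < d" "d \<le> 1" using e qf by (auto simp: d_def)
      have "d * q f \<le> e / (2 * (q f + 1)) * q f"
        using qf by (intro mult_right_mono) (auto simp: d_def)
      also have "\<dots> < e / 2" using qf e by (simp add: field_simps)
      finally show "d * q f < e / 2" .
    qed
    have d': "0 < d'" using e by (simp add: d'_def)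
    let ?V = "ball a d \<times> {g \<in> E. q (g - f) < d'}"
    have "q (b *\<^sub>R g - a *\<^sub>R f) < e" if b: "b \<in> ball a d" and g: "g \<in> E" "q (g - f) < d'" for b g
    proof -
      have gf: "g - f \<in> E" using subspace_diff[OF E] g af by blast
      have "b *\<^sub>R g - a *\<^sub>R f = b *\<^sub>R (g - f) + (b - a) *\<^sub>R f" by (simp add: algebra_simps)
      then have "q (b *\<^sub>R g - a *\<^sub>R f) \<le> \<bar>b\<bar> * q (g - f) + \<bar>b - a\<bar> * q f"
        using add[OF q, of "b *\<^sub>R (g - f)" "(b - a) *\<^sub>R f"] scale[OF q gf, of b] scale[OF q af(2), of "b - a"]
          subspace_scale[OF E gf, of b] subspace_scale[OF E af(2), of "b - a"] by simp
      moreover have "\<bar>b\<bar> * q (g - f) \<le> (\<bar>a\<bar> + 1) * d'"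
        using b d(2) g(2) nonneg[OF q gf] by (intro mult_mono) (auto simp: dist_real_def)
      moreover have "(\<bar>a\<bar> + 1) * d' = e / 2" by (simp add: d'_def divide_simps)
      moreover have "\<bar>b - a\<bar> * q f \<le> d * q f"
        using b qf by (intro mult_right_mono) (auto simp: dist_real_def)
      ultimately show ?thesis using d(3) by linarith
    qed
    moreover have "openin (prod_topology euclideanreal ?T) ?V"
      using ball_open[OF q af(2)] by (simp add: openin_prod_Times_iff)
    moreover have "x \<in> ?V" using af d d' zero_value[OF q] by simp
    ultimately show "\<exists>V. openin (prod_topology euclideanreal ?T) V \<and> x \<in> V \<and>
        (\<forall>y\<in>V. q ((case y of (a, x) \<Rightarrow> a *\<^sub>R x) - (case x of (a, x) \<Rightarrow> a *\<^sub>R x)) < e)"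
      using af by (intro exI[of _ ?V]) auto
  qed (auto intro: subspace_scale[OF E])
  fix U assume U: "openin ?T U \<and> 0 \<in> U"
  then obtain F e where F: "finite F" "F \<subseteq> Q" "0 < e" "{g \<in> E. \<forall>q\<in>F. q (g - 0) < e} \<subseteq> U"
    unfolding openin_seminorm_topology by blast
  let ?V = "topspace ?T \<inter> (\<Inter>q\<in>F. {g \<in> E. q (g - 0) < e})"
  have "openin ?T ?V"
  proof (cases "F = {}")
    case False
    then show ?thesis
      using F ball_open[OF _ subspace_0[OF E]] openin_topspace[of ?T] by (intro openin_Int openin_Inter) auto
  qed (use openin_topspace[of ?T] in simp)
  moreover have "q 0 < e" if "q \<in> F" for q
    unfolding zero_value[OF subsetD[OF F(2) that]] by (rule F(3))
  then have "0 \<in> ?V"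
    using subspace_0[OF E] by simp
  moreover have "convex ?V"
  proof (rule convexI)
    fix f g and u v :: real assume fg: "f \<in> ?V" "g \<in> ?V" and uv: "0 \<le> u" "0 \<le> v" "u + v = 1"
    then have fE: "f \<in> E" "g \<in> E" by auto
    have "q (u *\<^sub>R f + v *\<^sub>R g) < e" if "q \<in> F" for q
    proof -
      have q: "q \<in> Q" using that F by blast
      have "q f < e" "q g < e" using fg that by auto
      then have "u * q f + v * q g < e" using uv by (intro convex_bound_lt) auto
      moreover have "q (u *\<^sub>R f + v *\<^sub>R g) \<le> u * q f + v * q g"
        using add[OF q subspace_scale[OF E fE(1), of u] subspace_scale[OF E fE(2), of v]]
          scale[OF q fE(1), of u] scale[OF q fE(2), of v] uv by simp
      ultimately show ?thesis by linarith
    qed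
    then show "u *\<^sub>R f + v *\<^sub>R g \<in> ?V"
      using fE by (auto intro!: subspace_add[OF E] subspace_scale[OF E])
  qed
  moreover have "?V \<subseteq> U" using F(4) by auto
  ultimately show "\<exists>V. openin ?T V \<and> 0 \<in> V \<and> convex V \<and> V \<subseteq> U" by blast
qed

lemma limitin_zero:
  assumes "range f \<subseteq> E" "\<And>q e. q \<in> Q \<Longrightarrow> 0 < e \<Longrightarrow> \<forall>\<^sub>F n in sequentially. q (f n) < e"
  shows "limitin (seminorm_topology E Q) f 0 sequentially"
  unfolding limitin_def topspace_seminorm_topology
proof (intro conjI allI impI subspace_0[OF E])
  fix U assume "openin (seminorm_topology E Q) U \<and> 0 \<in> U"
  then obtain F e where F: "finite F" "F \<subseteq> Q" "0 < e" "{g \<in> E. \<forall>q\<in>F. q (g - 0) < e} \<subseteq> U"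
    unfolding openin_seminorm_topology by blast
  have "\<forall>\<^sub>F n in sequentially. \<forall>q\<in>F. q (f n) < e"
    using F by (intro eventually_ball_finite) (auto intro: assms(2))
  then show "\<forall>\<^sub>F n in sequentially. f n \<in> U"
  proof eventually_elim
    case (elim n)
    then have "f n \<in> {g \<in> E. \<forall>q\<in>F. q (g - 0) < e}" using assms(1) by auto
    then show ?case using F(4) by blast
  qed
qed

end

lemma continuous_map_generated:
  assumes "\<And>T. T \<in> \<T> \<Longrightarrow> continuous_map X T f" "\<T> \<noteq> {}"
  shows "continuous_map X (topology_generated_by (\<Union>{{U. openin T U} | T. T \<in> \<T>})) f"
proof (rule continuous_on_generated_topo)
  show "openin X (f -` U \<inter> topspace X)" if U: "U \<in> \<Union>{{U. openin T U} | T. T \<in> \<T>}" for U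
  proof -
    obtain T where T: "T \<in> \<T>" "openin T U" using U by blast
    have "f -` U \<inter> topspace X = {x \<in> topspace X. f x \<in> U}" by auto
    then show ?thesis using openin_continuous_map_preimage[OF assms(1)[OF T(1)] T(2)] by simp
  qed
  obtain T where T: "T \<in> \<T>" using assms(2) by blast
  have "f ` topspace X \<subseteq> topspace T" using assms(1)[OF T] by (auto simp: continuous_map_def)
  moreover have "topspace T \<subseteq> \<Union>(\<Union>{{U. openin T U} | T. T \<in> \<T>})" using T by blast
  ultimately show "f ` topspace X \<subseteq> \<Union>(\<Union>{{U. openin T U} | T. T \<in> \<T>})" by blast
qed

text \<open>A supremum of locally convex topologies on one space is locally convex: the operations
  are continuous because they are so into each \<open>T\<close>, and convex neighbourhoods arise
  along the generation of open sets.\<close>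

lemma lctvs_generated:
  assumes \<T>: "\<T> \<noteq> {}" "\<And>T. T \<in> \<T> \<Longrightarrow> lctvs T" "\<And>T. T \<in> \<T> \<Longrightarrow> topspace T = E"
  defines "G \<equiv> topology_generated_by (\<Union>{{U. openin T U} | T. T \<in> \<T>})"
  shows "topspace G = E" "\<And>T U. T \<in> \<T> \<Longrightarrow> openin T U \<Longrightarrow> openin G U" "lctvs G"
proof -
  obtain T0 where T0: "T0 \<in> \<T>" using \<T>(1) by blast
  show top: "topspace G = E"
    unfolding G_def topology_generated_by_topspace
    using \<T>(3) T0 by (auto dest: openin_subset)
  show op: "openin G U" if "T \<in> \<T>" "openin T U" for T U
    unfolding G_def by (rule topology_generated_by_Basis) (use that in blast)
  have id: "continuous_map G T (\<lambda>x. x)" if "T \<in> \<T>" for T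
    unfolding continuous_map_def using op[OF that] top \<T>(3)[OF that]
    by (auto simp: Collect_conj_eq Int_absorb1 dest: openin_subset)
  show "lctvs G"
    unfolding lctvs_def
  proof (intro conjI allI impI)
    show "subspace (topspace G)" using \<T>(2,3) T0 top by (auto simp: lctvs_def)
    show "continuous_map (prod_topology G G) G (\<lambda>(x, y). x + y)"
      unfolding G_def[symmetric]
    \<comment> \<open>Only the target is unfolded; the source keeps its continuous identity maps to
      each \<open>T\<close>.\<close>
    proof (subst (3) G_def, rule continuous_map_generated[OF _ \<T>(1)])
      fix T assume T: "T \<in> \<T>"
      have "continuous_map (prod_topology G G) (prod_topology T T) (\<lambda>p. (fst p, snd p))"
        by (intro continuous_map_pairedI continuous_map_compose[OF continuous_map_fst id[OF T], unfolded o_def]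
            continuous_map_compose[OF continuous_map_snd id[OF T], unfolded o_def])
      moreover have "continuous_map (prod_topology T T) T (\<lambda>(x, y). x + y)"
        using \<T>(2)[OF T] by (simp add: lctvs_def)
      ultimately have "continuous_map (prod_topology G G) T ((\<lambda>(x, y). x + y) \<circ> (\<lambda>p. (fst p, snd p)))"
        by (rule continuous_map_compose)
      then show "continuous_map (prod_topology G G) T (\<lambda>(x, y). x + y)"
        by (simp add: o_def case_prod_unfold)
    qed
    show "continuous_map (prod_topology euclideanreal G) G (\<lambda>(a, x). a *\<^sub>R x)"
    proof (subst (2) G_def, rule continuous_map_generated[OF _ \<T>(1)])
      fix T assume T: "T \<in> \<T>"
      have "continuous_map (prod_topology euclideanreal G) (prod_topology euclideanreal T) (\<lambda>p. (fst p, snd p))"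
        by (intro continuous_map_pairedI continuous_map_fst
            continuous_map_compose[OF continuous_map_snd id[OF T], unfolded o_def])
      moreover have "continuous_map (prod_topology euclideanreal T) T (\<lambda>(a, x). a *\<^sub>R x)"
        using \<T>(2)[OF T] by (simp add: lctvs_def)
      ultimately have "continuous_map (prod_topology euclideanreal G) T ((\<lambda>(a, x). a *\<^sub>R x) \<circ> (\<lambda>p. (fst p, snd p)))"
        by (rule continuous_map_compose)
      then show "continuous_map (prod_topology euclideanreal G) T (\<lambda>(a, x). a *\<^sub>R x)"
        by (simp add: o_def case_prod_unfold)
    qed
    fix U assume U: "openin G U \<and> 0 \<in> U"
    then have "generate_topology_on (\<Union>{{U. openin T U} | T. T \<in> \<T>}) U" "0 \<in> U"
      unfolding G_def openin_topology_generated_by_iff by auto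
    then show "\<exists>V. openin G V \<and> 0 \<in> V \<and> convex V \<and> V \<subseteq> U"
    proof (induction rule: generate_topology_on.induct)
      case (Int a b)
      then obtain V W where "openin G V" "0 \<in> V" "convex V" "V \<subseteq> a" "openin G W" "0 \<in> W" "convex W" "W \<subseteq> b"
        by auto
      then show ?case by (intro exI[of _ "V \<inter> W"]) (auto intro: convex_Int)
    next
      case (UN K)
      then obtain k where "k \<in> K" "0 \<in> k" by blast
      with UN.IH[of k] show ?case by blast
    next
      case (Basis s)
      then obtain T where T: "T \<in> \<T>" "openin T s" by blast
      then obtain V where "openin T V" "0 \<in> V" "convex V" "V \<subseteq> s"
        using \<T>(2)[OF T(1)] Basis unfolding lctvs_def by blast
      then show ?case using op[OF T(1)] by blast
    qed auto
  qed
qed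

section \<open>Weighted spaces\<close>

definition weighted_bound :: "(real \<Rightarrow> real) \<Rightarrow> (real^'n \<Rightarrow> real) \<Rightarrow> real \<Rightarrow> bool" where
  "weighted_bound \<phi> f C \<longleftrightarrow> (\<forall>x. \<phi> (norm x) * \<bar>f x\<bar> \<le> C)"

definition weighted_seminorm :: "(real \<Rightarrow> real) \<Rightarrow> 'n list \<Rightarrow> (real^'n \<Rightarrow> real^'n) \<Rightarrow> real" where
  "weighted_seminorm \<phi> js f = (SUP x. \<phi> (norm x) * norm (partials js f x))"

definition weighted_maps :: "(real \<Rightarrow> real) set \<Rightarrow> (real^'n \<Rightarrow> real^'n) set" where
  "weighted_maps W = {f. smooth_map f \<and> (\<forall>\<phi>\<in>W. \<forall>js. bdd_above (range (\<lambda>x. \<phi> (norm x) * norm (partials js f x))))}"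

definition weighted_seminorms :: "(real \<Rightarrow> real) set \<Rightarrow> ((real^'n \<Rightarrow> real^'n) \<Rightarrow> real) set" where
  "weighted_seminorms W = {weighted_seminorm \<phi> js | \<phi> js. \<phi> \<in> W}"

text \<open>\<open>one\<close> puts the plain supremum among the norms and so gives the embedding;
  \<open>shift\<close> absorbs a bounded displacement of the argument.\<close>

locale weights =
  fixes W :: "(real \<Rightarrow> real) set"
  assumes nonneg: "\<phi> \<in> W \<Longrightarrow> 0 \<le> r \<Longrightarrow> 0 \<le> \<phi> r"
    and mono: "\<phi> \<in> W \<Longrightarrow> 0 \<le> r \<Longrightarrow> r \<le> s \<Longrightarrow> \<phi> r \<le> \<phi> s"
    and one: "(\<lambda>_. 1) \<in> W"
    and shift: "\<phi> \<in> W \<Longrightarrow> 0 \<le> R \<Longrightarrow> \<exists>\<psi>\<in>W. \<exists>K\<ge>0. \<forall>r\<ge>0. \<phi> (r + R) \<le> K * \<psi> r"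
begin

lemma size_bound_weighted:
  assumes \<phi>: "\<phi> \<in> W"
  shows "size_bound (weighted_bound \<phi> :: (real^'n \<Rightarrow> real) \<Rightarrow> _)"
proof
  have nn: "0 \<le> \<phi> (norm x)" for x :: "real^'n" using nonneg[OF \<phi>] by simp
  fix f g :: "real^'n \<Rightarrow> real" and c C D :: real
  show "0 \<le> C" if "weighted_bound \<phi> f C"
    using that[unfolded weighted_bound_def, rule_format, of 0] nn[of 0]
    by (meson abs_ge_zero mult_nonneg_nonneg order_trans)
  show "weighted_bound \<phi> (\<lambda>x::real^'n. 0) 0"
    by (simp add: weighted_bound_def)
  show "weighted_bound \<phi> f D" if "weighted_bound \<phi> f C" "C \<le> D"
    using that unfolding weighted_bound_def by (meson order_trans)
  show "weighted_bound \<phi> f (c * C)" if "weighted_bound \<phi> g C" "0 \<le> c" "\<And>x. \<bar>f x\<bar> \<le> c * \<bar>g x\<bar>"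
    unfolding weighted_bound_def
  proof
    fix x
    have "\<phi> (norm x) * \<bar>f x\<bar> \<le> \<phi> (norm x) * (c * \<bar>g x\<bar>)"
      using that(3) nn by (intro mult_left_mono)
    also have "\<dots> = c * (\<phi> (norm x) * \<bar>g x\<bar>)" by simp
    also have "\<dots> \<le> c * C"
      using that(1,2) by (intro mult_left_mono) (auto simp: weighted_bound_def)
    finally show "\<phi> (norm x) * \<bar>f x\<bar> \<le> c * C" .
  qed
  show "weighted_bound \<phi> (\<lambda>x. f x + g x) (C + D)" if "weighted_bound \<phi> f C" "weighted_bound \<phi> g D"
    unfolding weighted_bound_def
  proof
    fix x
    have "\<phi> (norm x) * \<bar>f x + g x\<bar> \<le> \<phi> (norm x) * (\<bar>f x\<bar> + \<bar>g x\<bar>)"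
      using nn by (intro mult_left_mono) auto
    also have "\<dots> \<le> C + D"
      using that by (simp add: weighted_bound_def distrib_left add_mono)
    finally show "\<phi> (norm x) * \<bar>f x + g x\<bar> \<le> C + D" .
  qed
  show "weighted_bound \<phi> f C" if "\<And>x. (\<lambda>n. F n x) \<longlonglongrightarrow> f x" "\<And>n. weighted_bound \<phi> (F n) C"
    for F :: "nat \<Rightarrow> real^'n \<Rightarrow> real"
    unfolding weighted_bound_def
  proof
    fix x
    show "\<phi> (norm x) * \<bar>f x\<bar> \<le> C"
      by (rule tendsto_upperbound[OF tendsto_mult[OF tendsto_const tendsto_rabs[OF that(1)]]])
        (use that(2) in \<open>auto simp: weighted_bound_def\<close>)
  qed
qed

text \<open>Since |x| is at most |F x| + R, monotonicity and \<open>shift\<close> bound the weight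
  at \<open>x\<close> by a weight at \<open>F x\<close>, where \<open>f\<close> is
  evaluated.\<close>

lemma displacement_control_weighted:
  assumes \<phi>: "\<phi> \<in> W"
  shows "\<exists>\<psi>\<in>W. \<exists>K. displacement_control (weighted_bound \<phi>) (weighted_bound \<psi>) R {[]} K"
proof -
  \<comment> \<open>\<open>\<bar>R\<bar>\<close> because \<open>shift\<close> asks for a nonnegative
    displacement and \<open>R\<close> is arbitrary.\<close>
  obtain \<psi> K where \<psi>: "\<psi> \<in> W" "K \<ge> 0" "\<And>r. r \<ge> 0 \<Longrightarrow> \<phi> (r + \<bar>R\<bar>) \<le> K * \<psi> r"
    using shift[OF \<phi>, of "\<bar>R\<bar>"] by auto
  have "weighted_bound \<phi> (\<lambda>x. f (F x) $ i) (K * C)"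
    if F: "\<forall>x. norm (F x - x) \<le> R" and f: "weighted_bound \<psi> (\<lambda>x. f x $ i) C"
    for F f :: "real^'n \<Rightarrow> real^'n" and i C
    unfolding weighted_bound_def
  proof
    fix x
    have "norm x \<le> norm (F x) + norm (F x - x)"
      by (metis add.commute norm_minus_commute norm_triangle_sub)
    also have "\<dots> \<le> norm (F x) + \<bar>R\<bar>"
      using F[rule_format, of x] by linarith
    finally have "\<phi> (norm x) \<le> \<phi> (norm (F x) + \<bar>R\<bar>)"
      using mono[OF \<phi>] by simp
    also have "\<dots> \<le> K * \<psi> (norm (F x))" using \<psi>(3) by simp
    finally have "\<phi> (norm x) * \<bar>f (F x) $ i\<bar> \<le> (K * \<psi> (norm (F x))) * \<bar>f (F x) $ i\<bar>"
      by (intro mult_right_mono) auto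
    also have "\<dots> \<le> K * C"
      using f \<psi>(2) unfolding weighted_bound_def by (simp add: mult.assoc mult_left_mono)
    finally show "\<phi> (norm x) * \<bar>f (F x) $ i\<bar> \<le> K * C" .
  qed
  then show ?thesis
    using \<psi>(1,2) by (intro bexI[of _ \<psi>] exI[of _ K]) (auto simp: displacement_control_def)
qed

lemma reparametrizable_weighted: "reparametrizable (weighted_bound ` W)"
  unfolding reparametrizable_def using displacement_control_weighted by blast

lemma controls_sup_weighted: "controls_sup (weighted_bound (\<lambda>_. 1)) {[]} 1"
  by (simp add: controls_sup_def weighted_bound_def)

lemma weighted_seminorm_upper:
  assumes "f \<in> weighted_maps W" "\<phi> \<in> W"
  shows "\<phi> (norm x) * norm (partials js f x) \<le> weighted_seminorm \<phi> js f"
  unfolding weighted_seminorm_def using assms by (intro cSUP_upper) (auto simp: weighted_maps_def)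

lemma weighted_seminorm_least:
  "(\<And>x. \<phi> (norm x) * norm (partials js f x) \<le> C) \<Longrightarrow> weighted_seminorm \<phi> js f \<le> C"
  unfolding weighted_seminorm_def by (intro cSUP_least) auto

lemma weighted_add:
  assumes "f \<in> weighted_maps W" "g \<in> weighted_maps W" "\<phi> \<in> W"
  shows "\<phi> (norm x) * norm (partials js (f + g) x) \<le> weighted_seminorm \<phi> js f + weighted_seminorm \<phi> js g"
proof -
  have "\<phi> (norm x) * norm (partials js (f + g) x) \<le> \<phi> (norm x) * (norm (partials js f x) + norm (partials js g x))"
    using assms nonneg[OF assms(3)] by (intro mult_left_mono) (auto simp: smooth_map_add weighted_maps_def norm_triangle_ineq)
  also have "\<dots> \<le> weighted_seminorm \<phi> js f + weighted_seminorm \<phi> js g"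
    unfolding distrib_left by (intro add_mono weighted_seminorm_upper assms)
  finally show ?thesis .
qed

lemma weighted_scale:
  assumes "f \<in> weighted_maps W" "\<phi> \<in> W"
  shows "\<phi> (norm x) * norm (partials js (a *\<^sub>R f) x) \<le> \<bar>a\<bar> * weighted_seminorm \<phi> js f"
proof -
  have "\<phi> (norm x) * norm (partials js (a *\<^sub>R f) x) = \<bar>a\<bar> * (\<phi> (norm x) * norm (partials js f x))"
    using assms by (simp add: smooth_map_scaleR weighted_maps_def)
  also have "\<dots> \<le> \<bar>a\<bar> * weighted_seminorm \<phi> js f"
    by (intro mult_left_mono weighted_seminorm_upper assms) auto
  finally show ?thesis .
qed

lemma seminorms_weighted:
  "seminorms (weighted_maps W :: (real^'n \<Rightarrow> real^'n) set) (weighted_seminorms W)"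
proof
  show "subspace (weighted_maps W :: (real^'n \<Rightarrow> real^'n) set)"
  proof (rule subspaceI)
    show "0 \<in> (weighted_maps W :: (real^'n \<Rightarrow> real^'n) set)"
      unfolding zero_fun_def weighted_maps_def mem_Collect_eq partials_zero using smooth_map_zero by simp
    show "f + g \<in> weighted_maps W" if "f \<in> weighted_maps W" "g \<in> weighted_maps W" for f g :: "real^'n \<Rightarrow> real^'n"
      using weighted_add[OF that] that smooth_map_add(1)[of f g]
      unfolding weighted_maps_def[of W] by (auto intro!: bdd_aboveI2)
    show "a *\<^sub>R f \<in> weighted_maps W" if "f \<in> weighted_maps W" for a and f :: "real^'n \<Rightarrow> real^'n"
      using weighted_scale[OF that] that smooth_map_scaleR(1)[of f]
      unfolding weighted_maps_def[of W] by (auto intro!: bdd_aboveI2)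
  qed
  fix q :: "(real^'n \<Rightarrow> real^'n) \<Rightarrow> real" and f :: "real^'n \<Rightarrow> real^'n" assume q: "q \<in> weighted_seminorms W" and f: "f \<in> weighted_maps W"
  obtain \<phi> js where \<phi>: "\<phi> \<in> W" "q = weighted_seminorm \<phi> js" using q by (auto simp: weighted_seminorms_def)
  show "0 \<le> q f"
    unfolding \<phi>(2)
    by (rule order_trans[OF mult_nonneg_nonneg weighted_seminorm_upper[OF f \<phi>(1), of 0 js]])
      (simp_all add: nonneg[OF \<phi>(1)])
  show "q (f + g) \<le> q f + q g" if "g \<in> weighted_maps W" for g
    unfolding \<phi>(2) by (intro weighted_seminorm_least weighted_add f that \<phi>)
  show "q (a *\<^sub>R f) \<le> \<bar>a\<bar> * q f" for a
    unfolding \<phi>(2) by (intro weighted_seminorm_least weighted_scale f \<phi>)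
qed

lemma norm_le_components:
  fixes v :: "real^'n"
  assumes "0 \<le> c" "\<And>i. c * \<bar>v $ i\<bar> \<le> C i"
  shows "c * norm v \<le> (\<Sum>i\<in>UNIV. C i)"
proof -
  have "c * norm v \<le> c * (\<Sum>i\<in>UNIV. \<bar>v $ i\<bar>)"
    by (intro mult_left_mono norm_le_l1_cart assms)
  also have "\<dots> \<le> (\<Sum>i\<in>UNIV. C i)"
    unfolding sum_distrib_left by (intro sum_mono assms)
  finally show ?thesis .
qed

lemma weighted_maps_components:
  "weighted_maps W = {f. smooth_map f \<and> (\<forall>N\<in>weighted_bound ` W. \<forall>js i. \<exists>C. N (\<lambda>x. partials js f x $ i) C)}"
proof -
  have eq: "bdd_above (range (\<lambda>x. \<phi> (norm x) * norm (partials js f x))) \<longleftrightarrow>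
      (\<forall>i. \<exists>C. weighted_bound \<phi> (\<lambda>x. partials js f x $ i) C)" if \<phi>: "\<phi> \<in> W" for \<phi> js and f :: "real^'n \<Rightarrow> real^'n"
  proof
    assume "bdd_above (range (\<lambda>x. \<phi> (norm x) * norm (partials js f x)))"
    then obtain C where C: "\<And>x. \<phi> (norm x) * norm (partials js f x) \<le> C" by (auto simp: bdd_above_def)
    have "\<phi> (norm x) * \<bar>partials js f x $ i\<bar> \<le> C" for x i
      using mult_left_mono[OF component_le_norm_cart nonneg[OF \<phi> norm_ge_zero]] C order_trans by blast
    then show "\<forall>i. \<exists>C. weighted_bound \<phi> (\<lambda>x. partials js f x $ i) C"
      unfolding weighted_bound_def by blast
  next
    assume "\<forall>i. \<exists>C. weighted_bound \<phi> (\<lambda>x. partials js f x $ i) C"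
    then obtain C where "\<And>i x. \<phi> (norm x) * \<bar>partials js f x $ i\<bar> \<le> C i"
      unfolding weighted_bound_def by (metis (no_types))
    then have "\<phi> (norm x) * norm (partials js f x) \<le> (\<Sum>i\<in>UNIV. C i)" for x
      using nonneg[OF \<phi>] by (intro norm_le_components) auto
    then show "bdd_above (range (\<lambda>x. \<phi> (norm x) * norm (partials js f x)))"
      by (auto intro!: bdd_aboveI2)
  qed
  show ?thesis
    unfolding weighted_maps_def by (simp add: eq)
qed

lemma weighted_zero_neighbourhood:
  fixes N :: "(real^'n \<Rightarrow> real) \<Rightarrow> real \<Rightarrow> bool"
  assumes N: "N \<in> weighted_bound ` W" and e: "0 < e"
  shows "\<exists>U. openin (seminorm_topology (weighted_maps W) (weighted_seminorms W)) U \<and> 0 \<in> U \<and>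
    (\<forall>f\<in>U. N (\<lambda>x. partials js f x $ i) e)"
proof -
  \<comment> \<open>Saved under a new name because the interpretation of \<open>seminorms\<close>
    brings its own \<open>nonneg\<close>.\<close>
  note weight_nonneg = nonneg
  interpret seminorms "weighted_maps W :: (real^'n \<Rightarrow> real^'n) set" "weighted_seminorms W"
    by (rule seminorms_weighted)
  obtain \<phi> where \<phi>: "\<phi> \<in> W" "N = weighted_bound \<phi>" using N by blast
  have q: "weighted_seminorm \<phi> js \<in> weighted_seminorms W" using \<phi> by (auto simp: weighted_seminorms_def)
  let ?U = "{f \<in> weighted_maps W. weighted_seminorm \<phi> js (f - 0) < e}"
  have "N (\<lambda>x. partials js f x $ i) e" if f: "f \<in> ?U" for f
    unfolding \<phi>(2) weighted_bound_def
  proof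
    fix x
    have "\<phi> (norm x) * \<bar>partials js f x $ i\<bar> \<le> \<phi> (norm x) * norm (partials js f x)"
      by (intro mult_left_mono component_le_norm_cart weight_nonneg[OF \<phi>(1)]) auto
    also have "\<dots> \<le> weighted_seminorm \<phi> js f"
      using f \<phi>(1) by (intro weighted_seminorm_upper) auto
    finally show "\<phi> (norm x) * \<bar>partials js f x $ i\<bar> \<le> e" using f by simp
  qed
  then show ?thesis
    using ball_open[OF q subspace_0[OF E], of e] subspace_0[OF E] zero_value[OF q] e
    by (intro exI[of _ ?U]) auto
qed

lemma eventually_weighted_seminorm:
  fixes f :: "nat \<Rightarrow> real^'n \<Rightarrow> real^'n"
  assumes \<phi>: "\<phi> \<in> W" and e: "0 < e"
    and ev: "\<And>i e. 0 < e \<Longrightarrow> \<forall>\<^sub>F n in sequentially. weighted_bound \<phi> (\<lambda>x. partials js (f n) x $ i) e"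
  shows "\<forall>\<^sub>F n in sequentially. weighted_seminorm \<phi> js (f n) < e"
proof -
  \<comment> \<open>The sum over the components is then \<open>e / 2\<close>, strictly below
    \<open>e\<close>.\<close>
  define d where "d = e / (2 * real CARD('n))"
  have d: "0 < d" using e by (simp add: d_def)
  have "\<forall>\<^sub>F n in sequentially. \<forall>i\<in>UNIV. weighted_bound \<phi> (\<lambda>x. partials js (f n) x $ i) d"
    by (intro eventually_ball_finite finite ballI ev d)
  then show ?thesis
  proof eventually_elim
    case (elim n)
    have "weighted_seminorm \<phi> js (f n) \<le> (\<Sum>i\<in>(UNIV::'n set). d)"
      using elim nonneg[OF \<phi>] unfolding weighted_bound_def
      by (intro weighted_seminorm_least norm_le_components) auto
    also have "\<dots> < e" using e by (simp add: d_def)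
    finally show ?case .
  qed
qed

lemma function_space_weighted:
  "function_space (seminorm_topology (weighted_maps W :: (real^'n \<Rightarrow> real^'n) set) (weighted_seminorms W)) (weighted_bound ` W)"
proof
  interpret seminorms "weighted_maps W :: (real^'n \<Rightarrow> real^'n) set" "weighted_seminorms W"
    by (rule seminorms_weighted)
  let ?T = "seminorm_topology (weighted_maps W :: (real^'n \<Rightarrow> real^'n) set) (weighted_seminorms W)"
  show "lctvs ?T" by (rule lctvs_topology)
  show "\<forall>N\<in>weighted_bound ` W. size_bound N" using size_bound_weighted by blast
  show "topspace ?T = {f. smooth_map f \<and> (\<forall>N\<in>weighted_bound ` W. \<forall>js i. \<exists>C. N (\<lambda>x. partials js f x $ i) C)}"
    using weighted_maps_components by simp
  show "\<exists>U. openin ?T U \<and> 0 \<in> U \<and> (\<forall>f\<in>U. N (\<lambda>x. partials js f x $ i) e)"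
    if "N \<in> weighted_bound ` W" "0 < e" for N js i e
    using that by (rule weighted_zero_neighbourhood)
  show "limitin ?T f 0 sequentially" if "range f \<subseteq> topspace ?T"
    "\<And>N js i e. N \<in> weighted_bound ` W \<Longrightarrow> 0 < e \<Longrightarrow> \<forall>\<^sub>F n in sequentially. N (\<lambda>x. partials js (f n) x $ i) e" for f
  proof (rule limitin_zero)
    show "range f \<subseteq> weighted_maps W" using that(1) by simp
    fix q :: "(real^'n \<Rightarrow> real^'n) \<Rightarrow> real" and e :: real assume "q \<in> weighted_seminorms W" "0 < e"
    then show "\<forall>\<^sub>F n in sequentially. q (f n) < e"
      using that(2) by (auto simp: weighted_seminorms_def intro!: eventually_weighted_seminorm)
  qed
  show "\<exists>N\<in>weighted_bound ` W. \<exists>J K. controls_sup N J K"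
    using controls_sup_weighted one by blast
  show "reparametrizable (weighted_bound ` W)" by (rule reparametrizable_weighted)
qed

end

lemma sup_seminorm_eq: "sup_seminorm = weighted_seminorm (\<lambda>_. 1)"
  by (simp add: fun_eq_iff sup_seminorm_def weighted_seminorm_def)

lemma function_space_bounded: "function_space (bounded_space :: (real^'n \<Rightarrow> real^'n) topology) {weighted_bound (\<lambda>_. 1)}"
proof -
  interpret weights "{\<lambda>_. 1}"
    by standard (auto intro!: exI[of _ "1::real"])
  have "bounded (range f) \<longleftrightarrow> bdd_above (range (\<lambda>x. 1 * norm (f x)))" for f :: "real^'n \<Rightarrow> real^'n"
    by (simp add: bounded_iff bdd_above_def)
  then have e1: "weighted_maps {\<lambda>_. 1} = {f :: real^'n \<Rightarrow> real^'n. smooth_map f \<and> (\<forall>js. bounded (range (partials js f)))}"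
    by (simp add: weighted_maps_def)
  have e2: "weighted_seminorms {\<lambda>_. 1} = range (sup_seminorm :: 'n list \<Rightarrow> _)"
    by (auto simp: weighted_seminorms_def sup_seminorm_eq)
  show ?thesis
    using function_space_weighted[where 'n='n, unfolded e1 e2] by (simp add: bounded_space_def)
qed

lemma function_space_schwartz: "function_space (schwartz_space :: (real^'n \<Rightarrow> real^'n) topology) (weighted_bound ` range (\<lambda>k r. (1 + r\<^sup>2) ^ k))"
proof -
  interpret weights "range (\<lambda>k r. (1 + r\<^sup>2) ^ k)"
  proof
    show "(\<lambda>_. 1) \<in> range (\<lambda>k r. (1 + r\<^sup>2) ^ k :: real)"
      by (rule range_eqI[of _ _ 0]) simp
    fix \<phi> :: "real \<Rightarrow> real" assume "\<phi> \<in> range (\<lambda>k r. (1 + r\<^sup>2) ^ k)"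
    then obtain k where \<phi>: "\<phi> = (\<lambda>r. (1 + r\<^sup>2) ^ k)" by blast
    show "0 \<le> \<phi> r" for r unfolding \<phi> by simp
    show "\<phi> r \<le> \<phi> s" if "0 \<le> r" "r \<le> s" for r s
      unfolding \<phi> using that by (intro power_mono add_left_mono) auto
    show "\<exists>\<psi>\<in>range (\<lambda>k r. (1 + r\<^sup>2) ^ k). \<exists>K\<ge>0. \<forall>r\<ge>0. \<phi> (r + R) \<le> K * \<psi> r" for R
    \<comment> \<open>The constant is the one in Peetre's inequality 1 + (r + R)^2 \<le> 2 (1 + R^2)
      (1 + r^2), raised to the power \<open>k\<close>; the weight itself stays the same.\<close>
    proof (intro bexI[of _ \<phi>] exI[of _ "(2 * (1 + R\<^sup>2)) ^ k"] conjI allI impI)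
      fix r :: real
      have "0 \<le> (r - R)\<^sup>2" by simp
      then have "(r + R)\<^sup>2 \<le> 2 * r\<^sup>2 + 2 * R\<^sup>2" by (simp add: power2_eq_square algebra_simps)
      moreover have "0 \<le> R\<^sup>2 * r\<^sup>2" by simp
      moreover have "(2 * (1 + R\<^sup>2)) * (1 + r\<^sup>2) = 2 + 2 * r\<^sup>2 + 2 * R\<^sup>2 + 2 * (R\<^sup>2 * r\<^sup>2)"
        by (simp add: algebra_simps)
      ultimately have "1 + (r + R)\<^sup>2 \<le> (2 * (1 + R\<^sup>2)) * (1 + r\<^sup>2)" by linarith
      then show "\<phi> (r + R) \<le> (2 * (1 + R\<^sup>2)) ^ k * \<phi> r"
        unfolding \<phi> power_mult_distrib[symmetric] by (intro power_mono) auto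
    qed (auto simp: \<phi>)
  qed
  have e1: "weighted_maps (range (\<lambda>k r. (1 + r\<^sup>2) ^ k)) = {f :: real^'n \<Rightarrow> real^'n. smooth_map f \<and>
      (\<forall>k js. bdd_above (range (\<lambda>x. (1 + (norm x)\<^sup>2) ^ k * norm (partials js f x))))}"
    by (simp add: weighted_maps_def)
  have e2: "weighted_seminorms (range (\<lambda>k r. (1 + r\<^sup>2) ^ k)) = {schwartz_seminorm k (js :: 'n list) | k js. True}"
    by (auto simp: weighted_seminorms_def weighted_seminorm_def[abs_def] schwartz_seminorm_def[abs_def])
  show ?thesis
    using function_space_weighted[where 'n='n, unfolded e1 e2] unfolding schwartz_space_def .
qed

section \<open>The space of test functions\<close>

definition monotone_weights :: "(real \<Rightarrow> real) set" where
  "monotone_weights = {\<phi>. (\<forall>r\<ge>0. 0 \<le> \<phi> r) \<and> (\<forall>r s. 0 \<le> r \<longrightarrow> r \<le> s \<longrightarrow> \<phi> r \<le> \<phi> s)}"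

interpretation mw: weights monotone_weights
proof
  show "\<exists>\<psi>\<in>monotone_weights. \<exists>K\<ge>0. \<forall>r\<ge>0. \<phi> (r + R) \<le> K * \<psi> r"
    if "\<phi> \<in> monotone_weights" "0 \<le> R" for \<phi> R
    using that by (intro bexI[of _ "\<lambda>r. \<phi> (r + R)"] exI[of _ 1]) (auto simp: monotone_weights_def)
qed (auto simp: monotone_weights_def)

interpretation unit_weight: weights "{\<lambda>_. 1}"
  by standard (auto intro!: exI[of _ "1::real"])

text \<open>If the supports escaped, there would be maps \<open>f j\<close> not vanishing at points
  \<open>x j\<close> with |x j| > j. The step function that jumps by
  \<open>j / norm (f j (x j))\<close> at \<open>j\<close> is a monotone weight for which the
  weighted value at \<open>x j\<close> is at least \<open>j\<close>, against the assumed
  bound.\<close>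

lemma common_support:
  fixes G :: "(real^'n \<Rightarrow> real^'n) set"
  assumes bounded: "\<And>\<phi>. \<phi> \<in> monotone_weights \<Longrightarrow> \<exists>C. \<forall>f\<in>G. \<forall>x. \<phi> (norm x) * norm (f x) \<le> C"
  shows "\<exists>R. \<forall>f\<in>G. \<forall>x. R < norm x \<longrightarrow> f x = 0"
proof (rule ccontr)
  assume "\<nexists>R. \<forall>f\<in>G. \<forall>x. R < norm x \<longrightarrow> f x = 0"
  then have "\<forall>j::nat. \<exists>f x. f \<in> G \<and> real j < norm x \<and> f x \<noteq> 0" by blast
  then obtain f x where fx: "\<And>j::nat. f j \<in> G" "\<And>j. real j < norm (x j)" "\<And>j. f j (x j) \<noteq> 0"
    by metis
  \<comment> \<open>Only finitely many indices lie below \<open>r\<close>, and the jump of index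
    \<open>j\<close> has already occurred at \<open>norm (x j)\<close>.\<close>
  define \<phi> where "\<phi> r = (\<Sum>j | real j \<le> r. real j / norm (f j (x j)))" for r
  have fin: "finite {j. real j \<le> r}" for r
  proof (rule finite_subset)
    show "{j. real j \<le> r} \<subseteq> {..nat \<lceil>r\<rceil>}" by (auto simp: le_nat_iff) linarith
  qed simp
  have "\<phi> \<in> monotone_weights"
    unfolding monotone_weights_def \<phi>_def using fin
    by (auto intro!: sum_nonneg sum_mono2)
  then obtain C where C: "\<And>g y. g \<in> G \<Longrightarrow> \<phi> (norm y) * norm (g y) \<le> C"
    using bounded by blast
  obtain j :: nat where j: "C < real j" using reals_Archimedean2 by blast
  have "real j / norm (f j (x j)) \<le> \<phi> (norm (x j))"
    unfolding \<phi>_def using fx(2)[of j] fin by (intro member_le_sum) auto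
  then have "real j \<le> \<phi> (norm (x j)) * norm (f j (x j))"
    using fx(3)[of j] by (simp add: divide_le_eq)
  with C[OF fx(1)[of j], of "x j"] j show False by linarith
qed

lemma partials_zero_outside:
  assumes "x \<notin> closure {x. f x \<noteq> 0}"
  shows "partials js f x = 0"
  using assms
proof (induction js arbitrary: x)
  case Nil
  then show ?case using closure_subset[of "{x. f x \<noteq> 0}"] by auto
next
  case (Cons j js)
  have "((\<lambda>_. 0) has_derivative (\<lambda>_. 0)) (at x)" by simp
  then have "(partials js f has_derivative (\<lambda>_. 0)) (at x)"
    by (rule has_derivative_transform_within_open[where s="- closure {x. f x \<noteq> 0}"])
      (use Cons in auto)
  then show ?case
    by (simp add: partial_eq_dd dd_eqI[where f'="\<lambda>_. 0"])
qed

definition maps_supported_in :: "(real^'n) set \<Rightarrow> (real^'n \<Rightarrow> real^'n) set" where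
  "maps_supported_in K = {f. smooth_map f \<and> closure {x. f x \<noteq> 0} \<subseteq> K}"

lemma test_space_on_eq: "test_space_on K = seminorm_topology (maps_supported_in K) (range sup_seminorm)"
  by (simp add: test_space_on_def maps_supported_in_def)

lemma supported_zero: "f \<in> maps_supported_in K \<Longrightarrow> x \<notin> K \<Longrightarrow> partials js f x = 0"
  using partials_zero_outside[of x f js] by (auto simp: maps_supported_in_def)

lemma supported_weighted_bound:
  fixes K :: "(real^'n) set"
  assumes \<phi>: "\<phi> \<in> monotone_weights" and R: "0 \<le> R" "K \<subseteq> cball 0 R" and f: "f \<in> maps_supported_in K"
    and C: "\<And>x. norm (partials js f x) \<le> C"
  shows "\<phi> (norm x) * norm (partials js f x) \<le> \<phi> R * C"
proof (cases "x \<in> K")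
  case True
  then have "norm x \<le> R" using R by auto
  then have "\<phi> (norm x) \<le> \<phi> R" using mw.mono[OF \<phi>] by simp
  then show ?thesis
    using C[of x] mw.nonneg[OF \<phi> R(1)] by (intro mult_mono) auto
next
  case False
  have "0 \<le> C" using C[of 0] norm_ge_zero order_trans by blast
  then show ?thesis
    using mw.nonneg[OF \<phi> R(1)] supported_zero[OF f False] by simp
qed

lemma supported_partials_bounded:
  fixes K :: "(real^'n) set"
  assumes "compact K" "f \<in> maps_supported_in K"
  obtains C where "\<And>x. norm (partials js f x) \<le> C"
proof -
  have "compact (partials js f ` K)"
    using assms by (intro compact_continuous_image smooth_map_continuous) (auto simp: maps_supported_in_def)
  then obtain C where C: "\<And>y. y \<in> partials js f ` K \<Longrightarrow> norm y \<le> C"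
    using compact_imp_bounded bounded_iff by metis
  have "norm (partials js f x) \<le> \<bar>C\<bar>" for x
    using C[of "partials js f x"] supported_zero[OF assms(2), of x js] by (cases "x \<in> K") auto
  then show thesis by (rule that)
qed

lemma compact_subset_cball:
  fixes K :: "'a::euclidean_space set"
  assumes "compact K"
  obtains R where "0 \<le> R" "K \<subseteq> cball 0 R"
proof -
  obtain B where "\<And>x. x \<in> K \<Longrightarrow> norm x \<le> B"
    using compact_imp_bounded[OF assms] unfolding bounded_iff by blast
  then have "K \<subseteq> cball 0 \<bar>B\<bar>" by force
  then show thesis by (rule that[rotated]) simp
qed

lemma weighted_maps_antimono: "V \<subseteq> W \<Longrightarrow> weighted_maps W \<subseteq> weighted_maps V"
  unfolding weighted_maps_def by auto

lemma supported_subset_weighted_maps: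
  assumes "compact K"
  shows "maps_supported_in K \<subseteq> weighted_maps monotone_weights"
proof
  fix f assume f: "f \<in> maps_supported_in K"
  obtain R where R: "0 \<le> R" "K \<subseteq> cball 0 R"
    using compact_subset_cball[OF assms] .
  have "bdd_above (range (\<lambda>x. \<phi> (norm x) * norm (partials js f x)))" if \<phi>: "\<phi> \<in> monotone_weights" for \<phi> js
  proof -
    obtain C where C: "\<And>x. norm (partials js f x) \<le> C"
      using supported_partials_bounded[OF assms f, of js] by blast
    show ?thesis
      by (rule bdd_aboveI2[OF supported_weighted_bound[OF \<phi> R f C]])
  qed
  then show "f \<in> weighted_maps monotone_weights"
    using f by (simp add: weighted_maps_def maps_supported_in_def)
qed

lemma supported_inI:
  fixes f :: "real^'n \<Rightarrow> real^'n"
  assumes "smooth_map f" "\<And>x. R < norm x \<Longrightarrow> f x = 0"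
  shows "f \<in> maps_supported_in (cball 0 R)"
proof -
  have "{x. f x \<noteq> 0} \<subseteq> cball 0 R" using assms(2) by force
  then show ?thesis
    using assms(1) closure_minimal[OF _ closed_cball] by (simp add: maps_supported_in_def)
qed

text \<open>Boundedness against every monotone weight forces compact support, by
  \<open>common_support\<close> for a single map.\<close>

lemma test_maps_eq: "(\<Union>K\<in>{K. compact K}. maps_supported_in K) = (weighted_maps monotone_weights :: (real^'n \<Rightarrow> real^'n) set)"
proof (intro equalityI subsetI)
  fix f :: "real^'n \<Rightarrow> real^'n" assume f: "f \<in> weighted_maps monotone_weights"
  have "\<exists>R. \<forall>g\<in>{f}. \<forall>x. R < norm x \<longrightarrow> g x = 0"
  proof (rule common_support)
    fix \<phi> assume "\<phi> \<in> monotone_weights"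
    then show "\<exists>C. \<forall>g\<in>{f}. \<forall>x. \<phi> (norm x) * norm (g x) \<le> C"
      using mw.weighted_seminorm_upper[OF f, of \<phi> _ "[]"] by auto
  qed
  then obtain R where "\<And>x. R < norm x \<Longrightarrow> f x = 0" by blast
  then have "f \<in> maps_supported_in (cball 0 R)"
    using f by (intro supported_inI) (auto simp: weighted_maps_def)
  then show "f \<in> (\<Union>K\<in>{K. compact K}. maps_supported_in K)" using compact_cball by blast
qed (use supported_subset_weighted_maps in auto)

lemma seminorms_supported:
  fixes K :: "(real^'n) set"
  assumes "compact K"
  shows "seminorms (maps_supported_in K) (range sup_seminorm)"
proof -
  have W: "weighted_seminorms {\<lambda>_. 1} = range (sup_seminorm :: 'n list \<Rightarrow> _)"
    by (auto simp: weighted_seminorms_def sup_seminorm_eq)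
  interpret seminorms "weighted_maps {\<lambda>_. 1} :: (real^'n \<Rightarrow> real^'n) set" "range sup_seminorm"
    using unit_weight.seminorms_weighted[where 'n='n] unfolding W .
  have sub: "maps_supported_in K \<subseteq> weighted_maps {\<lambda>_. 1}"
    using supported_subset_weighted_maps[OF assms] weighted_maps_antimono[of "{\<lambda>_. 1}" monotone_weights] mw.one by blast
  have iff: "f \<in> maps_supported_in K \<longleftrightarrow> smooth_map f \<and> (\<forall>x. x \<notin> K \<longrightarrow> f x = 0)" for f :: "real^'n \<Rightarrow> real^'n"
  proof
    show "smooth_map f \<and> (\<forall>x. x \<notin> K \<longrightarrow> f x = 0)" if "f \<in> maps_supported_in K"
      using that supported_zero[OF that, of _ "[]"] by (auto simp: maps_supported_in_def)
    show "f \<in> maps_supported_in K" if "smooth_map f \<and> (\<forall>x. x \<notin> K \<longrightarrow> f x = 0)"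
      using that closure_minimal[OF _ compact_imp_closed[OF assms], of "{x. f x \<noteq> 0}"]
      by (auto simp: maps_supported_in_def)
  qed
  show ?thesis
  proof
    show "subspace (maps_supported_in K)"
      using smooth_map_zero[where 'a='n and 'b='n]
      by (auto intro!: subspaceI simp: iff smooth_map_add(1) smooth_map_scaleR(1) zero_fun_def plus_fun_def scaleR_fun_def)
        (auto dest: smooth_map_add(1) smooth_map_scaleR(1) simp: plus_fun_def scaleR_fun_def)
  qed (use sub nonneg add scale in blast)+
qed

text \<open>This makes the weighted topology a competitor in the supremum that defines
  \<open>test_space\<close>. On a ball of radius \<open>R\<close> containing \<open>K\<close> the
  weight is at most \<open>\<phi> R\<close>, so plain suprema control weighted ones.\<close>

lemma test_space_on_continuous_weighted:
  fixes K :: "(real^'n) set"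
  assumes K: "compact K"
  shows "continuous_map (test_space_on K) (seminorm_topology (weighted_maps monotone_weights) (weighted_seminorms monotone_weights)) id"
  unfolding test_space_on_eq
proof (rule continuous_map_seminorm_topologyI)
  interpret seminorms "maps_supported_in K" "range sup_seminorm"
    by (rule seminorms_supported[OF K])
  show "id f \<in> weighted_maps monotone_weights" if "f \<in> topspace (seminorm_topology (maps_supported_in K) (range sup_seminorm))" for f
    using that supported_subset_weighted_maps[OF K] by auto
  fix f :: "real^'n \<Rightarrow> real^'n" and q :: "(real^'n \<Rightarrow> real^'n) \<Rightarrow> real" and e :: real
  assume "f \<in> topspace (seminorm_topology (maps_supported_in K) (range sup_seminorm))"
    and "q \<in> weighted_seminorms monotone_weights" and e: "0 < e"
  then obtain \<phi> js where f: "f \<in> maps_supported_in K" and \<phi>: "\<phi> \<in> monotone_weights" "q = weighted_seminorm \<phi> js"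
    by (auto simp: weighted_seminorms_def)
  obtain R where R: "0 \<le> R" "K \<subseteq> cball 0 R"
    using compact_subset_cball[OF K] .
  have \<phi>R: "0 \<le> \<phi> R" using mw.nonneg[OF \<phi>(1) R(1)] .
  define d where "d = e / (\<phi> R + 1)"
  have d: "0 < d" "\<phi> R * d < e" using e \<phi>R by (simp_all add: d_def field_simps)
  let ?V = "{g \<in> maps_supported_in K. sup_seminorm js (g - f) < d}"
  have "q (g - f) < e" if g: "g \<in> ?V" for g
  proof -
    have gf: "g - f \<in> maps_supported_in K" using g f subspace_diff[OF E] by blast
    then have gw: "g - f \<in> weighted_maps {\<lambda>_. 1}"
      using supported_subset_weighted_maps[OF K] weighted_maps_antimono[of "{\<lambda>_. 1}" monotone_weights] mw.one by blast
    have "norm (partials js (g - f) x) \<le> d" for x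
      using unit_weight.weighted_seminorm_upper[OF gw, of "\<lambda>_. 1" x js] g by (simp add: sup_seminorm_eq)
    then have "q (g - f) \<le> \<phi> R * d"
      unfolding \<phi>(2) by (intro mw.weighted_seminorm_least supported_weighted_bound[OF \<phi>(1) R gf])
    with d(2) show ?thesis by linarith
  qed
  then show "\<exists>V. openin (seminorm_topology (maps_supported_in K) (range sup_seminorm)) V \<and> f \<in> V \<and> (\<forall>y\<in>V. q (id y - id f) < e)"
    using ball_open[OF rangeI f, of js d] f d(1) zero_value[OF rangeI, of js]
    by (intro exI[of _ ?V]) auto
qed

definition test_topologies :: "(real^'n \<Rightarrow> real^'n) topology set" where
  "test_topologies = {T. lctvs T \<and> topspace T = weighted_maps monotone_weights \<and>
     (\<forall>S\<in>test_space_on ` {K. compact K}. continuous_map S T id)}"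

lemma test_space_eq: "(test_space :: (real^'n \<Rightarrow> real^'n) topology) = topology_generated_by (\<Union>{{U. openin T U} | T. T \<in> test_topologies})"
proof -
  have "(\<Union>S\<in>test_space_on ` {K. compact K}. topspace S) = (weighted_maps monotone_weights :: (real^'n \<Rightarrow> real^'n) set)"
    using test_maps_eq by (simp add: test_space_on_eq)
  then show ?thesis
    by (simp add: test_space_def lc_inductive_limit_def test_topologies_def)
qed

lemma weighted_topology_in_test_topologies:
  "seminorm_topology (weighted_maps monotone_weights :: (real^'n \<Rightarrow> real^'n) set) (weighted_seminorms monotone_weights) \<in> test_topologies"
  using seminorms.lctvs_topology[OF mw.seminorms_weighted[where 'n='n]] test_space_on_continuous_weighted[where 'n='n]
  by (simp add: test_topologies_def)

lemma test_space_topologies: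
  shows "lctvs (test_space :: (real^'n \<Rightarrow> real^'n) topology)"
    and "topspace (test_space :: (real^'n \<Rightarrow> real^'n) topology) = weighted_maps monotone_weights"
    and "\<And>T U. T \<in> test_topologies \<Longrightarrow> openin T U \<Longrightarrow> openin (test_space :: (real^'n \<Rightarrow> real^'n) topology) U"
    and "\<And>K. compact K \<Longrightarrow> continuous_map (test_space_on K) (test_space :: (real^'n \<Rightarrow> real^'n) topology) id"
proof -
  have ne: "(test_topologies :: (real^'n \<Rightarrow> real^'n) topology set) \<noteq> {}"
    using weighted_topology_in_test_topologies by blast
  have *: "\<And>T. T \<in> (test_topologies :: (real^'n \<Rightarrow> real^'n) topology set) \<Longrightarrow> lctvs T"
    "\<And>T. T \<in> (test_topologies :: (real^'n \<Rightarrow> real^'n) topology set) \<Longrightarrow> topspace T = weighted_maps monotone_weights"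
    by (simp_all add: test_topologies_def)
  note gen = lctvs_generated[OF ne *, folded test_space_eq]
  show "lctvs (test_space :: (real^'n \<Rightarrow> real^'n) topology)" by (rule gen)
  show "topspace (test_space :: (real^'n \<Rightarrow> real^'n) topology) = weighted_maps monotone_weights" by (rule gen)
  show "openin (test_space :: (real^'n \<Rightarrow> real^'n) topology) U" if "T \<in> test_topologies" "openin T U" for T U
    by (rule gen(2)[OF _ _ that])
  show "continuous_map (test_space_on K) (test_space :: (real^'n \<Rightarrow> real^'n) topology) id" if "compact K" for K
    unfolding test_space_eq
    by (rule continuous_map_generated[OF _ ne]) (use that in \<open>auto simp: test_topologies_def\<close>)
qed

text \<open>Weighted neighbourhoods are open as the weighted topology is one of the competitors. A
  sequence that is null for every weight has a common compact support; there the weight 1 gives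
  convergence, which the continuous inclusion carries to the limit.\<close>

lemma function_space_test:
  "function_space (test_space :: (real^'n \<Rightarrow> real^'n) topology) (weighted_bound ` monotone_weights)"
proof
  let ?T = "test_space :: (real^'n \<Rightarrow> real^'n) topology"
  show "lctvs ?T" by (rule test_space_topologies)
  show "\<forall>N\<in>weighted_bound ` monotone_weights. size_bound N" using mw.size_bound_weighted by blast
  show "topspace ?T = {f. smooth_map f \<and> (\<forall>N\<in>weighted_bound ` monotone_weights. \<forall>js i. \<exists>C. N (\<lambda>x. partials js f x $ i) C)}"
    unfolding test_space_topologies(2) by (rule mw.weighted_maps_components)
  show "\<exists>U. openin ?T U \<and> 0 \<in> U \<and> (\<forall>f\<in>U. N (\<lambda>x. partials js f x $ i) e)"
    if "N \<in> weighted_bound ` monotone_weights" "0 < e" for N js i e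
    using mw.weighted_zero_neighbourhood[OF that, of js i]
      test_space_topologies(3)[OF weighted_topology_in_test_topologies] by blast
  show "\<exists>N\<in>weighted_bound ` monotone_weights. \<exists>J K. controls_sup N J K"
    using mw.controls_sup_weighted mw.one by blast
  show "reparametrizable (weighted_bound ` monotone_weights)" by (rule mw.reparametrizable_weighted)
  fix f :: "nat \<Rightarrow> real^'n \<Rightarrow> real^'n"
  assume fE: "range f \<subseteq> topspace ?T"
    and ev: "\<And>N js i e. N \<in> weighted_bound ` monotone_weights \<Longrightarrow> 0 < e \<Longrightarrow>
      \<forall>\<^sub>F n in sequentially. N (\<lambda>x. partials js (f n) x $ i) e"
  have fW: "f n \<in> weighted_maps monotone_weights" for n
    using fE by (auto simp: test_space_topologies(2))
  have evW: "\<forall>\<^sub>F n in sequentially. weighted_seminorm \<phi> js (f n) < e"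
    if "\<phi> \<in> monotone_weights" "0 < e" for \<phi> js e
    using that ev by (intro mw.eventually_weighted_seminorm) auto
  have "\<exists>R. \<forall>g\<in>range f. \<forall>x. R < norm x \<longrightarrow> g x = 0"
  proof (rule common_support)
    fix \<phi> assume \<phi>: "\<phi> \<in> monotone_weights"
    obtain M where M: "\<And>n. n \<ge> M \<Longrightarrow> weighted_seminorm \<phi> [] (f n) < 1"
      using evW[OF \<phi> zero_less_one, of "[]"] unfolding eventually_sequentially by blast
    \<comment> \<open>The tail of the sequence is bounded by 1, the finitely many first members by
      the sum.\<close>
    have "\<phi> (norm x) * norm (f n x) \<le> 1 + (\<Sum>n<M. \<bar>weighted_seminorm \<phi> [] (f n)\<bar>)" for n x
    proof -
      have "\<phi> (norm x) * norm (f n x) \<le> weighted_seminorm \<phi> [] (f n)"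
        using mw.weighted_seminorm_upper[OF fW \<phi>, of x "[]"] by simp
      moreover have "weighted_seminorm \<phi> [] (f n) \<le> 1 + (\<Sum>n<M. \<bar>weighted_seminorm \<phi> [] (f n)\<bar>)"
      proof (cases "n < M")
        case True
        then have "\<bar>weighted_seminorm \<phi> [] (f n)\<bar> \<le> (\<Sum>n<M. \<bar>weighted_seminorm \<phi> [] (f n)\<bar>)"
          by (intro member_le_sum) auto
        then show ?thesis by linarith
      next
        case False
        have "0 \<le> (\<Sum>n<M. \<bar>weighted_seminorm \<phi> [] (f n)\<bar>)" by (intro sum_nonneg) auto
        then show ?thesis using M[of n] False by linarith
      qed
      ultimately show ?thesis by linarith
    qed
    then show "\<exists>C. \<forall>g\<in>range f. \<forall>x. \<phi> (norm x) * norm (g x) \<le> C" by blast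
  qed
  then obtain R where R: "\<And>n x. R < norm x \<Longrightarrow> f n x = 0" by blast
  have fR: "f n \<in> maps_supported_in (cball 0 R)" for n
    using fW[of n] R by (intro supported_inI) (auto simp: weighted_maps_def)
  have "limitin (test_space_on (cball 0 R)) f 0 sequentially"
    unfolding test_space_on_eq
  proof (rule seminorms.limitin_zero[OF seminorms_supported[OF compact_cball]])
    show "range f \<subseteq> maps_supported_in (cball 0 R)" using fR by blast
    fix q :: "(real^'n \<Rightarrow> real^'n) \<Rightarrow> real" and e :: real assume "q \<in> range sup_seminorm" "0 < e"
    then show "\<forall>\<^sub>F n in sequentially. q (f n) < e"
      using evW[OF mw.one] by (auto simp: sup_seminorm_eq)
  qed
  from continuous_map_limit[OF test_space_topologies(4)[OF compact_cball] this]
  show "limitin ?T f 0 sequentially" by simp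
qed

section \<open>A pointwise Sobolev inequality\<close>

text \<open>By the fundamental theorem \<open>\<bar>u 0\<bar>\<close> is at most
  \<open>\<bar>u s\<bar>\<close> plus the integral of \<open>\<bar>u'\<bar>\<close> over the unit
  interval; this is averaged over \<open>s\<close>.\<close>

lemma abs_le_average:
  fixes u u' :: "real \<Rightarrow> real"
  assumes d: "\<And>s. (u has_real_derivative u' s) (at s)" and c: "continuous_on UNIV u'"
  shows "ennreal \<bar>u 0\<bar> \<le> (\<integral>\<^sup>+s. indicator {0..1} s * (ennreal \<bar>u s\<bar> + ennreal \<bar>u' s\<bar>) \<partial>lborel)"
proof -
  define D where "D = (\<integral>\<^sup>+x. indicator {0..1} x * ennreal \<bar>u' x\<bar> \<partial>lborel)"
  have cu: "continuous_on UNIV u"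
    using d by (meson DERIV_isCont continuous_at_imp_continuous_on)
  have [measurable]: "u \<in> borel_measurable borel" "u' \<in> borel_measurable borel"
    using c cu by (auto intro: borel_measurable_continuous_onI)
  have cu': "isCont u' x" for x using c by (simp add: continuous_on_eq_continuous_at)
  have le: "ennreal \<bar>u 0\<bar> \<le> ennreal \<bar>u s\<bar> + D" if s: "0 \<le> s" "s \<le> 1" for s
  proof -
    have int: "integrable lborel (\<lambda>x. u' x * indicator {0..s} x)"
      by (rule borel_integrable_atLeastAtMost[OF cu'])
    have "(\<integral>x. indicator {0..s} x *\<^sub>R u' x \<partial>lborel) = u s - u 0"
      using s(1) c by (intro integral_FTC_atLeastAtMost)
        (auto simp: has_real_derivative_iff_has_vector_derivative[symmetric]
          intro: has_field_derivative_at_within[OF d] continuous_on_subset)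
    then have eq: "(\<integral>x. u' x * indicator {0..s} x \<partial>lborel) = u s - u 0"
      by (simp add: mult.commute)
    have "ennreal \<bar>u s - u 0\<bar> \<le> (\<integral>\<^sup>+x. norm (u' x * indicator {0..s} x) \<partial>lborel)"
      using integral_norm_bound_ennreal[OF int] by (simp add: eq)
    also have "\<dots> \<le> D"
      unfolding D_def using s by (intro nn_integral_mono) (auto split: split_indicator)
    finally have le: "ennreal \<bar>u s - u 0\<bar> \<le> D" .
    have "ennreal \<bar>u 0\<bar> \<le> ennreal (\<bar>u s\<bar> + \<bar>u s - u 0\<bar>)"
      by (intro ennreal_leI) linarith
    also have "\<dots> = ennreal \<bar>u s\<bar> + ennreal \<bar>u s - u 0\<bar>" by simp
    also have "\<dots> \<le> ennreal \<bar>u s\<bar> + D" using le by (rule add_left_mono)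
    finally show ?thesis .
  qed
  have "ennreal \<bar>u 0\<bar> = (\<integral>\<^sup>+s. indicator {0..1::real} s * ennreal \<bar>u 0\<bar> \<partial>lborel)"
    by (simp add: nn_integral_multc)
  also have "\<dots> \<le> (\<integral>\<^sup>+s. indicator {0..1} s * ennreal \<bar>u s\<bar> + indicator {0..1} s * D \<partial>lborel)"
    using le by (intro nn_integral_mono) (auto split: split_indicator)
  also have "\<dots> = (\<integral>\<^sup>+s. indicator {0..1} s * ennreal \<bar>u s\<bar> \<partial>lborel) + D"
    by (subst nn_integral_add) (simp_all add: nn_integral_multc)
  also have "\<dots> = (\<integral>\<^sup>+s. indicator {0..1} s * (ennreal \<bar>u s\<bar> + ennreal \<bar>u' s\<bar>) \<partial>lborel)"
    unfolding D_def by (subst nn_integral_add[symmetric]) (simp_all add: distrib_left)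
  finally show ?thesis .
qed

text \<open>The mean over the unit cube with corner \<open>x\<close> spanned by \<open>I\<close>,
  written as a product integral so that directions can be added one at a time. Values in
  \<open>ennreal\<close> avoid integrability conditions.\<close>

definition cube_average :: "'a::euclidean_space set \<Rightarrow> ('a \<Rightarrow> ennreal) \<Rightarrow> 'a \<Rightarrow> ennreal" where
  "cube_average I h x = (\<integral>\<^sup>+y. (\<Prod>b\<in>I. indicator {0..1} (y b)) * h (x + (\<Sum>b\<in>I. y b *\<^sub>R b)) \<partial>(\<Pi>\<^sub>M b\<in>I. lborel))"

interpretation lborel_product: product_sigma_finite "\<lambda>_. lborel :: real measure"
  by standard

lemma cube_average_measurable [measurable]:
  fixes h :: "'a::euclidean_space \<Rightarrow> ennreal"
  assumes [measurable]: "h \<in> borel_measurable borel" and I: "finite I"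
  shows "(\<lambda>y. (\<Prod>b\<in>I. indicator {0..1} (y b)) * h (x + (\<Sum>b\<in>I. y b *\<^sub>R b))) \<in> borel_measurable (\<Pi>\<^sub>M b\<in>I. (lborel :: real measure))"
  by measurable

lemma cube_average_insert:
  fixes h :: "'a::euclidean_space \<Rightarrow> ennreal"
  assumes h [measurable]: "h \<in> borel_measurable borel" and I: "finite I" "b \<notin> I"
  shows "cube_average (insert b I) h x = cube_average I (\<lambda>z. \<integral>\<^sup>+s. indicator {0..1} s * h (z + s *\<^sub>R b) \<partial>lborel) x"
proof -
  have "cube_average (insert b I) h x = (\<integral>\<^sup>+y. (\<integral>\<^sup>+s. (\<Prod>c\<in>insert b I. indicator {0..1} ((y(b := s)) c)) *
      h (x + (\<Sum>c\<in>insert b I. (y(b := s)) c *\<^sub>R c)) \<partial>lborel) \<partial>(\<Pi>\<^sub>M b\<in>I. lborel))"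
    unfolding cube_average_def
    by (rule lborel_product.product_nn_integral_insert[OF I]) (rule cube_average_measurable, use I in auto)
  also have "\<dots> = (\<integral>\<^sup>+y. (\<Prod>c\<in>I. indicator {0..1} (y c)) *
      (\<integral>\<^sup>+s. indicator {0..1} s * h (x + (\<Sum>c\<in>I. y c *\<^sub>R c) + s *\<^sub>R b) \<partial>lborel) \<partial>(\<Pi>\<^sub>M b\<in>I. lborel))"
  proof (rule nn_integral_cong)
    fix y :: "'a \<Rightarrow> real"
    have "(\<Prod>c\<in>insert b I. indicator {0..1} ((y(b := s)) c)) * h (x + (\<Sum>c\<in>insert b I. (y(b := s)) c *\<^sub>R c))
        = (\<Prod>c\<in>I. indicator {0..1} (y c)) * (indicator {0..1} s * h (x + (\<Sum>c\<in>I. y c *\<^sub>R c) + s *\<^sub>R b))" for s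
    proof -
      have p: "(\<Prod>c\<in>I. indicator {0..1} ((y(b := s)) c) :: ennreal) = (\<Prod>c\<in>I. indicator {0..1} (y c))"
        using I by (intro prod.cong) auto
      have q: "(\<Sum>c\<in>I. (y(b := s)) c *\<^sub>R c) = (\<Sum>c\<in>I. y c *\<^sub>R c)"
        using I by (intro sum.cong) auto
      show ?thesis
        unfolding prod.insert[OF I] sum.insert[OF I] p q by (simp add: ac_simps)
    qed
    then show "(\<integral>\<^sup>+s. (\<Prod>c\<in>insert b I. indicator {0..1} ((y(b := s)) c)) *
        h (x + (\<Sum>c\<in>insert b I. (y(b := s)) c *\<^sub>R c)) \<partial>lborel) =
        (\<Prod>c\<in>I. indicator {0..1} (y c)) *
        (\<integral>\<^sup>+s. indicator {0..1} s * h (x + (\<Sum>c\<in>I. y c *\<^sub>R c) + s *\<^sub>R b) \<partial>lborel)"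
      by (simp add: nn_integral_cmult)
  qed
  finally show ?thesis by (simp add: cube_average_def)
qed

lemma cube_average_mono: "(\<And>z. g z \<le> h z) \<Longrightarrow> cube_average I g x \<le> cube_average I h x"
  unfolding cube_average_def by (intro nn_integral_mono mult_left_mono) auto

lemma cube_average_add:
  fixes g h :: "'a::euclidean_space \<Rightarrow> ennreal"
  assumes "g \<in> borel_measurable borel" "h \<in> borel_measurable borel" "finite I"
  shows "cube_average I (\<lambda>z. g z + h z) x = cube_average I g x + cube_average I h x"
  unfolding cube_average_def distrib_left
  by (intro nn_integral_add cube_average_measurable assms)

text \<open>\<open>abs_le_average\<close> along \<open>b\<close> under the integral sign: one more
  averaged direction costs one derivative in it.\<close>

lemma cube_average_step:
  fixes u v :: "'a::euclidean_space \<Rightarrow> real"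
  assumes u: "continuous_on UNIV u" and v: "continuous_on UNIV v"
    and d: "\<And>z s. ((\<lambda>s. u (z + s *\<^sub>R b)) has_real_derivative v (z + s *\<^sub>R b)) (at s)"
    and I: "finite I" "b \<notin> I"
  shows "cube_average I (\<lambda>z. ennreal \<bar>u z\<bar>) x \<le>
    cube_average (insert b I) (\<lambda>z. ennreal \<bar>u z\<bar>) x + cube_average (insert b I) (\<lambda>z. ennreal \<bar>v z\<bar>) x"
proof -
  have [measurable]: "u \<in> borel_measurable borel" "v \<in> borel_measurable borel"
    using u v by (auto intro: borel_measurable_continuous_onI)
  have "cube_average I (\<lambda>z. ennreal \<bar>u z\<bar>) x \<le>
      cube_average I (\<lambda>z. \<integral>\<^sup>+s. indicator {0..1} s * (ennreal \<bar>u (z + s *\<^sub>R b)\<bar> + ennreal \<bar>v (z + s *\<^sub>R b)\<bar>) \<partial>lborel) x"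
  proof (rule cube_average_mono)
    fix z
    have "continuous_on UNIV (\<lambda>s. v (z + s *\<^sub>R b))"
      by (rule continuous_on_compose2[OF v]) (auto intro!: continuous_intros)
    from abs_le_average[OF d this]
    show "ennreal \<bar>u z\<bar> \<le> (\<integral>\<^sup>+s. indicator {0..1} s * (ennreal \<bar>u (z + s *\<^sub>R b)\<bar> + ennreal \<bar>v (z + s *\<^sub>R b)\<bar>) \<partial>lborel)"
      by simp
  qed
  also have "\<dots> = cube_average (insert b I) (\<lambda>z. ennreal \<bar>u z\<bar> + ennreal \<bar>v z\<bar>) x"
    by (rule cube_average_insert[symmetric, OF _ I]) measurable
  also have "\<dots> = cube_average (insert b I) (\<lambda>z. ennreal \<bar>u z\<bar>) x + cube_average (insert b I) (\<lambda>z. ennreal \<bar>v z\<bar>) x"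
    using I by (intro cube_average_add) auto
  finally show ?thesis .
qed

lemma cube_average_Basis:
  fixes h :: "'a::euclidean_space \<Rightarrow> ennreal"
  assumes [measurable]: "h \<in> borel_measurable borel"
  shows "cube_average Basis h x = (\<integral>\<^sup>+z. indicator (cbox 0 One) z * h (x + z) \<partial>lborel)"
proof -
  have "(\<integral>\<^sup>+z. indicator (cbox 0 One) z * h (x + z) \<partial>lborel) =
      (\<integral>\<^sup>+y. indicator (cbox 0 One) (\<Sum>b\<in>Basis. y b *\<^sub>R b) * h (x + (\<Sum>b\<in>Basis. y b *\<^sub>R b)) \<partial>(\<Pi>\<^sub>M b\<in>Basis. lborel))"
  proof -
    have m: "(\<lambda>f. \<Sum>b\<in>Basis. f b *\<^sub>R b) \<in> measurable (\<Pi>\<^sub>M b\<in>Basis. lborel) (borel :: 'a measure)"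
      by measurable
    have "(\<lambda>z. indicator (cbox 0 One) z * h (x + z)) \<in> borel_measurable borel"
      by measurable
    then show ?thesis
      by (subst lborel_eq, subst nn_integral_distr[OF m]) simp_all
  qed
  also have "\<dots> = cube_average Basis h x"
    unfolding cube_average_def
  proof (rule nn_integral_cong)
    fix y :: "'a \<Rightarrow> real"
    have "indicator (cbox 0 One) (\<Sum>b\<in>Basis. y b *\<^sub>R b) = (\<Prod>b\<in>(Basis :: 'a set). indicator {0..1} (y b) :: ennreal)"
      by (auto simp: indicator_def mem_box inner_sum_left_Basis)
    then show "indicator (cbox 0 One) (\<Sum>b\<in>Basis. y b *\<^sub>R b) * h (x + (\<Sum>b\<in>Basis. y b *\<^sub>R b)) =
        (\<Prod>b\<in>Basis. indicator {0..1} (y b)) * h (x + (\<Sum>b\<in>Basis. y b *\<^sub>R b))" by simp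
  qed
  finally show ?thesis by simp
qed

lemma smooth_map_DERIV_line:
  fixes f :: "real^'n \<Rightarrow> real^'n"
  assumes f: "smooth_map f"
  shows "((\<lambda>s. partials js f (z + s *\<^sub>R axis k 1) $ i) has_real_derivative partials (k # js) f (z + s *\<^sub>R axis k 1) $ i) (at s)"
proof -
  have hd: "((\<lambda>x. partials js f x $ i) has_derivative (\<lambda>h. (\<Sum>l\<in>UNIV. h $ l *\<^sub>R partials (l # js) f x) $ i)) (at x)" for x
    by (rule bounded_linear.has_derivative[OF bounded_linear_vec_nth smooth_map_has_derivative[OF f]])
  have "dd (axis k 1) (\<lambda>x. partials js f x $ i) x = partials (k # js) f x $ i" for x
    unfolding dd_eqI[OF hd] by (simp add: axis_def if_distrib[of "\<lambda>x. x * _"] cong: if_cong)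
  then show ?thesis
    using DERIV_line[of "\<lambda>x. partials js f x $ i" z "axis k 1" s] hd
    unfolding differentiable_def by auto
qed

text \<open>Each direction is averaged once, and every term then acquires a companion differentiated
  in that direction. The derivatives that arise are those along \<open>subseqs ks\<close>, in which
  no direction repeats.\<close>

lemma Sobolev_iterated:
  fixes f :: "real^'n \<Rightarrow> real^'n"
  assumes f: "smooth_map f" and ks: "distinct ks"
  shows "ennreal \<bar>f x $ i\<bar> \<le> (\<Sum>ss\<leftarrow>subseqs ks. cube_average ((\<lambda>k. axis k 1) ` set ks) (\<lambda>z. ennreal \<bar>partials ss f z $ i\<bar>) x)"
  using ks
proof (induction ks)
  case Nil
  \<comment> \<open>Over the empty index set the product measure is a point mass, so the average is
    the value at \<open>x\<close>.\<close>
  then show ?case by (simp add: cube_average_def PiM_empty nn_integral_count_space_finite)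
next
  case (Cons k ks)
  let ?I = "(\<lambda>k. axis k 1 :: real^'n) ` set ks"
  have k: "axis k 1 \<notin> ?I" using Cons.prems by (auto simp: axis_eq_axis)
  have "ennreal \<bar>f x $ i\<bar> \<le> (\<Sum>ss\<leftarrow>subseqs ks. cube_average ?I (\<lambda>z. ennreal \<bar>partials ss f z $ i\<bar>) x)"
    using Cons by simp
  also have "\<dots> \<le> (\<Sum>ss\<leftarrow>subseqs ks. cube_average (insert (axis k 1) ?I) (\<lambda>z. ennreal \<bar>partials ss f z $ i\<bar>) x
      + cube_average (insert (axis k 1) ?I) (\<lambda>z. ennreal \<bar>partials (k # ss) f z $ i\<bar>) x)"
    by (intro sum_list_mono cube_average_step smooth_map_continuous_component f smooth_map_DERIV_line k) auto
  also have "\<dots> = (\<Sum>ss\<leftarrow>subseqs (k # ks). cube_average (insert (axis k 1) ?I) (\<lambda>z. ennreal \<bar>partials ss f z $ i\<bar>) x)"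
    by (simp add: Let_def sum_list_addf o_def add.commute)
  finally show ?case by simp
qed

text \<open>The root is left out, so that terms can be added and integrated over \<open>x\<close>
  directly.\<close>

definition cube_Lp :: "real \<Rightarrow> ('a::euclidean_space \<Rightarrow> real) \<Rightarrow> 'a \<Rightarrow> ennreal" where
  "cube_Lp p g x = (\<integral>\<^sup>+z. indicator (cbox 0 One) z * ennreal (\<bar>g (x + z)\<bar> powr p) \<partial>lborel)"

text \<open>A linearised Hoelder inequality, with a parameter left to be optimised after integration
  over the unit cube. Above \<open>\<tau>\<close> it rests on
  \<open>a powr (1 - p) \<le> \<tau> powr (1 - p)\<close>.\<close>

lemma le_Young:
  fixes a \<tau> p :: real
  assumes "0 \<le> a" "0 < \<tau>" "1 \<le> p"
  shows "a \<le> \<tau> + \<tau> powr (1 - p) * a powr p"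
proof (cases "a \<le> \<tau>")
  case False
  then have "a = a powr (1 - p) * a powr p" using assms by (simp add: powr_add[symmetric])
  also have "\<dots> \<le> \<tau> powr (1 - p) * a powr p"
    using False assms by (intro mult_right_mono powr_mono2') auto
  finally show ?thesis using assms by linarith
qed (use assms in \<open>simp add: add_increasing2\<close>)

lemma cube_average_le_Lp:
  fixes g :: "'a::euclidean_space \<Rightarrow> real"
  assumes g: "continuous_on UNIV g" and p: "1 \<le> p" and \<tau>: "0 < \<tau>"
  shows "cube_average Basis (\<lambda>z. ennreal \<bar>g z\<bar>) x \<le> ennreal \<tau> + ennreal (\<tau> powr (1 - p)) * cube_Lp p g x"
proof -
  have [measurable]: "g \<in> borel_measurable borel" using g by (rule borel_measurable_continuous_onI)
  have "cube_average Basis (\<lambda>z. ennreal \<bar>g z\<bar>) x = (\<integral>\<^sup>+z. indicator (cbox 0 One) z * ennreal \<bar>g (x + z)\<bar> \<partial>lborel)"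
    by (rule cube_average_Basis) measurable
  also have "\<dots> \<le> (\<integral>\<^sup>+z. indicator (cbox 0 One) z * ennreal \<tau> +
      ennreal (\<tau> powr (1 - p)) * (indicator (cbox 0 One) z * ennreal (\<bar>g (x + z)\<bar> powr p)) \<partial>lborel)"
  proof (rule nn_integral_mono)
    fix z :: 'a
    have "ennreal \<bar>g (x + z)\<bar> \<le> ennreal (\<tau> + \<tau> powr (1 - p) * \<bar>g (x + z)\<bar> powr p)"
      by (intro ennreal_leI le_Young) (use p \<tau> in auto)
    then show "indicator (cbox 0 One) z * ennreal \<bar>g (x + z)\<bar> \<le> indicator (cbox 0 One) z * ennreal \<tau> +
        ennreal (\<tau> powr (1 - p)) * (indicator (cbox 0 One) z * ennreal (\<bar>g (x + z)\<bar> powr p))"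
      using \<tau> by (auto split: split_indicator simp: ennreal_mult)
  qed
  also have "\<dots> = ennreal \<tau> + ennreal (\<tau> powr (1 - p)) * cube_Lp p g x"
    unfolding cube_Lp_def
    by (subst nn_integral_add) (simp_all add: nn_integral_cmult nn_integral_multc)
  finally show ?thesis .
qed

text \<open>The choice \<open>\<tau> = \<sigma> powr (1 / p)\<close> makes the second term equal to
  \<open>\<tau>\<close>. For \<open>\<sigma> = 0\<close> small values of \<open>\<tau>\<close> force
  \<open>a = 0\<close>.\<close>

lemma powr_le_of_Young:
  fixes a m \<sigma> p :: real
  assumes a: "0 \<le> a" and m: "0 \<le> m" and \<sigma>: "0 \<le> \<sigma>" and p: "1 \<le> p"
    and le: "\<And>\<tau>. 0 < \<tau> \<Longrightarrow> a \<le> m * \<tau> + \<tau> powr (1 - p) * \<sigma>"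
  shows "a powr p \<le> (m + 1) powr p * \<sigma>"
proof (cases "\<sigma> = 0")
  case True
  have "a \<le> 0"
  proof (rule field_le_epsilon)
    fix e :: real assume e: "0 < e"
    have "a \<le> m * (e / (m + 1))" using le[of "e / (m + 1)"] e m True by simp
    also have "\<dots> \<le> e" using e m by (simp add: field_simps)
    finally show "a \<le> 0 + e" by simp
  qed
  then show ?thesis using a True by simp
next
  case False
  define \<tau> where "\<tau> = \<sigma> powr (1 / p)"
  have \<tau>: "0 < \<tau>" using False \<sigma> by (simp add: \<tau>_def)
  have "\<tau> powr (1 - p) * \<sigma> = \<sigma> powr ((1 / p) * (1 - p) + 1)"
    using False \<sigma> by (simp add: \<tau>_def powr_powr powr_add)
  also have "(1 / p) * (1 - p) + 1 = 1 / p" using p by (simp add: field_simps)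
  finally have "a \<le> (m + 1) * \<tau>" using le[OF \<tau>] by (simp add: \<tau>_def[symmetric] algebra_simps)
  then have "a powr p \<le> ((m + 1) * \<tau>) powr p" using a p by (intro powr_mono2) auto
  also have "\<dots> = (m + 1) powr p * \<sigma>"
    using m \<tau> p \<sigma> False by (simp add: powr_mult \<tau>_def powr_powr)
  finally show ?thesis .
qed

text \<open>The iterated averages are passed through \<open>le_Young\<close> with one common
  parameter, which is then optimised; \<open>m\<close> counts the mixed derivatives.\<close>

lemma Sobolev_pointwise:
  assumes p: "1 \<le> p"
  shows "\<exists>(L :: 'n::finite list list) M. 0 \<le> M \<and> (\<forall>(f :: real^'n \<Rightarrow> real^'n) x i. smooth_map f \<longrightarrow>
       ennreal (\<bar>f x $ i\<bar> powr p) \<le> ennreal M * (\<Sum>ss\<leftarrow>L. cube_Lp p (\<lambda>z. partials ss f z $ i) x))"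
proof -
  obtain ks :: "'n list" where ks: "set ks = UNIV" "distinct ks"
    using finite_distinct_list[OF finite[of "UNIV :: 'n set"]] by blast
  have B: "(\<lambda>k. axis k 1 :: real^'n) ` set ks = Basis"
    unfolding ks(1) by (auto simp: Basis_vec_def)
  define L where "L = subseqs ks"
  define m where "m = real (length L)"
  show ?thesis
  proof (intro exI[of _ L] exI[of _ "(m + 1) powr p"] conjI allI impI)
    fix f :: "real^'n \<Rightarrow> real^'n" and x i assume f: "smooth_map f"
    define S where "S = (\<Sum>ss\<leftarrow>L. cube_Lp p (\<lambda>z. partials ss f z $ i) x)"
    have le: "ennreal \<bar>f x $ i\<bar> \<le> ennreal (m * \<tau>) + ennreal (\<tau> powr (1 - p)) * S" if \<tau>: "0 < \<tau>" for \<tau>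
    proof -
      have "ennreal \<bar>f x $ i\<bar> \<le> (\<Sum>ss\<leftarrow>L. cube_average Basis (\<lambda>z. ennreal \<bar>partials ss f z $ i\<bar>) x)"
        using Sobolev_iterated[OF f ks(2), of x i] unfolding B L_def .
      also have "\<dots> \<le> (\<Sum>ss\<leftarrow>L. ennreal \<tau> + ennreal (\<tau> powr (1 - p)) * cube_Lp p (\<lambda>z. partials ss f z $ i) x)"
        by (intro sum_list_mono cube_average_le_Lp smooth_map_continuous_component f p \<tau>)
      also have "\<dots> = ennreal (m * \<tau>) + ennreal (\<tau> powr (1 - p)) * S"
        using \<tau> by (simp add: sum_list_addf sum_list_const_mult S_def m_def sum_list_triv ennreal_mult ennreal_of_nat_eq_real_of_nat)
      finally show ?thesis .
    qed
    have pos: "0 < (m + 1) powr p" by (simp add: m_def add_nonneg_pos)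
    show "ennreal (\<bar>f x $ i\<bar> powr p) \<le> ennreal ((m + 1) powr p) * (\<Sum>ss\<leftarrow>L. cube_Lp p (\<lambda>z. partials ss f z $ i) x)"
      unfolding S_def[symmetric]
    \<comment> \<open>An infinite \<open>S\<close> makes the right side infinite, as its factor is
      positive.\<close>
    proof (cases S)
      case (real \<sigma>)
      have "\<bar>f x $ i\<bar> powr p \<le> (m + 1) powr p * \<sigma>"
      proof (rule powr_le_of_Young[OF abs_ge_zero _ real(1) p])
        show "0 \<le> m" by (simp add: m_def)
        fix \<tau> :: real assume \<tau>: "0 < \<tau>"
        have "ennreal \<bar>f x $ i\<bar> \<le> ennreal (m * \<tau> + \<tau> powr (1 - p) * \<sigma>)"
          using le[OF \<tau>] real \<tau> by (simp add: ennreal_mult m_def)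
        then show "\<bar>f x $ i\<bar> \<le> m * \<tau> + \<tau> powr (1 - p) * \<sigma>"
          using \<tau> real(1) by (subst (asm) ennreal_le_iff) (auto simp: m_def)
      qed
      then show "ennreal (\<bar>f x $ i\<bar> powr p) \<le> ennreal ((m + 1) powr p) * S"
        using real by (simp add: ennreal_mult[symmetric] ennreal_leI)
    next
      case top
      then show "ennreal (\<bar>f x $ i\<bar> powr p) \<le> ennreal ((m + 1) powr p) * S"
        using pos by (simp add: ennreal_mult_top)
    qed
  qed simp
qed

section \<open>Lebesgue norms as size bounds\<close>

text \<open>Vanishing arguments are treated apart: there the claim reduces to
  \<open>c powr p \<le> c\<close> for \<open>c\<close> between 0 and 1.\<close>

lemma powr_convex_nonneg:
  fixes x y :: real
  assumes "0 \<le> x" "0 \<le> y" "0 \<le> u" "u \<le> 1" "1 \<le> p"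
  shows "((1 - u) * x + u * y) powr p \<le> (1 - u) * x powr p + u * y powr p"
proof -
  have le: "c powr p \<le> c" if "0 \<le> c" "c \<le> 1" for c :: real
    using powr_mono'[OF assms(5) that] that by simp
  consider "x = 0" | "y = 0" | "0 < x" "0 < y" using assms by linarith
  then show ?thesis
  proof cases
    case 1
    then show ?thesis using assms le[of u] by (simp add: powr_mult mult_right_mono)
  next
    case 2
    then show ?thesis using assms le[of "1 - u"] by (simp add: powr_mult mult_right_mono)
  next
    case 3
    then show ?thesis
      using convex_onD[OF powr_convex[OF assms(5)], of u x y] assms by simp
  qed
qed

definition Lp_bound :: "real \<Rightarrow> (real^'n \<Rightarrow> real) \<Rightarrow> real \<Rightarrow> bool" where
  "Lp_bound p f C \<longleftrightarrow> 0 \<le> C \<and> (\<integral>\<^sup>+x. ennreal (\<bar>f x\<bar> powr p) \<partial>lborel) \<le> ennreal (C powr p)"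

text \<open>Minkowski's inequality by convexity: f + g is C + D times the convex combination of f /
  C and g / D with weights \<open>1 - u\<close> and \<open>u\<close>, and both quotients have norm
  at most 1.\<close>

lemma Lp_bound_triangle_pos:
  fixes f g :: "real^'n \<Rightarrow> real"
  assumes p: "1 \<le> p" and c: "continuous_on UNIV f" "continuous_on UNIV g"
    and f: "Lp_bound p f C" and g: "Lp_bound p g D" and pos: "0 < C" "0 < D"
  shows "Lp_bound p (\<lambda>x. f x + g x) (C + D)"
proof -
  have [measurable]: "f \<in> borel_measurable borel" "g \<in> borel_measurable borel"
    using c by (auto intro: borel_measurable_continuous_onI)
  define u where "u = D / (C + D)"
  have u: "0 \<le> u" "u \<le> 1" "(C + D) * (1 - u) = C" "(C + D) * u = D"
    using pos by (auto simp: u_def field_simps)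
  define s where "s = (C + D) powr p"
  have s: "0 \<le> s" by (simp add: s_def)
  have pt: "\<bar>f x + g x\<bar> powr p \<le> s * ((1 - u) * (1 / C powr p)) * \<bar>f x\<bar> powr p + s * (u * (1 / D powr p)) * \<bar>g x\<bar> powr p" for x
  proof -
    have "\<bar>f x + g x\<bar> \<le> (C + D) * ((1 - u) * (\<bar>f x\<bar> / C) + u * (\<bar>g x\<bar> / D))"
    proof -
      have "(C + D) * ((1 - u) * (\<bar>f x\<bar> / C) + u * (\<bar>g x\<bar> / D)) = ((C + D) * (1 - u)) * (\<bar>f x\<bar> / C) + ((C + D) * u) * (\<bar>g x\<bar> / D)"
        by (simp only: distrib_left mult.assoc)
      also have "\<dots> = \<bar>f x\<bar> + \<bar>g x\<bar>" unfolding u using pos by simp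
      finally show ?thesis by simp
    qed
    then have "\<bar>f x + g x\<bar> powr p \<le> ((C + D) * ((1 - u) * (\<bar>f x\<bar> / C) + u * (\<bar>g x\<bar> / D))) powr p"
      using p by (intro powr_mono2) auto
    also have "\<dots> = s * ((1 - u) * (\<bar>f x\<bar> / C) + u * (\<bar>g x\<bar> / D)) powr p"
      using pos u by (simp add: powr_mult s_def)
    also have "\<dots> \<le> s * ((1 - u) * (\<bar>f x\<bar> / C) powr p + u * (\<bar>g x\<bar> / D) powr p)"
      using pos u p s by (intro mult_left_mono powr_convex_nonneg) auto
    also have "\<dots> = s * ((1 - u) * (1 / C powr p)) * \<bar>f x\<bar> powr p + s * (u * (1 / D powr p)) * \<bar>g x\<bar> powr p"
      using pos by (simp add: powr_divide algebra_simps)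
    finally show ?thesis .
  qed
  have "(\<integral>\<^sup>+x. ennreal (\<bar>f x + g x\<bar> powr p) \<partial>lborel) \<le>
      (\<integral>\<^sup>+x. ennreal (s * ((1 - u) * (1 / C powr p))) * ennreal (\<bar>f x\<bar> powr p) +
        ennreal (s * (u * (1 / D powr p))) * ennreal (\<bar>g x\<bar> powr p) \<partial>lborel)"
  proof (rule nn_integral_mono)
    fix x
    show "ennreal (\<bar>f x + g x\<bar> powr p) \<le> ennreal (s * ((1 - u) * (1 / C powr p))) * ennreal (\<bar>f x\<bar> powr p) +
        ennreal (s * (u * (1 / D powr p))) * ennreal (\<bar>g x\<bar> powr p)"
    proof -
      have nn: "0 \<le> s * ((1 - u) * (1 / C powr p))" "0 \<le> s * (u * (1 / D powr p))"
        using s u by auto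
      have "ennreal (\<bar>f x + g x\<bar> powr p) \<le> ennreal (s * ((1 - u) * (1 / C powr p)) * \<bar>f x\<bar> powr p + s * (u * (1 / D powr p)) * \<bar>g x\<bar> powr p)"
        by (rule ennreal_leI[OF pt])
      also have "\<dots> = ennreal (s * ((1 - u) * (1 / C powr p)) * \<bar>f x\<bar> powr p) + ennreal (s * (u * (1 / D powr p)) * \<bar>g x\<bar> powr p)"
        by (rule ennreal_plus) (intro mult_nonneg_nonneg[OF nn(1)] mult_nonneg_nonneg[OF nn(2)] powr_ge_zero)+
      finally show ?thesis
        by (simp only: ennreal_mult[OF nn(1) powr_ge_zero] ennreal_mult[OF nn(2) powr_ge_zero])
    qed
  qed
  also have "\<dots> = ennreal (s * ((1 - u) * (1 / C powr p))) * (\<integral>\<^sup>+x. ennreal (\<bar>f x\<bar> powr p) \<partial>lborel) +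
      ennreal (s * (u * (1 / D powr p))) * (\<integral>\<^sup>+x. ennreal (\<bar>g x\<bar> powr p) \<partial>lborel)"
    by (subst nn_integral_add) (simp_all add: nn_integral_cmult)
  also have "\<dots> \<le> ennreal (s * ((1 - u) * (1 / C powr p))) * ennreal (C powr p) +
      ennreal (s * (u * (1 / D powr p))) * ennreal (D powr p)"
    using f g by (intro add_mono mult_left_mono) (auto simp: Lp_bound_def)
  also have "\<dots> = ennreal (s * (1 - u)) + ennreal (s * u)"
    using pos s u by (simp add: ennreal_mult[symmetric])
  also have "\<dots> = ennreal s"
  proof -
    have "s * (1 - u) + s * u = s" by (simp add: algebra_simps)
    then show ?thesis using s u by (subst ennreal_plus[symmetric]) simp_all
  qed
  finally show ?thesis using pos by (simp add: Lp_bound_def s_def)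
qed

text \<open>Extends the triangle inequality to vanishing bounds: each is enlarged by
  \<open>e / 2\<close>, and \<open>e\<close> tends to 0.\<close>

lemma Lp_bound_limit:
  assumes p: "1 \<le> p" and C: "0 \<le> C" and le: "\<And>e. 0 < e \<Longrightarrow> Lp_bound p f (C + e)"
  shows "Lp_bound p f C"
proof -
  have "(\<lambda>n. (C + 1 / real (Suc n)) powr p) \<longlonglongrightarrow> (C + 0) powr p"
    using p C by (intro tendsto_powr' tendsto_add tendsto_const LIMSEQ_Suc[OF lim_1_over_n]) auto
  then have "(\<lambda>n. ennreal ((C + 1 / real (Suc n)) powr p)) \<longlonglongrightarrow> ennreal (C powr p)"
    by (simp add: tendsto_ennrealI)
  then have "(\<integral>\<^sup>+x. ennreal (\<bar>f x\<bar> powr p) \<partial>lborel) \<le> ennreal (C powr p)"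
    by (rule tendsto_lowerbound) (use le in \<open>auto simp: Lp_bound_def\<close>)
  with C show ?thesis by (simp add: Lp_bound_def)
qed

lemma Lp_bound_weaken:
  assumes "1 \<le> p" "Lp_bound p f C" "C \<le> D"
  shows "Lp_bound p f D"
proof -
  have "ennreal (C powr p) \<le> ennreal (D powr p)"
    using assms by (intro ennreal_leI powr_mono2) (auto simp: Lp_bound_def)
  then show ?thesis
    using assms order_trans unfolding Lp_bound_def by fastforce
qed

lemma size_bound_Lp:
  assumes p: "1 \<le> p"
  shows "size_bound (Lp_bound p :: (real^'n \<Rightarrow> real) \<Rightarrow> _)"
proof
  fix f g :: "real^'n \<Rightarrow> real" and c C D :: real
  show "0 \<le> C" if "Lp_bound p f C" using that by (simp add: Lp_bound_def)
  show "Lp_bound p (\<lambda>x::real^'n. 0) 0" using p by (simp add: Lp_bound_def)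
  show "Lp_bound p f D" if "Lp_bound p f C" "C \<le> D" using Lp_bound_weaken[OF p that] .
  show "Lp_bound p f (c * C)" if "continuous_on UNIV g" "Lp_bound p g C" "0 \<le> c" "\<And>x. \<bar>f x\<bar> \<le> c * \<bar>g x\<bar>"
  proof -
    have [measurable]: "g \<in> borel_measurable borel"
      using that(1) by (rule borel_measurable_continuous_onI)
    have C: "0 \<le> C" using that(2) by (simp add: Lp_bound_def)
    have "(\<integral>\<^sup>+x. ennreal (\<bar>f x\<bar> powr p) \<partial>lborel) \<le> (\<integral>\<^sup>+x. ennreal (c powr p) * ennreal (\<bar>g x\<bar> powr p) \<partial>lborel)"
    proof (rule nn_integral_mono)
      fix x
      have "\<bar>f x\<bar> powr p \<le> (c * \<bar>g x\<bar>) powr p" using that(4) p by (intro powr_mono2) auto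
      also have "\<dots> = c powr p * \<bar>g x\<bar> powr p" using that(3) by (simp add: powr_mult)
      finally show "ennreal (\<bar>f x\<bar> powr p) \<le> ennreal (c powr p) * ennreal (\<bar>g x\<bar> powr p)"
        by (simp add: ennreal_mult[symmetric] ennreal_leI)
    qed
    also have "\<dots> = ennreal (c powr p) * (\<integral>\<^sup>+x. ennreal (\<bar>g x\<bar> powr p) \<partial>lborel)"
      by (simp add: nn_integral_cmult)
    also have "\<dots> \<le> ennreal (c powr p) * ennreal (C powr p)"
      using that(2) by (intro mult_left_mono) (auto simp: Lp_bound_def)
    also have "\<dots> = ennreal ((c * C) powr p)"
      using that(3) C by (simp add: ennreal_mult[symmetric] powr_mult)
    finally show ?thesis using that(3) C by (simp add: Lp_bound_def)
  qed
  show "Lp_bound p (\<lambda>x. f x + g x) (C + D)"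
    if c: "continuous_on UNIV f" "continuous_on UNIV g" and fg: "Lp_bound p f C" "Lp_bound p g D"
  proof (rule Lp_bound_limit[OF p])
    have nn: "0 \<le> C" "0 \<le> D" using fg by (auto simp: Lp_bound_def)
    then show "0 \<le> C + D" by simp
    fix e :: real assume e: "0 < e"
    have "Lp_bound p (\<lambda>x. f x + g x) ((C + e / 2) + (D + e / 2))"
      using e nn by (intro Lp_bound_triangle_pos p c Lp_bound_weaken[OF p fg(1)] Lp_bound_weaken[OF p fg(2)]) auto
    then show "Lp_bound p (\<lambda>x. f x + g x) (C + D + e)" by (simp add: algebra_simps)
  qed
  show "Lp_bound p f C" if F: "\<And>n. continuous_on UNIV (F n)" and lim: "\<And>x. (\<lambda>n. F n x) \<longlonglongrightarrow> f x"
    and le: "\<And>n. Lp_bound p (F n) C" for F :: "nat \<Rightarrow> real^'n \<Rightarrow> real"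
  proof -
    have [measurable]: "F n \<in> borel_measurable borel" for n
      using F by (rule borel_measurable_continuous_onI)
    have "(\<lambda>n. ennreal (\<bar>F n x\<bar> powr p)) \<longlonglongrightarrow> ennreal (\<bar>f x\<bar> powr p)" for x
      using p by (intro tendsto_ennrealI tendsto_powr' tendsto_rabs lim tendsto_const) auto
    then have "(\<integral>\<^sup>+x. ennreal (\<bar>f x\<bar> powr p) \<partial>lborel) = (\<integral>\<^sup>+x. liminf (\<lambda>n. ennreal (\<bar>F n x\<bar> powr p)) \<partial>lborel)"
      by (intro nn_integral_cong lim_imp_Liminf[symmetric] sequentially_bot)
    also have "\<dots> \<le> liminf (\<lambda>n. \<integral>\<^sup>+x. ennreal (\<bar>F n x\<bar> powr p) \<partial>lborel)"
      by (intro nn_integral_liminf) measurable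
    also have "\<dots> \<le> ennreal (C powr p)"
      using le by (intro Liminf_le) (auto simp: Lp_bound_def)
    finally show ?thesis using le[of 0] by (simp add: Lp_bound_def)
  qed
qed

lemma cube_Lp_le:
  fixes g :: "real^'n \<Rightarrow> real"
  assumes c: "continuous_on UNIV g" and g: "Lp_bound p g C"
  shows "cube_Lp p g x \<le> ennreal (C powr p)"
proof -
  have [measurable]: "g \<in> borel_measurable borel" using c by (rule borel_measurable_continuous_onI)
  have "cube_Lp p g x \<le> (\<integral>\<^sup>+z. ennreal (\<bar>g (x + z)\<bar> powr p) \<partial>lborel)"
    unfolding cube_Lp_def by (intro nn_integral_mono) (auto split: split_indicator)
  also have "\<dots> = (\<integral>\<^sup>+z. ennreal (\<bar>g z\<bar> powr p) \<partial>distr lborel borel ((+) x))"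
    by (subst nn_integral_distr) simp_all
  also have "\<dots> \<le> ennreal (C powr p)"
    using g by (simp add: lborel_distr_plus Lp_bound_def)
  finally show ?thesis .
qed

lemma sum_list_ennreal_le:
  "(\<And>s. s \<in> set L \<Longrightarrow> h s \<le> ennreal c) \<Longrightarrow> 0 \<le> c \<Longrightarrow> (\<Sum>s\<leftarrow>L. h s) \<le> ennreal (real (length L) * c)"
proof (induction L)
  case (Cons s L)
  have "(\<Sum>s\<leftarrow>s # L. h s) \<le> ennreal c + ennreal (real (length L) * c)"
    using Cons by (auto intro!: add_mono)
  also have "\<dots> = ennreal (real (length (s # L)) * c)"
    using Cons.prems(2) by (simp add: ennreal_plus[symmetric] algebra_simps del: ennreal_plus)
  finally show ?case .
qed simp

text \<open>Every cube integral is at most the integral over the whole space, so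
  \<open>Sobolev_pointwise\<close> yields a uniform bound.\<close>

lemma controls_sup_Lp:
  assumes p: "1 \<le> p"
  shows "\<exists>J K. controls_sup (Lp_bound p :: (real^'n \<Rightarrow> real) \<Rightarrow> _) J K"
proof -
  obtain L :: "'n list list" and M where M: "0 \<le> M" and le: "\<And>(f :: real^'n \<Rightarrow> real^'n) x i. smooth_map f \<Longrightarrow>
      ennreal (\<bar>f x $ i\<bar> powr p) \<le> ennreal M * (\<Sum>ss\<leftarrow>L. cube_Lp p (\<lambda>z. partials ss f z $ i) x)"
    using Sobolev_pointwise[OF p] by blast
  define m where "m = M * real (length L)"
  have m: "0 \<le> m" using M by (simp add: m_def)
  have "\<bar>f x $ i\<bar> \<le> m powr (1 / p) * C"
    if C: "0 < C" and f: "smooth_map f" and b: "\<forall>js\<in>set L. Lp_bound p (\<lambda>x. partials js f x $ i) C"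
    for f :: "real^'n \<Rightarrow> real^'n" and i C x
  proof -
    have "ennreal (\<bar>f x $ i\<bar> powr p) \<le> ennreal M * ennreal (real (length L) * C powr p)"
      by (rule order_trans[OF le[OF f] mult_left_mono[OF sum_list_ennreal_le]])
        (use b f in \<open>auto intro!: cube_Lp_le smooth_map_continuous_component\<close>)
    also have "\<dots> = ennreal (m * C powr p)" using M by (simp add: ennreal_mult[symmetric] m_def mult.assoc)
    finally have "\<bar>f x $ i\<bar> powr p \<le> m * C powr p"
      using m by (subst (asm) ennreal_le_iff) auto
    then have "(\<bar>f x $ i\<bar> powr p) powr (1 / p) \<le> (m * C powr p) powr (1 / p)"
      using p by (intro powr_mono2) auto
    then show ?thesis using p C m by (simp add: powr_powr powr_mult)
  qed
  then have "controls_sup (Lp_bound p :: (real^'n \<Rightarrow> real) \<Rightarrow> _) (set L) (m powr (1 / p))"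
    by (simp add: controls_sup_def)
  then show ?thesis by blast
qed

text \<open>For \<open>z\<close> in the unit cube, \<open>F x + z\<close> lies within the radius
  \<open>r\<close> of \<open>x\<close>. A translation bounds the inner integral by one over the ball
  about \<open>x\<close>, in which \<open>F\<close> no longer occurs; exchanging the integrals then
  costs only the volume of that ball.\<close>

lemma cube_Lp_displaced:
  fixes g :: "real^'n \<Rightarrow> real" and F :: "real^'n \<Rightarrow> real^'n"
  assumes c: "continuous_on UNIV g" and F: "\<And>x. norm (F x - x) \<le> R" and g: "Lp_bound p g C"
  shows "(\<integral>\<^sup>+x. cube_Lp p g (F x) \<partial>lborel) \<le> emeasure lborel (cball (0 :: real^'n) (R + real CARD('n))) * ennreal (C powr p)"
proof -
  \<comment> \<open>Points of the unit cube have norm at most the dimension, by comparison with the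
    sum of the coordinates.\<close>
  define r where "r = R + real CARD('n)"
  have R: "0 \<le> R" using F[of 0] norm_ge_zero order_trans by blast
  have r: "0 \<le> r" using R by (simp add: r_def)
  define B where "B = {q :: (real^'n) \<times> (real^'n). norm (snd q - fst q) \<le> r}"
  have "closed B" unfolding B_def by (intro closed_Collect_le continuous_intros)
  then have [measurable]: "B \<in> sets borel" by (rule borel_closed)
  have [measurable]: "g \<in> borel_measurable borel" using c by (rule borel_measurable_continuous_onI)
  have "cube_Lp p g (F x) \<le> (\<integral>\<^sup>+w. indicator B (x, w) * ennreal (\<bar>g w\<bar> powr p) \<partial>lborel)" for x
  proof -
    have "cube_Lp p g (F x) \<le> (\<integral>\<^sup>+z. indicator B (x, F x + z) * ennreal (\<bar>g (F x + z)\<bar> powr p) \<partial>lborel)"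
      unfolding cube_Lp_def
    proof (rule nn_integral_mono)
      fix z :: "real^'n"
      have "(x, F x + z) \<in> B" if z: "z \<in> cbox 0 One"
      proof -
        have "\<bar>z $ i\<bar> \<le> 1" for i
        proof -
          have b: "axis i 1 \<in> (Basis :: (real^'n) set)" by (auto simp: Basis_vec_def)
          then have "One \<bullet> (axis i 1 :: real^'n) = 1"
            by (simp add: inner_sum_left inner_Basis)
          then show ?thesis
            using z b by (auto simp: mem_box inner_axis dest!: bspec[of _ _ "axis i 1"])
        qed
        then have "norm z \<le> (\<Sum>i\<in>(UNIV :: 'n set). 1)"
          by (intro order_trans[OF norm_le_l1_cart] sum_mono)
        moreover have "norm (F x + z - x) \<le> norm (F x - x) + norm z"
          using norm_triangle_ineq[of "F x - x" z] by (simp add: algebra_simps)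
        ultimately show ?thesis
          unfolding B_def r_def using F[of x] by simp
      qed
      then show "indicator (cbox 0 One) z * ennreal (\<bar>g (F x + z)\<bar> powr p) \<le> indicator B (x, F x + z) * ennreal (\<bar>g (F x + z)\<bar> powr p)"
        by (auto split: split_indicator)
    qed
    also have "\<dots> = (\<integral>\<^sup>+w. indicator B (x, w) * ennreal (\<bar>g w\<bar> powr p) \<partial>distr lborel borel ((+) (F x)))"
      by (subst nn_integral_distr) simp_all
    finally show ?thesis by (simp add: lborel_distr_plus)
  qed
  then have "(\<integral>\<^sup>+x. cube_Lp p g (F x) \<partial>lborel) \<le> (\<integral>\<^sup>+x. (\<integral>\<^sup>+w. indicator B (x, w) * ennreal (\<bar>g w\<bar> powr p) \<partial>lborel) \<partial>lborel)"
    by (intro nn_integral_mono)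
  also have "\<dots> = (\<integral>\<^sup>+w. (\<integral>\<^sup>+x. indicator B (x, w) * ennreal (\<bar>g w\<bar> powr p) \<partial>lborel) \<partial>lborel)"
    by (rule lborel_pair.Fubini'[symmetric]) measurable
  also have "\<dots> = (\<integral>\<^sup>+w. emeasure lborel (cball (0 :: real^'n) r) * ennreal (\<bar>g w\<bar> powr p) \<partial>lborel)"
  proof (rule nn_integral_cong)
    fix w :: "real^'n"
    have "indicator B (x, w) = (indicator (cball w r) x :: ennreal)" for x
      by (simp add: B_def indicator_def dist_norm)
    then have "(\<integral>\<^sup>+x. indicator B (x, w) * ennreal (\<bar>g w\<bar> powr p) \<partial>lborel) = emeasure lborel (cball w r) * ennreal (\<bar>g w\<bar> powr p)"
      by (simp only:) (subst nn_integral_multc, simp_all add: borel_measurable_indicator)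
    then show "(\<integral>\<^sup>+x. indicator B (x, w) * ennreal (\<bar>g w\<bar> powr p) \<partial>lborel) = emeasure lborel (cball (0 :: real^'n) r) * ennreal (\<bar>g w\<bar> powr p)"
      using r by (simp add: emeasure_cball)
  qed
  also have "\<dots> = emeasure lborel (cball (0 :: real^'n) r) * (\<integral>\<^sup>+w. ennreal (\<bar>g w\<bar> powr p) \<partial>lborel)"
    by (simp add: nn_integral_cmult)
  also have "\<dots> \<le> emeasure lborel (cball (0 :: real^'n) r) * ennreal (C powr p)"
    using g by (intro mult_left_mono) (auto simp: Lp_bound_def)
  finally show ?thesis by (simp add: r_def)
qed

text \<open>\<open>Sobolev_pointwise\<close> at the point \<open>F x\<close>, integrated over
  \<open>x\<close> by means of \<open>cube_Lp_displaced\<close>; continuity of \<open>F\<close>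
  provides measurability.\<close>

lemma displacement_control_Lp:
  assumes p: "1 \<le> p"
  shows "\<exists>J K. displacement_control (Lp_bound p :: (real^'n \<Rightarrow> real) \<Rightarrow> _) (Lp_bound p) R J K"
proof -
  obtain L :: "'n list list" and M where M: "0 \<le> M" and le: "\<And>(f :: real^'n \<Rightarrow> real^'n) x i. smooth_map f \<Longrightarrow>
      ennreal (\<bar>f x $ i\<bar> powr p) \<le> ennreal M * (\<Sum>ss\<leftarrow>L. cube_Lp p (\<lambda>z. partials ss f z $ i) x)"
    using Sobolev_pointwise[OF p] by blast
  define V where "V = measure lborel (cball (0 :: real^'n) (R + real CARD('n)))"
  have V: "emeasure lborel (cball (0 :: real^'n) (R + real CARD('n))) = ennreal V" "0 \<le> V"
    unfolding V_def using emeasure_bounded_finite[OF bounded_cball, of "0 :: real^'n" "R + real CARD('n)"]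
    by (auto intro!: emeasure_eq_ennreal_measure simp: less_top)
  define m where "m = M * (real (length L) * V)"
  have m: "0 \<le> m" using M V by (simp add: m_def)
  have "Lp_bound p (\<lambda>x. f (F x) $ i) (m powr (1 / p) * C)"
    if F: "continuous_on UNIV F" "\<forall>x. norm (F x - x) \<le> R" and C: "0 < C" and f: "smooth_map f"
      and b: "\<forall>js\<in>set L. Lp_bound p (\<lambda>x. partials js f x $ i) C"
    for F f :: "real^'n \<Rightarrow> real^'n" and i C
  proof -
    have [measurable]: "F \<in> borel_measurable borel" using F(1) by (rule borel_measurable_continuous_onI)
    have [measurable]: "(\<lambda>z. partials ss f z $ i) \<in> borel_measurable borel" for ss
      using f by (intro borel_measurable_continuous_onI smooth_map_continuous_component)
    have meas [measurable]: "(\<lambda>x. cube_Lp p (\<lambda>z. partials ss f z $ i) (F x)) \<in> borel_measurable lborel" for ss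
      unfolding cube_Lp_def by measurable
    have int: "(\<integral>\<^sup>+x. (\<Sum>ss\<leftarrow>L'. cube_Lp p (\<lambda>z. partials ss f z $ i) (F x)) \<partial>lborel)
        = (\<Sum>ss\<leftarrow>L'. \<integral>\<^sup>+x. cube_Lp p (\<lambda>z. partials ss f z $ i) (F x) \<partial>lborel)
        \<and> (\<lambda>x. \<Sum>ss\<leftarrow>L'. cube_Lp p (\<lambda>z. partials ss f z $ i) (F x)) \<in> borel_measurable lborel" for L'
    proof (induction L')
      case (Cons ss L')
      then show ?case
        using nn_integral_add[OF meas, of "\<lambda>x. \<Sum>ss\<leftarrow>L'. cube_Lp p (\<lambda>z. partials ss f z $ i) (F x)" ss]
        by (auto intro!: borel_measurable_add meas)
    qed simp
    have "(\<integral>\<^sup>+x. ennreal (\<bar>f (F x) $ i\<bar> powr p) \<partial>lborel) \<le>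
        (\<integral>\<^sup>+x. ennreal M * (\<Sum>ss\<leftarrow>L. cube_Lp p (\<lambda>z. partials ss f z $ i) (F x)) \<partial>lborel)"
      by (intro nn_integral_mono le f)
    also have "\<dots> = ennreal M * (\<Sum>ss\<leftarrow>L. \<integral>\<^sup>+x. cube_Lp p (\<lambda>z. partials ss f z $ i) (F x) \<partial>lborel)"
      using int[of L] by (simp add: nn_integral_cmult)
    also have "\<dots> \<le> ennreal M * ennreal (real (length L) * (V * C powr p))"
    proof (intro mult_left_mono sum_list_ennreal_le)
      fix ss assume ss: "ss \<in> set L"
      have "(\<integral>\<^sup>+x. cube_Lp p (\<lambda>z. partials ss f z $ i) (F x) \<partial>lborel) \<le> ennreal V * ennreal (C powr p)"
        unfolding V(1)[symmetric] using F(2) b ss f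
        by (intro cube_Lp_displaced smooth_map_continuous_component) auto
      then show "(\<integral>\<^sup>+x. cube_Lp p (\<lambda>z. partials ss f z $ i) (F x) \<partial>lborel) \<le> ennreal (V * C powr p)"
        using V(2) by (simp add: ennreal_mult)
    qed (use V(2) in auto)
    also have "\<dots> = ennreal (m * C powr p)"
      using M V(2) by (simp add: ennreal_mult[symmetric] m_def mult.assoc)
    also have "m * C powr p = (m powr (1 / p) * C) powr p"
      using m p C by (simp add: powr_mult powr_powr)
    finally show ?thesis using m C by (simp add: Lp_bound_def)
  qed
  then have "displacement_control (Lp_bound p :: (real^'n \<Rightarrow> real) \<Rightarrow> _) (Lp_bound p) R (set L) (m powr (1 / p))"
    by (simp add: displacement_control_def)
  then show ?thesis by blast
qed

section \<open>Lebesgue norms of vector fields and of their components\<close>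

lemma (in size_bound) norm_bound_components:
  fixes v :: "real^'n \<Rightarrow> real^'m"
  assumes v: "continuous_on UNIV v" and C: "\<And>i. N (\<lambda>x. v x $ i) (C i)"
  shows "N (\<lambda>x. norm (v x)) (\<Sum>i\<in>UNIV. C i)"
proof -
  have c: "continuous_on UNIV (\<lambda>x. \<bar>v x $ i\<bar>)" for i
    by (intro continuous_on_rabs continuous_on_component v)
  have "N (\<lambda>x. \<Sum>i\<in>UNIV. \<bar>v x $ i\<bar>) (\<Sum>i\<in>UNIV. C i)"
    by (intro sum_bound finite c dominated1[OF c continuous_on_component[OF v] C]) simp
  then show ?thesis
    by (rule dominated1[rotated 2])
      (auto intro!: continuous_intros v c norm_le_l1_cart order_trans[OF norm_le_l1_cart abs_ge_self])
qed

lemma (in size_bound) norm_bound_iff_components: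
  fixes v :: "real^'n \<Rightarrow> real^'m"
  assumes v: "continuous_on UNIV v"
  shows "(\<exists>C. N (\<lambda>x. norm (v x)) C) \<longleftrightarrow> (\<forall>i. \<exists>C. N (\<lambda>x. v x $ i) C)"
proof
  assume "\<exists>C. N (\<lambda>x. norm (v x)) C"
  then show "\<forall>i. \<exists>C. N (\<lambda>x. v x $ i) C"
    using dominated1[OF continuous_on_component[OF v] continuous_on_norm[OF v]] component_le_norm_cart
    by (metis abs_norm_cancel)
next
  assume "\<forall>i. \<exists>C. N (\<lambda>x. v x $ i) C"
  then obtain C where "\<And>i. N (\<lambda>x. v x $ i) (C i)" by metis
  then show "\<exists>C. N (\<lambda>x. norm (v x)) C"
    using norm_bound_components[OF v] by blast
qed

definition Lp_maps :: "real \<Rightarrow> (real^'n \<Rightarrow> real^'n) set" where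
  "Lp_maps p = {f. smooth_map f \<and> (\<forall>js. integrable lborel (\<lambda>x. norm (partials js f x) powr p))}"

lemma Lp_seminorm_nonneg: "0 \<le> Lp_seminorm p js f"
  by (simp add: Lp_seminorm_def)

text \<open>Connects the extended integral in \<open>Lp_bound\<close> with the Bochner integral in
  \<open>Lp_seminorm\<close>; the latter defaults to 0 without integrability, hence the restriction
  to \<open>Lp_maps\<close>.\<close>

lemma Lp_bound_iff_seminorm:
  assumes p: "1 \<le> p" and f: "f \<in> Lp_maps p"
  shows "Lp_bound p (\<lambda>x. norm (partials js f x)) C \<longleftrightarrow> Lp_seminorm p js f \<le> C"
proof -
  define I where "I = (LINT x|lborel. norm (partials js f x) powr p)"
  have I: "0 \<le> I" unfolding I_def by simp
  have "(\<integral>\<^sup>+x. ennreal (\<bar>norm (partials js f x)\<bar> powr p) \<partial>lborel) = ennreal I"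
    unfolding I_def using f by (simp add: nn_integral_eq_integral Lp_maps_def)
  then have "Lp_bound p (\<lambda>x. norm (partials js f x)) C \<longleftrightarrow> 0 \<le> C \<and> I \<le> C powr p"
    by (simp add: Lp_bound_def)
  also have "\<dots> \<longleftrightarrow> I powr (1 / p) \<le> C"
  proof
    assume C: "0 \<le> C \<and> I \<le> C powr p"
    then have "I powr (1 / p) \<le> (C powr p) powr (1 / p)"
      using p I by (intro powr_mono2) auto
    then show "I powr (1 / p) \<le> C" using p C by (simp add: powr_powr)
  next
    assume le: "I powr (1 / p) \<le> C"
    then have "(I powr (1 / p)) powr p \<le> C powr p"
      using p by (intro powr_mono2) auto
    moreover have "0 \<le> C" using le powr_ge_zero order_trans by blast
    ultimately show "0 \<le> C \<and> I \<le> C powr p" using p I by (simp add: powr_powr)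
  qed
  finally show ?thesis by (simp add: Lp_seminorm_def I_def)
qed

lemma Lp_maps_iff:
  fixes f :: "real^'n \<Rightarrow> real^'n"
  assumes p: "1 \<le> p" and f: "smooth_map f"
  shows "f \<in> Lp_maps p \<longleftrightarrow> (\<forall>js. \<exists>C. Lp_bound p (\<lambda>x. norm (partials js f x)) C)"
proof
  assume "f \<in> Lp_maps p"
  then show "\<forall>js. \<exists>C. Lp_bound p (\<lambda>x. norm (partials js f x)) C"
    using Lp_bound_iff_seminorm[OF p] by blast
next
  assume b: "\<forall>js. \<exists>C. Lp_bound p (\<lambda>x. norm (partials js f x)) C"
  have "integrable lborel (\<lambda>x. norm (partials js f x) powr p)" for js
  proof (rule integrableI_bounded)
    have [measurable]: "partials js f \<in> borel_measurable borel"
      by (intro borel_measurable_continuous_onI smooth_map_continuous f)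
    show "(\<lambda>x. norm (partials js f x) powr p) \<in> borel_measurable lborel" by measurable
    obtain C where "Lp_bound p (\<lambda>x. norm (partials js f x)) C" using b by blast
    then show "(\<integral>\<^sup>+x. ennreal (norm (norm (partials js f x) powr p)) \<partial>lborel) < \<infinity>"
      by (auto simp: Lp_bound_def intro: le_less_trans[OF _ ennreal_less_top])
  qed
  then show "f \<in> Lp_maps p" using f by (simp add: Lp_maps_def)
qed

lemma Lp_bound_add:
  fixes f g :: "real^'n \<Rightarrow> real^'n"
  assumes p: "1 \<le> p" and f: "f \<in> Lp_maps p" and g: "g \<in> Lp_maps p"
  shows "Lp_bound p (\<lambda>x. norm (partials js (f + g) x)) (Lp_seminorm p js f + Lp_seminorm p js g)"
proof -
  interpret size_bound "Lp_bound p" by (rule size_bound_Lp[OF p])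
  have s: "smooth_map f" "smooth_map g" using f g by (auto simp: Lp_maps_def)
  have c: "continuous_on UNIV (\<lambda>x. norm (partials js h x))" if "smooth_map h" for h :: "real^'n \<Rightarrow> real^'n"
    by (intro continuous_on_norm smooth_map_continuous that)
  have "Lp_bound p (\<lambda>x. norm (partials js f x) + norm (partials js g x)) (Lp_seminorm p js f + Lp_seminorm p js g)"
    using f g by (intro triangle c s) (simp_all add: Lp_bound_iff_seminorm[OF p])
  then show ?thesis
    by (rule dominated1[rotated 2])
      (auto intro!: c s continuous_intros smooth_map_add(1) smooth_map_continuous simp: smooth_map_add(2)[OF s] intro: order_trans[OF norm_triangle_ineq])
qed

lemma Lp_bound_scale:
  fixes f :: "real^'n \<Rightarrow> real^'n"
  assumes p: "1 \<le> p" and f: "f \<in> Lp_maps p"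
  shows "Lp_bound p (\<lambda>x. norm (partials js (a *\<^sub>R f) x)) (\<bar>a\<bar> * Lp_seminorm p js f)"
proof -
  interpret size_bound "Lp_bound p" by (rule size_bound_Lp[OF p])
  have s: "smooth_map f" using f by (auto simp: Lp_maps_def)
  have c: "continuous_on UNIV (\<lambda>x. norm (partials js h x))" if "smooth_map h" for h :: "real^'n \<Rightarrow> real^'n"
    by (intro continuous_on_norm smooth_map_continuous that)
  show ?thesis
    by (rule dominated[OF c[OF smooth_map_scaleR(1)[OF s]] c[OF s]])
      (use f in \<open>auto simp: Lp_bound_iff_seminorm[OF p] smooth_map_scaleR(2)[OF s]\<close>)
qed

lemma seminorms_Lp:
  assumes p: "1 \<le> p"
  shows "seminorms (Lp_maps p :: (real^'n \<Rightarrow> real^'n) set) (range (Lp_seminorm p))"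
proof
  have sub_add: "f + g \<in> Lp_maps p" if "f \<in> Lp_maps p" "g \<in> Lp_maps p" for f g :: "real^'n \<Rightarrow> real^'n"
  proof -
    have s: "smooth_map (f + g)" using that by (auto simp: Lp_maps_def smooth_map_add(1))
    show ?thesis unfolding Lp_maps_iff[OF p s] using Lp_bound_add[OF p that] by blast
  qed
  have sub_scale: "a *\<^sub>R f \<in> Lp_maps p" if "f \<in> Lp_maps p" for a and f :: "real^'n \<Rightarrow> real^'n"
  proof -
    have s: "smooth_map (a *\<^sub>R f)" using that by (auto simp: Lp_maps_def smooth_map_scaleR(1))
    show ?thesis unfolding Lp_maps_iff[OF p s] using Lp_bound_scale[OF p that] by blast
  qed
  show "subspace (Lp_maps p :: (real^'n \<Rightarrow> real^'n) set)"
  proof (rule subspaceI)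
    show "0 \<in> (Lp_maps p :: (real^'n \<Rightarrow> real^'n) set)"
      unfolding zero_fun_def Lp_maps_def mem_Collect_eq partials_zero using smooth_map_zero p by simp
  qed (use sub_add sub_scale in auto)
  fix q :: "(real^'n \<Rightarrow> real^'n) \<Rightarrow> real" and f :: "real^'n \<Rightarrow> real^'n" assume q: "q \<in> range (Lp_seminorm p)" and f: "f \<in> Lp_maps p"
  then obtain js where q: "q = Lp_seminorm p js" by blast
  show "0 \<le> q f" by (simp add: q Lp_seminorm_nonneg)
  show "q (f + g) \<le> q f + q g" if "g \<in> Lp_maps p" for g
    using Lp_bound_add[OF p f that] Lp_bound_iff_seminorm[OF p sub_add[OF f that]] by (simp add: q)
  show "q (a *\<^sub>R f) \<le> \<bar>a\<bar> * q f" for a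
    using Lp_bound_scale[OF p f] Lp_bound_iff_seminorm[OF p sub_scale[OF f]] by (simp add: q)
qed

lemma function_space_sobolev:
  assumes p: "1 \<le> p"
  shows "function_space (sobolev_infty p :: (real^'n \<Rightarrow> real^'n) topology) {Lp_bound p}"
proof
  let ?T = "sobolev_infty p :: (real^'n \<Rightarrow> real^'n) topology"
  have T: "?T = seminorm_topology (Lp_maps p) (range (Lp_seminorm p))"
    by (simp add: sobolev_infty_def Lp_maps_def)
  interpret N: size_bound "Lp_bound p :: (real^'n \<Rightarrow> real) \<Rightarrow> _" by (rule size_bound_Lp[OF p])
  interpret seminorms "Lp_maps p :: (real^'n \<Rightarrow> real^'n) set" "range (Lp_seminorm p)"
    by (rule seminorms_Lp[OF p])
  show "lctvs ?T" unfolding T by (rule lctvs_topology)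
  show "\<forall>N\<in>{Lp_bound p :: (real^'n \<Rightarrow> real) \<Rightarrow> _}. size_bound N" using N.size_bound_axioms by simp
  show "topspace ?T = {f. smooth_map f \<and> (\<forall>N\<in>{Lp_bound p}. \<forall>js i. \<exists>C. N (\<lambda>x. partials js f x $ i) C)}"
  proof -
    have "f \<in> Lp_maps p \<longleftrightarrow> smooth_map f \<and> (\<forall>js i. \<exists>C. Lp_bound p (\<lambda>x. partials js f x $ i) C)" for f :: "real^'n \<Rightarrow> real^'n"
    proof (cases "smooth_map f")
      case True
      then show ?thesis
        using Lp_maps_iff[OF p True] N.norm_bound_iff_components[OF smooth_map_continuous[OF True]] by simp
    qed (simp add: Lp_maps_def)
    then show ?thesis unfolding T by auto
  qed
  show "\<exists>U. openin ?T U \<and> 0 \<in> U \<and> (\<forall>f\<in>U. N (\<lambda>x. partials js f x $ i) e)"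
    if N: "N \<in> {Lp_bound p}" and e: "0 < e" for N js i e
  proof -
    let ?U = "{f \<in> Lp_maps p. Lp_seminorm p js (f - 0) < e}"
    have "Lp_bound p (\<lambda>x. partials js f x $ i) e" if f: "f \<in> ?U" for f
    proof (rule N.dominated1)
      have s: "smooth_map f" using f by (simp add: Lp_maps_def)
      show "continuous_on UNIV (\<lambda>x. partials js f x $ i)" by (rule smooth_map_continuous_component[OF s])
      show "continuous_on UNIV (\<lambda>x. norm (partials js f x))" by (intro continuous_on_norm smooth_map_continuous s)
      show "Lp_bound p (\<lambda>x. norm (partials js f x)) e" using f by (simp add: Lp_bound_iff_seminorm[OF p])
      show "\<bar>partials js f x $ i\<bar> \<le> \<bar>norm (partials js f x)\<bar>" for x by (simp add: component_le_norm_cart)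
    qed
    then show ?thesis
      unfolding T using N ball_open[OF rangeI subspace_0[OF E], of js e] subspace_0[OF E] zero_value[OF rangeI, of js] e
      by (intro exI[of _ ?U]) auto
  qed
  show "limitin ?T f 0 sequentially" if fE: "range f \<subseteq> topspace ?T"
    and ev: "\<And>N js i e. N \<in> {Lp_bound p} \<Longrightarrow> 0 < e \<Longrightarrow> \<forall>\<^sub>F n in sequentially. N (\<lambda>x. partials js (f n) x $ i) e" for f
    unfolding T
  proof (rule limitin_zero)
    show fE: "range f \<subseteq> Lp_maps p" using fE by (simp add: T)
    fix q :: "(real^'n \<Rightarrow> real^'n) \<Rightarrow> real" and e :: real assume "q \<in> range (Lp_seminorm p)" and e: "0 < e"
    then obtain js where q: "q = Lp_seminorm p js" by blast
    define d where "d = e / (2 * real CARD('n))"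
    have d: "0 < d" using e by (simp add: d_def)
    have "\<forall>\<^sub>F n in sequentially. \<forall>i\<in>UNIV. Lp_bound p (\<lambda>x. partials js (f n) x $ i) d"
      by (intro eventually_ball_finite finite ballI ev d) simp
    then show "\<forall>\<^sub>F n in sequentially. q (f n) < e"
    proof eventually_elim
      case (elim n)
      have fn: "f n \<in> Lp_maps p" using fE by blast
      then have s: "smooth_map (f n)" by (simp add: Lp_maps_def)
      have "Lp_bound p (\<lambda>x. norm (partials js (f n) x)) (\<Sum>i\<in>(UNIV :: 'n set). d)"
        using elim by (intro N.norm_bound_components smooth_map_continuous s) auto
      then have "q (f n) \<le> e / 2"
        by (simp add: q Lp_bound_iff_seminorm[OF p fn] d_def)
      then show ?case using e by simp
    qed
  qed
  show "\<exists>N\<in>{Lp_bound p :: (real^'n \<Rightarrow> real) \<Rightarrow> _}. \<exists>J K. controls_sup N J K"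
    using controls_sup_Lp[OF p] by simp
  show "reparametrizable {Lp_bound p :: (real^'n \<Rightarrow> real) \<Rightarrow> _}"
    unfolding reparametrizable_def using displacement_control_Lp[where 'n='n, OF p] by blast
qed

theorem mainTheorem6:
  fixes p :: real and A :: "(real^'n \<Rightarrow> real^'n) topology"
  assumes "1 \<le> p"
    and "A \<in> {test_space, schwartz_space, sobolev_infty p, bounded_space}"
  shows "Diff_is_lie_group A"
  using assms(2) function_space.Diff_is_lie_group[OF function_space_test]
    function_space.Diff_is_lie_group[OF function_space_schwartz]
    function_space.Diff_is_lie_group[OF function_space_sobolev[OF assms(1)]]
    function_space.Diff_is_lie_group[OF function_space_bounded] by auto

end
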